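(* Let $\Omega=[a,b]$ with partition $a=x_0<x_1<\dots<x_m=b$, $\Omega_j=(x_{j-1},x_j)$, $m\ge 1$, and let $p,q,w$ be complex-valued functions on $\Omega$, extended periodically to $\mathbb{R}$ with period $\ell=b-a$. Assume: (1) for every $j\in\{1,\dots,m\}$: $p,w\in W^{2,\infty}(\Omega_j)$, $\inf_{x\in\overline{\Omega_j}}|p(x)|>0$ and $\inf_{x\in\overline{\Omega_j}}|w(x)|>0$; (2) $w/p=r^2$ on $\Omega$ for some $r:\Omega\to(0,\infty)$ (also extended $\ell$-periodically); (3) $q\in L^\infty(\Omega)$; (4) $(p\,r)(x_j^+)+(p\,r)(x_j^-)\neq 0$ for every $j\in\{1,\dots,m\}$. Let $\varphi\in\mathbb{R}$, and call $\lambda\in\mathbb{C}$ an eigenvalue if there is a nontrivial solution $y$ of $-(p\,y')'+q\,y=\lambda\,w\,y$ on $\Omega$ whose state vector $Y=(y,py')^{T}$ satisfies $Y(b^+)=e^{i\varphi}Y(a^+)$. Then only finitely many eigenvalues lie in the open left half-plane $\{\lambda\in\mathbb{C}:\operatorname{Re}(\lambda)<0\}$.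
   Context: A solution of $-(py')'+qy=\lambda wy$ on $\Omega$ is a function $y$ with $y,\,py'\in AC(\Omega)$ (absolutely continuous on $[a,b]$) satisfying the equation almost everywhere on $\Omega$. The state vector $Y=(y,py')^T$ is therefore continuous across each interface, $Y(x_j^+)=Y(x_j^-)$ for $j=1,\dots,m$; in particular, at $x_m=b$, $Y(b^+)=Y(b^-)$, so the boundary condition relates the value of $Y$ at $b$ to its value at $a$. $f(x^\pm)$ denotes the one-sided limits of $f$ at $x$. All interface values of $p,r$ are one-sided limits (these exist because $p,r\in W^{2,\infty}(\Omega_j)$). At $j=m$ the limit from the right is taken via the $\ell$-periodic extension, so $(pr)(x_m^+)=(pr)(a^+)$. $W^{2,\infty}(I)$ is the Sobolev space of functions on the open interval $I$ with weak derivatives up to order 2 in $L^\infty(I)$ (identified with their continuous representatives on $\overline I$). *)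

theory Defs
  imports "HOL-Analysis.Analysis"
begin

definition abs_continuous_on :: "real set \<Rightarrow> (real \<Rightarrow> complex) \<Rightarrow> bool" where
  "abs_continuous_on S f \<longleftrightarrow>
     (\<forall>\<epsilon>>0. \<exists>\<delta>>0. \<forall>D :: (real \<times> real) set.
        finite D \<and> (\<forall>(u, v)\<in>D. u < v \<and> {u..v} \<subseteq> S) \<and>
        disjoint_family_on (\<lambda>(u, v). {u<..<v}) D \<and> (\<Sum>(u, v)\<in>D. v - u) < \<delta>
        \<longrightarrow> (\<Sum>(u, v)\<in>D. cmod (f v - f u)) < \<epsilon>)"

definition L_infinity :: "real set \<Rightarrow> (real \<Rightarrow> complex) \<Rightarrow> bool" where
  "L_infinity S f \<longleftrightarrow>
     f \<in> borel_measurable (lebesgue_on S) \<and>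
     (\<exists>C. AE x in lebesgue_on S. cmod (f x) \<le> C)"

definition test_function :: "real set \<Rightarrow> (real \<Rightarrow> real) \<Rightarrow> bool" where
  "test_function I \<phi> \<longleftrightarrow>
     (\<forall>n. (deriv ^^ n) \<phi> differentiable_on UNIV) \<and>
     (\<exists>K. compact K \<and> K \<subseteq> I \<and> (\<forall>x. x \<notin> K \<longrightarrow> \<phi> x = 0))"

definition has_weak_deriv ::
  "nat \<Rightarrow> real set \<Rightarrow> (real \<Rightarrow> complex) \<Rightarrow> (real \<Rightarrow> complex) \<Rightarrow> bool" where
  "has_weak_deriv k I f g \<longleftrightarrow>
     (\<forall>\<phi>. test_function I \<phi> \<longrightarrow>
        (LINT x:I|lebesgue. (deriv ^^ k) \<phi> x *\<^sub>R f x)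
          = (-1) ^ k * (LINT x:I|lebesgue. \<phi> x *\<^sub>R g x))"

text \<open>
  The space \<open>W\<^sup>2\<^sup>,\<^sup>\<infinity>(I)\<close> for an open interval \<open>I\<close>. Its elements are identified with their
  continuous representatives, hence the continuity clause.
\<close>

definition W2_infinity :: "real set \<Rightarrow> (real \<Rightarrow> complex) \<Rightarrow> bool" where
  "W2_infinity I f \<longleftrightarrow>
     continuous_on I f \<and> L_infinity I f \<and>
     (\<forall>k\<in>{1, 2}. \<exists>g. L_infinity I g \<and> has_weak_deriv k I f g)"

text \<open>
  The continuous extension of \<open>f\<close> from \<open>I\<close> to \<open>closure I\<close>. The values that \<open>f\<close> itself takes
  at the end points of \<open>I\<close> are not used.
\<close>

definition closure_ext :: "real set \<Rightarrow> (real \<Rightarrow> complex) \<Rightarrow> real \<Rightarrow> complex" where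
  "closure_ext I f x = Lim (at x within I) f"

text \<open>
  The \<open>(b - a)\<close>-periodic extension of \<open>f\<close> from \<open>[a, b)\<close>. The value of \<open>f\<close> at \<open>b\<close> is discarded,
  as \<open>f a = f b\<close> is not assumed; one-sided limits do not depend on this choice.
\<close>

definition periodic_ext :: "real \<Rightarrow> real \<Rightarrow> (real \<Rightarrow> 'a) \<Rightarrow> real \<Rightarrow> 'a" where
  "periodic_ext a b f x = f (a + (b - a) * frac ((x - a) / (b - a)))"

definition right_limit :: "real \<Rightarrow> (real \<Rightarrow> complex) \<Rightarrow> complex" where
  "right_limit x f = Lim (at_right x) f"

definition left_limit :: "real \<Rightarrow> (real \<Rightarrow> complex) \<Rightarrow> complex" where
  "left_limit x f = Lim (at_left x) f"

definition subinterval :: "(nat \<Rightarrow> real) \<Rightarrow> nat \<Rightarrow> real set" where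
  "subinterval x j = {x (j - 1)<..<x j}"

text \<open>
  \<open>y\<close> solves \<open>-(p y')' + q y = \<mu> w y\<close> on \<open>[a, b]\<close>, with \<open>u\<close> the absolutely continuous function
  that represents \<open>p y'\<close> (which is determined only almost everywhere by \<open>p\<close> and \<open>y\<close>).
\<close>

definition SL_solution ::
  "real \<Rightarrow> real \<Rightarrow> (real \<Rightarrow> complex) \<Rightarrow> (real \<Rightarrow> complex) \<Rightarrow> (real \<Rightarrow> complex) \<Rightarrow> complex
   \<Rightarrow> (real \<Rightarrow> complex) \<Rightarrow> (real \<Rightarrow> complex) \<Rightarrow> bool" where
  "SL_solution a b p q w \<mu> y u \<longleftrightarrow>
     abs_continuous_on {a..b} y \<and> abs_continuous_on {a..b} u \<and>
     (AE x in lebesgue_on {a..b}. \<exists>y' u'.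
        (y has_vector_derivative y') (at x within {a..b}) \<and> u x = p x * y' \<and>
        (u has_vector_derivative u') (at x within {a..b}) \<and>
        - u' + q x * y x = \<mu> * w x * y x)"

text \<open>
  The components of the state vector \<open>(y, u)\<close> are continuous on \<open>[a, b]\<close> and continuous across
  \<open>b\<close>, so its one-sided limits \<open>a\<^sup>+\<close> and \<open>b\<^sup>+\<close> are its values at \<open>a\<close> and \<open>b\<close>.
\<close>

definition SL_eigenvalue ::
  "real \<Rightarrow> real \<Rightarrow> (real \<Rightarrow> complex) \<Rightarrow> (real \<Rightarrow> complex) \<Rightarrow> (real \<Rightarrow> complex) \<Rightarrow> real
   \<Rightarrow> complex \<Rightarrow> bool" where
  "SL_eigenvalue a b p q w \<phi> \<mu> \<longleftrightarrow>
     (\<exists>y u. SL_solution a b p q w \<mu> y u \<and> (\<exists>x\<in>{a..b}. y x \<noteq> 0) \<and>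
        y b = exp (\<i> * of_real \<phi>) * y a \<and> u b = exp (\<i> * of_real \<phi>) * u a)"

end

theory Submission
  imports Defs "HOL-Complex_Analysis.Complex_Analysis"
begin

text \<open>
  Write \<open>\<mu> = -\<kappa>\<^sup>2\<close>, \<open>s = p r\<close> and \<open>u = p y'\<close>. As \<open>w = r\<^sup>2 p\<close>, the equation is the system
  \<open>y' = (r / s) u\<close>, \<open>u' = (q + \<kappa>\<^sup>2 r s) y\<close>. If \<open>Re \<mu> < 0\<close>, then \<open>\<kappa>\<close> can be chosen with
  \<open>Re \<kappa> > \<bar>Im \<kappa>\<bar>\<close>, so that \<open>Re \<kappa>\<close> and \<open>\<bar>\<kappa>\<bar>\<close> are of the same size. The set of eigenvalues in the half-plane
  is finite for two reasons.

  There are none with \<open>\<bar>\<mu>\<bar>\<close> large. On one piece of the partition the combinations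
  \<open>P = u + \<kappa> s y\<close> and \<open>M = u - \<kappa> s y\<close> satisfy \<open>P' \<approx> \<kappa> r P\<close> and \<open>M' \<approx> -\<kappa> r M\<close>. Hence a form
  \<open>A \<bar>P\<bar>\<^sup>2 - B \<bar>M\<bar>\<^sup>2\<close>, with positive weights \<open>A\<close> and \<open>B\<close> that may vary along the piece, increases
  strictly once \<open>Re \<kappa>\<close> is large, whatever the weights are. At an interface from \<open>s\<^sub>-\<close> to \<open>s\<^sub>+\<close> the pair
  \<open>(P, M)\<close> is replaced by \<open>(\<alpha> P + \<beta> M, \<beta> P + \<alpha> M)\<close>, where \<open>\<alpha> = (s\<^sub>- + s\<^sub>+) / (2 s\<^sub>-)\<close>; because
  \<open>\<alpha> \<noteq> 0\<close>, the form does not drop there if its weights in front of the interface are \<open>\<eta>\<close> and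
  \<open>1 / \<eta>\<close> and those behind it are \<open>1\<close> and \<open>\<eta>\<close>, for a small \<open>\<eta>\<close> (\<open>interface_form\<close>). The boundary
  condition multiplies \<open>P\<close> and \<open>M\<close> by a number of modulus one, so it leaves the form unchanged. After a
  full period the form is back at its old value, so it was constant, and the solution vanishes
  (\<open>lyapunov_interval\<close>, \<open>no_large_eigensolution\<close>).

  The derivative of \<open>s\<close> would enter through \<open>P'\<close>. It is avoided: \<open>s\<close> is replaced by a smooth
  function that is uniformly close to it and agrees with it at the end points. The error is then at most
  a small multiple of \<open>\<bar>\<kappa>\<bar>\<close>, which the growth rate of order \<open>Re \<kappa>\<close> absorbs
  (\<open>smooth_approximation\<close>, \<open>wkb_error_bound\<close>). This calls for \<open>s\<close> to be continuous up to the end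
  points of each piece. Continuity of \<open>p\<close> and \<open>w\<close> there follows from the bounded first weak derivative, by
  testing with a smooth function close to the indicator of an interval (\<open>weak_deriv_lipschitz\<close>).

  In a bounded region the eigenvalues are zeros of an entire function. The fundamental system is the
  sum of the Picard iterates, each of which is a polynomial in \<open>\<mu>\<close>; the determinant \<open>D\<close> of the
  monodromy matrix minus \<open>exp (\<i> \<phi>)\<close> is therefore entire (\<open>quasi_periodic_zeros\<close>). By the first part
  \<open>D\<close> does not vanish identically, so it has finitely many zeros in a disc.

  The coefficients are merely measurable, so solutions are handled in two forms: as
  solutions of integral equations, which suits the Picard iteration, and as Lipschitz functions that are
  differentiable almost everywhere, which suits the quadratic form. The bridge is the fundamental theorem of
  calculus for absolutely continuous functions and the differentiability almost everywhere of indefinite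
  integrals.
\<close>

section \<open>Absolute continuity and derivatives almost everywhere\<close>

lemma abs_continuous_on_subset: "abs_continuous_on S f \<Longrightarrow> T \<subseteq> S \<Longrightarrow> abs_continuous_on T f"
proof -
  assume f: "abs_continuous_on S f" and T: "T \<subseteq> S"
  show ?thesis
    unfolding abs_continuous_on_def
  proof (intro allI impI)
    fix e :: real assume "e > 0"
    then obtain d where d: "d > 0" "\<And>D. finite D \<and> (\<forall>(u, v)\<in>D. u < v \<and> {u..v} \<subseteq> S) \<and>
        disjoint_family_on (\<lambda>(u, v). {u<..<v}) D \<and> (\<Sum>(u, v)\<in>D. v - u) < d
        \<Longrightarrow> (\<Sum>(u, v)\<in>D. cmod (f v - f u)) < e"
      using f unfolding abs_continuous_on_def by meson
    show "\<exists>d>0. \<forall>D. finite D \<and> (\<forall>(u, v)\<in>D. u < v \<and> {u..v} \<subseteq> T) \<and>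
        disjoint_family_on (\<lambda>(u, v). {u<..<v}) D \<and> (\<Sum>(u, v)\<in>D. v - u) < d
        \<longrightarrow> (\<Sum>(u, v)\<in>D. cmod (f v - f u)) < e"
    proof (intro exI[of _ d] conjI allI impI d)
      fix D :: "(real \<times> real) set"
      assume "finite D \<and> (\<forall>(u, v)\<in>D. u < v \<and> {u..v} \<subseteq> T) \<and>
        disjoint_family_on (\<lambda>(u, v). {u<..<v}) D \<and> (\<Sum>(u, v)\<in>D. v - u) < d"
      then show "finite D" "disjoint_family_on (\<lambda>(u, v). {u<..<v}) D" "(\<Sum>(u, v)\<in>D. v - u) < d"
        "\<forall>(u, v)\<in>D. u < v \<and> {u..v} \<subseteq> S"
        using T by (blast+)
    qed
  qed
qed

text \<open>
  A gauge argument. Off the null set \<open>N\<close> the gauge comes from the derivative. On \<open>N\<close> it keeps the tagged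
  intervals inside an open set around \<open>N\<close> of small measure, where absolute continuity makes the increments of
  \<open>f\<close> small in total.
\<close>
lemma abs_continuous_has_integral:
  fixes f f' :: "real \<Rightarrow> complex"
  assumes ab: "a \<le> b" and ac: "abs_continuous_on {a..b} f" and N: "negligible N"
    and der: "\<And>x. x \<in> {a..b} - N \<Longrightarrow> (f has_vector_derivative f' x) (at x within {a..b})"
  shows "(f' has_integral (f b - f a)) {a..b}"
proof -
  define g where "g x = (if x \<in> N then 0 else f' x)" for x
  have "(g has_integral (f b - f a)) (cbox a b)"
    unfolding has_integral
  proof (intro allI impI)
    fix e :: real assume e: "e > 0"
    define e' where "e' = e / (2 * (b - a + 1))"
    have e': "e' > 0" "e' * (b - a) < e / 2"
      using e ab by (auto simp: e'_def field_simps)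
    obtain \<delta> where \<delta>: "\<delta> > 0" and ac': "\<And>D. finite D \<Longrightarrow> (\<forall>(u, v)\<in>D. u < v \<and> {u..v} \<subseteq> {a..b}) \<Longrightarrow>
        disjoint_family_on (\<lambda>(u, v). {u<..<v}) D \<Longrightarrow> (\<Sum>(u, v)\<in>D. v - u) < \<delta>
        \<Longrightarrow> (\<Sum>(u, v)\<in>D. cmod (f v - f u)) < e / 2"
      using ac[unfolded abs_continuous_on_def, rule_format, of "e/2"] e by auto
    have Nm: "N \<in> lmeasurable" using N by (simp add: negligible_imp_measurable)
    obtain T where T: "open T" "N \<subseteq> T" "T - N \<in> lmeasurable" "emeasure lebesgue (T - N) < ennreal \<delta>"
      using sets_lebesgue_outer_open[OF negligible_imp_sets[OF N] \<delta>] by blast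
    have TN: "T = N \<union> (T - N)" using T(2) by blast
    have Tm: "T \<in> lmeasurable" using Nm T(3) by (subst TN) (rule fmeasurable.Un)
    have "measure lebesgue T \<le> measure lebesgue N + measure lebesgue (T - N)"
      by (subst TN) (rule measure_Un_le; use Nm T(3) in blast)
    also have "\<dots> < \<delta>"
      using T(4) \<delta> negligible_imp_measure0[OF N] emeasure_eq_measure2[OF T(3)] by (simp add: ennreal_less_iff)
    finally have Tlt: "measure lebesgue T < \<delta>" .
    have "\<exists>d. d > 0 \<and> ball x d \<subseteq> T" if "x \<in> N" for x
      using T(1,2) that by (meson openE subsetD)
    moreover have "\<exists>d. d > 0 \<and> (\<forall>y\<in>{a..b}. norm (y - x) < d \<longrightarrow> 
        norm (f y - f x - (y - x) *\<^sub>R f' x) \<le> e' * norm (y - x))" if "x \<in> {a..b} - N" for x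
      using der[OF that] e'(1) unfolding has_vector_derivative_def has_derivative_within_alt by blast
    ultimately have "\<exists>d. d > 0 \<and> (x \<in> N \<longrightarrow> ball x d \<subseteq> T) \<and> (x \<in> {a..b} - N \<longrightarrow> (\<forall>y\<in>{a..b}. norm (y - x) < d \<longrightarrow> 
        norm (f y - f x - (y - x) *\<^sub>R f' x) \<le> e' * norm (y - x)))" for x
      by (cases "x \<in> N"; cases "x \<in> {a..b}") (auto intro: exI[of _ 1])
    then obtain d where d0: "\<And>x. d x > 0" and dN: "\<And>x. x \<in> N \<Longrightarrow> ball x (d x) \<subseteq> T"
      and dD: "\<And>x y. x \<in> {a..b} - N \<Longrightarrow> y \<in> {a..b} \<Longrightarrow> norm (y - x) < d x \<Longrightarrow>
         norm (f y - f x - (y - x) *\<^sub>R f' x) \<le> e' * norm (y - x)"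
      by metis
    show "\<exists>\<gamma>. gauge \<gamma> \<and> (\<forall>\<D>. \<D> tagged_division_of cbox a b \<and> \<gamma> fine \<D> \<longrightarrow>
           norm ((\<Sum>(x, k)\<in>\<D>. measure lborel k *\<^sub>R g x) - (f b - f a)) < e)"
    proof (intro exI conjI allI impI)
      show "gauge (\<lambda>x. ball x (d x))" using d0 by (intro gauge_ball_dependent) auto
      fix p assume p: "p tagged_division_of cbox a b \<and> (\<lambda>x. ball x (d x)) fine p"
      then have pt: "p tagged_division_of cbox a b" and fine: "\<And>x k. (x, k) \<in> p \<Longrightarrow> k \<subseteq> ball x (d x)"
        by (auto simp: fine_def)
      note fin = tagged_division_ofD(1)[OF pt]
      have iv: "\<exists>u v. u \<le> v \<and> k = {u..v} \<and> x \<in> k \<and> k \<subseteq> {a..b}" if "(x, k) \<in> p" for x k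
      proof -
        from tagged_division_ofD(4)[OF pt that] obtain u v where "k = cbox u v" by blast
        then show ?thesis using tagged_division_ofD(2,3)[OF pt that]
          by (auto intro!: exI[of _ u] exI[of _ v])
      qed
      \<comment> \<open>The increments of \<open>f\<close> telescope, so the Riemann sum is compared with them interval by interval.\<close>
      have tel: "(\<Sum>(x, k)\<in>p. f (Sup k) - f (Inf k)) = f b - f a"
        using additive_tagged_division_1[of a b p f] pt ab by simp
      have "norm ((\<Sum>(x, k)\<in>p. measure lborel k *\<^sub>R g x) - (f b - f a))
          = norm (\<Sum>(x, k)\<in>p. measure lborel k *\<^sub>R g x - (f (Sup k) - f (Inf k)))"
        unfolding tel[symmetric] sum_subtractf[symmetric] by (simp add: split_def)
      also have "\<dots> \<le> (\<Sum>(x, k)\<in>p. (if x \<in> N then norm (f (Sup k) - f (Inf k)) else 0) + e' * measure lborel k)"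
      proof (rule sum_norm_le)
        fix z assume z: "z \<in> p"
        obtain x k where zk: "z = (x, k)" by (cases z)
        obtain u v where uv: "u \<le> v" "k = {u..v}" "x \<in> k" "k \<subseteq> {a..b}" using iv z zk by blast
        have "norm (measure lborel k *\<^sub>R g x - (f v - f u)) \<le> (if x \<in> N then norm (f v - f u) else 0) + e' * measure lborel k"
        proof (cases "x \<in> N")
          case True
          then show ?thesis using e' uv by (simp add: g_def norm_minus_commute)
        next
          case False
          have "u \<in> k" "v \<in> k" using uv by auto
          then have "u \<in> ball x (d x)" "v \<in> ball x (d x)"
            using fine[of x k] z zk by auto
          then have xu: "\<bar>u - x\<bar> < d x" "\<bar>v - x\<bar> < d x"
            by (auto simp: dist_real_def)
          have 1: "norm (f u - f x - (u - x) *\<^sub>R f' x) \<le> e' * norm (u - x)"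
            using uv False xu by (intro dD) auto
          have 2: "norm (f v - f x - (v - x) *\<^sub>R f' x) \<le> e' * norm (v - x)"
            using uv False xu by (intro dD) auto
          have "measure lborel k *\<^sub>R g x - (f v - f u) = 
             (f u - f x - (u - x) *\<^sub>R f' x) - (f v - f x - (v - x) *\<^sub>R f' x)"
            using uv False by (simp add: g_def algebra_simps)
          also have "norm \<dots> \<le> e' * norm (u - x) + e' * norm (v - x)"
            by (rule order_trans[OF norm_triangle_ineq4 add_mono[OF 1 2]])
          also have "\<dots> = e' * measure lborel k" using uv by (simp add: algebra_simps)
          finally show ?thesis using False by simp
        qed
        then show "norm (case z of (x, k) \<Rightarrow> measure lborel k *\<^sub>R g x - (f (Sup k) - f (Inf k))) \<le>
           (case z of (x, k) \<Rightarrow> (if x \<in> N then norm (f (Sup k) - f (Inf k)) else 0) + e' * measure lborel k)"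
          using uv zk by (auto split: if_splits)
      qed
      also have "\<dots> = (\<Sum>(x, k)\<in>p. if x \<in> N then norm (f (Sup k) - f (Inf k)) else 0) + e' * (b - a)"
      proof -
        have "(\<Sum>(x, k)\<in>p. e' * measure lborel k) = e' * (b - a)"
          using additive_content_tagged_division[OF pt] ab
          by (simp add: split_def flip: sum_distrib_left)
        then show ?thesis by (simp add: split_def sum.distrib)
      qed
      also have "(\<Sum>(x, k)\<in>p. if x \<in> N then norm (f (Sup k) - f (Inf k)) else 0) < e / 2"
      proof -
        \<comment> \<open>Degenerate intervals contribute nothing; they are left out so that distinct members of \<open>P\<close> are distinct intervals.\<close>
        define P where "P = {z\<in>p. fst z \<in> N \<and> Inf (snd z) < Sup (snd z)}"
        define h where "h = (\<lambda>z::real \<times> real set. (Inf (snd z), Sup (snd z)))"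
        have finP: "finite P" using fin by (simp add: P_def)
        have ivP: "snd z = {Inf (snd z)..Sup (snd z)} \<and> snd z \<subseteq> {a..b} \<and> snd z \<subseteq> T \<and> z \<in> p" if "z \<in> P" for z
        proof -
          have zp: "(fst z, snd z) \<in> p" "fst z \<in> N" using that by (auto simp: P_def)
          show ?thesis using iv[OF zp(1)] fine[OF zp(1)] dN[OF zp(2)] zp(1) by auto
        qed
        have disj: "z1 = z2 \<or> {Inf (snd z1)<..<Sup (snd z1)} \<inter> {Inf (snd z2)<..<Sup (snd z2)} = {}"
          if "z1 \<in> P" "z2 \<in> P" for z1 z2
        proof (cases "z1 = z2")
          case False
          have "(fst z1, snd z1) \<in> p" "(fst z2, snd z2) \<in> p" using that by (auto simp: P_def)
          then have "interior (snd z1) \<inter> interior (snd z2) = {}"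
            using tagged_division_ofD(5)[OF pt, of "fst z1" "snd z1" "fst z2" "snd z2"] False
            by (auto simp: prod_eq_iff)
          moreover have "interior (snd z1) = {Inf (snd z1)<..<Sup (snd z1)}"
            "interior (snd z2) = {Inf (snd z2)<..<Sup (snd z2)}"
            using ivP[OF that(1)] ivP[OF that(2)] interior_atLeastAtMost_real[of "Inf (snd z1)" "Sup (snd z1)"]
              interior_atLeastAtMost_real[of "Inf (snd z2)" "Sup (snd z2)"] by argo+
          ultimately show ?thesis by auto
        qed simp
        have inj: "inj_on h P"
        proof (rule inj_onI)
          fix z1 z2 assume z: "z1 \<in> P" "z2 \<in> P" "h z1 = h z2"
          have "{Inf (snd z1)<..<Sup (snd z1)} \<noteq> {}" using z(1) by (auto simp: P_def)
          then show "z1 = z2" using disj[OF z(1,2)] z(3) by (auto simp: h_def)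
        qed
        have "(\<Sum>(x, k)\<in>p. if x \<in> N then norm (f (Sup k) - f (Inf k)) else 0) = 
           (\<Sum>z\<in>P. norm (f (Sup (snd z)) - f (Inf (snd z))))"
        proof (rule sum.mono_neutral_cong_right[OF fin])
          show "P \<subseteq> p" by (auto simp: P_def)
          show "\<forall>i\<in>p - P. (case i of (x, k) \<Rightarrow> if x \<in> N then norm (f (Sup k) - f (Inf k)) else 0) = 0"
          proof
            fix z assume z: "z \<in> p - P"
            obtain x k where zk: "z = (x, k)" by (cases z)
            obtain u v where "u \<le> v" "k = {u..v}" using iv z zk by blast
            then show "(case z of (x, k) \<Rightarrow> if x \<in> N then norm (f (Sup k) - f (Inf k)) else 0) = 0"
              using z zk by (auto simp: P_def)
          qed
        qed (auto simp: P_def)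
        also have "\<dots> = (\<Sum>(u, v)\<in>h ` P. norm (f v - f u))"
          by (subst sum.reindex[OF inj]) (simp add: h_def o_def)
        also have "\<dots> < e / 2"
        proof (rule ac')
          show "finite (h ` P)" using finP by simp
          have "{Inf (snd z)..Sup (snd z)} \<subseteq> {a..b}" if "z \<in> P" for z
            using ivP[OF that] by argo
          then show "\<forall>(u, v)\<in>h ` P. u < v \<and> {u..v} \<subseteq> {a..b}"
            by (auto simp: h_def P_def simp del: atLeastatMost_subset_iff)
          show "disjoint_family_on (\<lambda>(u, v). {u<..<v}) (h ` P)"
            using disj unfolding disjoint_family_on_def h_def by fastforce
          have "(\<Sum>(u, v)\<in>h ` P. v - u) = (\<Sum>z\<in>P. Sup (snd z) - Inf (snd z))"
            by (subst sum.reindex[OF inj]) (simp add: h_def o_def)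
          also have "\<dots> = (\<Sum>z\<in>P. measure lebesgue {Inf (snd z)<..<Sup (snd z)})"
            by (intro sum.cong) (auto simp: P_def)
          also have "\<dots> = measure lebesgue (\<Union>z\<in>P. {Inf (snd z)<..<Sup (snd z)})"
          proof (rule measure_UNION'[symmetric, OF finP])
            show "pairwise (\<lambda>i j. disjnt {Inf (snd i)<..<Sup (snd i)} {Inf (snd j)<..<Sup (snd j)}) P"
              unfolding pairwise_def disjnt_def using disj by blast
          qed auto
          also have "\<dots> \<le> measure lebesgue T"
          proof (rule measure_mono_fmeasurable[OF _ _ Tm])
            show "(\<Union>z\<in>P. {Inf (snd z)<..<Sup (snd z)}) \<subseteq> T"
            proof (rule UN_least)
              fix z assume z: "z \<in> P"
              have "{Inf (snd z)<..<Sup (snd z)} \<subseteq> {Inf (snd z)..Sup (snd z)}" by auto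
              also have "\<dots> \<subseteq> T" using ivP[OF z] by argo
              finally show "{Inf (snd z)<..<Sup (snd z)} \<subseteq> T" .
            qed
          qed (use finP in auto)
          also have "\<dots> < \<delta>" by (rule Tlt)
          finally show "(\<Sum>(u, v)\<in>h ` P. v - u) < \<delta>" .
        qed
        finally show ?thesis .
      qed
      finally show "norm ((\<Sum>(x, k)\<in>p. measure lborel k *\<^sub>R g x) - (f b - f a)) < e" using e' by linarith
    qed
  qed
  then have "(g has_integral (f b - f a)) {a..b}" by simp
  then show ?thesis
    by (rule has_integral_spike[OF N, rotated]) (auto simp: g_def)
qed

lemma lipschitz_abs_continuous_on:
  assumes "L-lipschitz_on S f"
  shows "abs_continuous_on S f"
  unfolding abs_continuous_on_def
proof (intro allI impI)
  fix e :: real assume e: "e > 0"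
  have L: "L \<ge> 0" using assms lipschitz_on_nonneg by blast
  show "\<exists>\<delta>>0. \<forall>D. finite D \<and> (\<forall>(u, v)\<in>D. u < v \<and> {u..v} \<subseteq> S) \<and>
        disjoint_family_on (\<lambda>(u, v). {u<..<v}) D \<and> (\<Sum>(u, v)\<in>D. v - u) < \<delta>
        \<longrightarrow> (\<Sum>(u, v)\<in>D. cmod (f v - f u)) < e"
  proof (intro exI[of _ "e / (L + 1)"] conjI allI impI)
    show "e / (L + 1) > 0" using e L by simp
    fix D :: "(real \<times> real) set"
    assume D: "finite D \<and> (\<forall>(u, v)\<in>D. u < v \<and> {u..v} \<subseteq> S) \<and>
        disjoint_family_on (\<lambda>(u, v). {u<..<v}) D \<and> (\<Sum>(u, v)\<in>D. v - u) < e / (L + 1)"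
    have "(\<Sum>(u, v)\<in>D. cmod (f v - f u)) \<le> (\<Sum>(u, v)\<in>D. (L + 1) * (v - u))"
    proof (rule sum_mono, clarify)
      fix u v assume uv: "(u, v) \<in> D"
      then have "u < v" "{u..v} \<subseteq> S" using D by auto
      then have "cmod (f v - f u) \<le> L * (v - u)"
        using lipschitz_onD[OF assms, of v u] by (simp add: dist_norm subset_iff)
      also have "\<dots> \<le> (L + 1) * (v - u)" using \<open>u < v\<close> by (simp add: algebra_simps)
      finally show "cmod (f v - f u) \<le> (L + 1) * (v - u)" .
    qed
    also have "\<dots> = (L + 1) * (\<Sum>(u, v)\<in>D. v - u)" by (simp add: sum_distrib_left split_def)
    also have "\<dots> < (L + 1) * (e / (L + 1))" using D L by (intro mult_strict_left_mono) auto
    finally show "(\<Sum>(u, v)\<in>D. cmod (f v - f u)) < e" using L by simp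
  qed
qed

text \<open>
  The library controls the difference quotients to the right of almost every point. Applying this to the reflected
  function gives the quotients to the left.
\<close>
lemma indefinite_integral_has_vector_derivative_ae:
  fixes f :: "real \<Rightarrow> 'b::euclidean_space"
  assumes f: "f integrable_on {a..b}"
  obtains N where "negligible N"
    "\<And>x. x \<in> {a..b} - N \<Longrightarrow> ((\<lambda>t. integral {a..t} f) has_vector_derivative f x) (at x within {a..b})"
proof -
  define g where "g x = (if x \<in> {a..b} then f x else 0)" for x
  have gU: "g integrable_on UNIV" unfolding g_def using f integrable_restrict_UNIV by blast
  have g: "g integrable_on cbox c d" for c d
    using gU integrable_on_subcbox by blast
  have g': "(\<lambda>x. g (- x)) integrable_on cbox c d" for c d
    using g[where c="-d" and d="-c"] Henstock_Kurzweil_Integration.integrable_reflect_real[where f=g and a="-d" and b="-c"] by simp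
  obtain N1 where N1: "negligible N1" "\<And>x e. x \<notin> N1 \<Longrightarrow> 0 < e \<Longrightarrow>
               \<exists>d>0. \<forall>h. 0 < h \<and> h < d \<longrightarrow> norm (integral (cbox x (x + h *\<^sub>R One)) g /\<^sub>R h ^ DIM(real) - g x) < e"
    using integrable_ccontinuous_explicit[OF g] by blast
  obtain N2 where N2: "negligible N2" "\<And>x e. x \<notin> N2 \<Longrightarrow> 0 < e \<Longrightarrow>
               \<exists>d>0. \<forall>h. 0 < h \<and> h < d \<longrightarrow> norm (integral (cbox x (x + h *\<^sub>R One)) (\<lambda>x. g (- x)) /\<^sub>R h ^ DIM(real) - g (- x)) < e"
    using integrable_ccontinuous_explicit[OF g'] by blast
  have neg: "negligible (uminus ` N2)"
    by (rule negligible_differentiable_image_negligible[OF _ N2(1)]) (auto intro!: derivative_intros)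
  have bd: "\<exists>d>0. \<forall>h. 0 < h \<and> h < d \<longrightarrow> norm (integral {x..x+h} g - h *\<^sub>R g x) \<le> e * h \<and>
      norm (integral {x-h..x} g - h *\<^sub>R g x) \<le> e * h"
    if x: "x \<notin> N1 \<union> uminus ` N2" and e: "e > 0" for x e
  proof -
    have *: "norm (I - h *\<^sub>R v) \<le> e * h" if "norm (I /\<^sub>R h - v) < e" "h > 0" for I v :: 'b and h
    proof -
      have "I - h *\<^sub>R v = h *\<^sub>R (I /\<^sub>R h - v)" using that by (simp add: algebra_simps)
      then have "norm (I - h *\<^sub>R v) = h * norm (I /\<^sub>R h - v)" using that by simp
      then show ?thesis using that by (simp add: mult.commute)
    qed
    have "-x \<notin> N2" using x by force
    then obtain d1 d2 where "d1 > 0" "d2 > 0" and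
      d1: "\<And>h. 0 < h \<Longrightarrow> h < d1 \<Longrightarrow> norm (integral {x..x+h} g /\<^sub>R h - g x) < e" and
      d2: "\<And>h. 0 < h \<Longrightarrow> h < d2 \<Longrightarrow> norm (integral {-x..-x+h} (\<lambda>x. g (- x)) /\<^sub>R h - g x) < e"
      using N1(2)[of x e] N2(2)[of "-x" e] e x by auto
    have "integral {-x..-x+h} (\<lambda>x. g (- x)) = integral {x-h..x} g" for h
      using Henstock_Kurzweil_Integration.integral_reflect_real[where f=g and b=x and a="x-h"] by simp
    then show ?thesis
      using d1 d2 * \<open>d1 > 0\<close> \<open>d2 > 0\<close> by (intro exI[of _ "min d1 d2"]) auto
  qed
  show ?thesis
  proof
    show "negligible (N1 \<union> uminus ` N2)" using N1 neg by simp
    fix x assume x: "x \<in> {a..b} - (N1 \<union> uminus ` N2)"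
    have gx: "g x = f x" using x by (simp add: g_def)
    have gi: "integral {c..d} g = integral {c..d} f" if "a \<le> c" "d \<le> b" for c d
      by (rule integral_cong) (use that in \<open>auto simp: g_def\<close>)
    have comb: "integral {a..d} f - integral {a..c} f = integral {c..d} f" if "a \<le> c" "c \<le> d" "d \<le> b" for c d
    proof -
      have "f integrable_on {a..d}" by (rule integrable_on_subinterval[OF f]) (use that in auto)
      then have "integral {a..c} f + integral {c..d} f = integral {a..d} f"
        using that by (intro Henstock_Kurzweil_Integration.integral_combine) auto
      then show ?thesis by (simp add: algebra_simps)
    qed
    show "((\<lambda>t. integral {a..t} f) has_vector_derivative f x) (at x within {a..b})"
      unfolding has_vector_derivative_def has_derivative_within_alt
    proof (intro conjI allI impI)
      show "bounded_linear (\<lambda>h. h *\<^sub>R f x)" by (rule bounded_linear_scaleR_left)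
      fix e :: real assume "e > 0"
      then obtain d where d: "d > 0" "\<And>h. 0 < h \<Longrightarrow> h < d \<Longrightarrow> norm (integral {x..x+h} g - h *\<^sub>R g x) \<le> e * h"
         "\<And>h. 0 < h \<Longrightarrow> h < d \<Longrightarrow> norm (integral {x-h..x} g - h *\<^sub>R g x) \<le> e * h"
        using bd[of x e] x by blast
      have "norm (integral {a..y} f - integral {a..x} f - (y - x) *\<^sub>R f x) \<le> e * norm (y - x)"
        if y: "y \<in> {a..b}" "norm (y - x) < d" for y
      proof -
        consider "y = x" | "y > x" | "y < x" by linarith
        then show ?thesis
        proof cases
          case 2
          then show ?thesis using d(2)[of "y - x"] y x comb[of x y] gi[of x y] gx by auto
        next
          case 3
          then have "norm (integral {y..x} g - (x - y) *\<^sub>R g x) \<le> e * (x - y)" 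
            using d(3)[of "x - y"] y by auto
          moreover have "integral {a..y} f - integral {a..x} f - (y - x) *\<^sub>R f x
              = - (integral {y..x} g - (x - y) *\<^sub>R g x)"
            using y x comb[of y x] gi[of y x] gx 3 by (auto simp: algebra_simps)
          ultimately show ?thesis using 3 by (simp only: norm_minus_cancel) auto
        qed simp
      qed
      then show "\<exists>d>0. \<forall>y\<in>{a..b}. norm (y - x) < d \<longrightarrow>
            norm (integral {a..y} f - integral {a..x} f - (y - x) *\<^sub>R f x) \<le> e * norm (y - x)"
        using d(1) by blast
    qed
  qed
qed

definition lipschitz_Icc :: "real \<Rightarrow> real \<Rightarrow> (real \<Rightarrow> complex) \<Rightarrow> bool" where
  "lipschitz_Icc c d f \<longleftrightarrow> (\<exists>L. L-lipschitz_on {c..d} f)"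

lemma lipschitz_Icc_const: "lipschitz_Icc c d (\<lambda>t. z)"
  unfolding lipschitz_Icc_def using lipschitz_on_constant by blast

lemma lipschitz_Icc_add: "lipschitz_Icc c d f \<Longrightarrow> lipschitz_Icc c d g \<Longrightarrow> lipschitz_Icc c d (\<lambda>t. f t + g t)"
  unfolding lipschitz_Icc_def using lipschitz_on_add by blast

lemma lipschitz_Icc_diff: "lipschitz_Icc c d f \<Longrightarrow> lipschitz_Icc c d g \<Longrightarrow> lipschitz_Icc c d (\<lambda>t. f t - g t)"
  unfolding lipschitz_Icc_def using lipschitz_on_diff by blast

lemma lipschitz_Icc_cnj: "lipschitz_Icc c d f \<Longrightarrow> lipschitz_Icc c d (\<lambda>t. cnj (f t))"
  unfolding lipschitz_Icc_def lipschitz_on_def dist_norm by (metis complex_cnj_diff complex_mod_cnj)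

lemma lipschitz_Icc_continuous: "lipschitz_Icc c d f \<Longrightarrow> continuous_on {c..d} f"
  unfolding lipschitz_Icc_def using lipschitz_on_continuous_on by blast

lemma lipschitz_Icc_subset: "lipschitz_Icc a b f \<Longrightarrow> a \<le> c \<Longrightarrow> d \<le> b \<Longrightarrow> lipschitz_Icc c d f"
  unfolding lipschitz_Icc_def using lipschitz_on_subset[of _ "{a..b}" f "{c..d}"] by (metis atLeastatMost_subset_iff)

text \<open>
  Compactness of the interval bounds both factors.
\<close>
lemma lipschitz_Icc_mult:
  assumes "lipschitz_Icc c d f" "lipschitz_Icc c d g" shows "lipschitz_Icc c d (\<lambda>t. f t * g t)"
proof -
  obtain L M where L: "L-lipschitz_on {c..d} f" and M: "M-lipschitz_on {c..d} g"
    using assms unfolding lipschitz_Icc_def by blast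
  have bd: "\<exists>F\<ge>0. \<forall>t\<in>{c..d}. cmod (h t) \<le> F" if "lipschitz_Icc c d h" for h
  proof -
    have "bounded (h ` {c..d})"
      by (intro compact_imp_bounded compact_continuous_image lipschitz_Icc_continuous[OF that]) auto
    then obtain F where F: "\<forall>x\<in>h ` {c..d}. cmod x \<le> F" unfolding bounded_iff by blast
    show ?thesis
    proof (intro exI conjI ballI)
      show "0 \<le> max 0 F" by simp
      fix t assume "t \<in> {c..d}"
      then have "cmod (h t) \<le> F" using F by blast
      then show "cmod (h t) \<le> max 0 F" by simp
    qed
  qed
  obtain F where F: "F \<ge> 0" "\<And>t. t \<in> {c..d} \<Longrightarrow> cmod (f t) \<le> F" using bd[OF assms(1)] by blast
  obtain G where G: "G \<ge> 0" "\<And>t. t \<in> {c..d} \<Longrightarrow> cmod (g t) \<le> G" using bd[OF assms(2)] by blast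
  have "(F * M + L * G)-lipschitz_on {c..d} (\<lambda>t. f t * g t)"
  proof (rule lipschitz_onI)
    fix x y assume xy: "x \<in> {c..d}" "y \<in> {c..d}"
    have "f x * g x - f y * g y = f x * (g x - g y) + (f x - f y) * g y" by (simp add: algebra_simps)
    then have "cmod (f x * g x - f y * g y) \<le> cmod (f x) * cmod (g x - g y) + cmod (f x - f y) * cmod (g y)"
      by (metis norm_mult norm_triangle_ineq)
    also have "\<dots> \<le> F * (M * dist x y) + (L * dist x y) * G"
      using lipschitz_onD[OF L xy] lipschitz_onD[OF M xy] lipschitz_on_nonneg[OF L] xy F G
      by (intro add_mono mult_mono) (auto simp: dist_norm)
    finally show "dist (f x * g x) (f y * g y) \<le> (F * M + L * G) * dist x y"
      by (simp add: dist_norm algebra_simps)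
  qed (use F G lipschitz_on_nonneg[OF L] lipschitz_on_nonneg[OF M] in auto)
  then show ?thesis unfolding lipschitz_Icc_def by blast
qed

lemma lipschitz_Icc_C1:
  assumes "continuous_on {c..d} f'" "\<And>t. t \<in> {c..d} \<Longrightarrow> (f has_vector_derivative f' t) (at t within {c..d})"
  shows "lipschitz_Icc c d f"
proof -
  have "bounded (f' ` {c..d})"
    by (intro compact_imp_bounded compact_continuous_image assms) auto
  then obtain F where F: "\<forall>x\<in>f' ` {c..d}. cmod x \<le> F" unfolding bounded_iff by blast
  have "(max 0 F)-lipschitz_on {c..d} f"
  proof (rule bounded_derivative_imp_lipschitz)
    show "(f has_derivative (\<lambda>h. h *\<^sub>R f' t)) (at t within {c..d})" if "t \<in> {c..d}" for t
      using assms(2)[OF that] by (simp add: has_vector_derivative_def)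
    show "onorm (\<lambda>h. h *\<^sub>R f' t) \<le> max 0 F" if "t \<in> {c..d}" for t
    proof (rule onorm_le)
      fix h :: real
      have "cmod (f' t) \<le> max 0 F" using F that by (simp add: le_max_iff_disj)
      then show "norm (h *\<^sub>R f' t) \<le> max 0 F * norm h"
        by (simp add: mult.commute mult_left_mono)
    qed
  qed auto
  then show ?thesis unfolding lipschitz_Icc_def by blast
qed

text \<open>
  The form in which monotonicity is used: a lower bound for the derivative almost everywhere integrates to a
  lower bound for the increment, because a Lipschitz function is absolutely continuous.
\<close>
lemma lipschitz_Icc_ae_derivative_Re_ge:
  fixes Q Q' :: "real \<Rightarrow> complex"
  assumes "c \<le> d" "lipschitz_Icc c d Q" "negligible N"
    and der: "\<And>t. t \<in> {c..d} - N \<Longrightarrow> (Q has_vector_derivative Q' t) (at t within {c..d})"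
    and ge: "\<And>t. t \<in> {c..d} - N \<Longrightarrow> n t \<le> Re (Q' t)"
    and n: "continuous_on {c..d} n"
  shows "integral {c..d} n \<le> Re (Q d) - Re (Q c)"
proof -
  obtain L where "L-lipschitz_on {c..d} Q" using assms(2) unfolding lipschitz_Icc_def by blast
  then have "(Q' has_integral (Q d - Q c)) {c..d}"
    by (rule abs_continuous_has_integral[OF assms(1) lipschitz_abs_continuous_on assms(3) der])
  then have "((Re \<circ> Q') has_integral Re (Q d - Q c)) {c..d}"
    by (rule has_integral_linear) (rule bounded_linear_Re)
  then have "((\<lambda>t. if t \<in> N then n t else Re (Q' t)) has_integral Re (Q d - Q c)) {c..d}"
    by (rule has_integral_spike[OF assms(3), rotated]) auto
  moreover have "(n has_integral integral {c..d} n) {c..d}"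
    by (intro integrable_integral integrable_continuous_real n)
  moreover have "n t \<le> (if t \<in> N then n t else Re (Q' t))" if "t \<in> {c..d}" for t
    using ge[of t] that by auto
  ultimately have "integral {c..d} n \<le> Re (Q d - Q c)"
    using has_integral_le by blast
  then show ?thesis by simp
qed

section \<open>Weak derivatives and continuous extension\<close>

text \<open>
  The functions \<open>exp (-1 / x) / x\<^sup>k\<close>, continued by zero to the left of the origin. The derivative of one is a
  linear combination of others, which makes smoothness a matter of closure properties.
\<close>
definition exp_inv :: "nat \<Rightarrow> real \<Rightarrow> real" where
  "exp_inv k x = (if x > 0 then inverse x ^ k * exp (- inverse x) else 0)"

lemma exp_inv_tendsto_0: "(exp_inv k \<longlongrightarrow> 0) (at_right 0)"
proof -
  have "((\<lambda>x::real. inverse x ^ k / exp (inverse x)) \<longlongrightarrow> 0) (at_right 0)"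
    by (rule filterlim_compose[OF tendsto_power_div_exp_0 filterlim_inverse_at_top_right])
  moreover have "\<forall>\<^sub>F x in at_right 0. inverse x ^ k / exp (inverse x) = exp_inv k x"
    using eventually_at_right_less[of "0::real"]
    by eventually_elim (simp add: exp_inv_def exp_minus divide_inverse)
  ultimately show ?thesis by (rule Lim_transform_eventually)
qed

lemma exp_inv_deriv:
  "(exp_inv k has_real_derivative (exp_inv (k + 2) x - of_nat k * exp_inv (k + 1) x)) (at x)"
proof -
  consider "x > 0" | "x < 0" | "x = 0" by linarith
  then show ?thesis
  proof cases
    case 1
    have "((\<lambda>x. inverse x ^ k * exp (- inverse x)) has_real_derivative
        (of_nat k * inverse x ^ (k - 1) * (- (inverse x * inverse x))) * exp (- inverse x)
          + inverse x ^ k * (exp (- inverse x) * (inverse x * inverse x))) (at x)"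
      using 1 by (auto intro!: derivative_eq_intros)
    also have "(of_nat k * inverse x ^ (k - 1) * (- (inverse x * inverse x))) * exp (- inverse x)
          + inverse x ^ k * (exp (- inverse x) * (inverse x * inverse x))
        = exp_inv (k + 2) x - of_nat k * exp_inv (k + 1) x"
      using 1 by (cases k) (simp_all add: exp_inv_def power_add algebra_simps)
    finally have "((\<lambda>x. inverse x ^ k * exp (- inverse x)) has_real_derivative
        (exp_inv (k + 2) x - of_nat k * exp_inv (k + 1) x)) (at x)" .
    then show ?thesis
      by (rule has_field_derivative_transform_within_open[of _ _ _ "{0<..}"]) (use 1 in \<open>auto simp: exp_inv_def\<close>)
  next
    case 2
    have "((\<lambda>x. 0) has_real_derivative (exp_inv (k + 2) x - of_nat k * exp_inv (k + 1) x)) (at x)"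
      using 2 by (simp add: exp_inv_def)
    then show ?thesis
      by (rule has_field_derivative_transform_within_open[of _ _ _ "{..<0}"]) (use 2 in \<open>auto simp: exp_inv_def\<close>)
  next
    case 3
    have "((\<lambda>y. (exp_inv k y - exp_inv k 0) / (y - 0)) \<longlongrightarrow> 0) (at 0)"
    proof (rule filterlim_split_at)
      have "\<forall>\<^sub>F y in at_left 0. 0 = (exp_inv k y - exp_inv k 0) / (y - 0)"
        using eventually_at_left_real[of "-1" "0::real", OF neg_less_0_iff_less[THEN iffD2, OF zero_less_one]]
        by eventually_elim (auto simp: exp_inv_def)
      then show "((\<lambda>y. (exp_inv k y - exp_inv k 0) / (y - 0)) \<longlongrightarrow> 0) (at_left 0)"
        by (rule Lim_transform_eventually[OF tendsto_const])
      have "\<forall>\<^sub>F y in at_right 0. exp_inv (k + 1) y = (exp_inv k y - exp_inv k 0) / (y - 0)"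
        using eventually_at_right_less[of "0::real"]
        by eventually_elim (auto simp: exp_inv_def field_simps)
      then show "((\<lambda>y. (exp_inv k y - exp_inv k 0) / (y - 0)) \<longlongrightarrow> 0) (at_right 0)"
        by (rule Lim_transform_eventually[OF exp_inv_tendsto_0])
    qed
    then show ?thesis using 3 by (simp add: has_field_derivative_iff exp_inv_def)
  qed
qed

text \<open>
  A class of functions that is closed under differentiation. Its members have derivatives of all orders in the sense
  of \<open>test_function\<close>, and no formula for the higher derivatives is needed.
\<close>
inductive flat_smooth :: "(real \<Rightarrow> real) \<Rightarrow> bool" where
  base: "flat_smooth (\<lambda>x. exp_inv k (c * x + d))"
| add: "flat_smooth f \<Longrightarrow> flat_smooth g \<Longrightarrow> flat_smooth (\<lambda>x. f x + g x)"
| mult: "flat_smooth f \<Longrightarrow> flat_smooth g \<Longrightarrow> flat_smooth (\<lambda>x. f x * g x)"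
| scale: "flat_smooth f \<Longrightarrow> flat_smooth (\<lambda>x. c * f x)"

lemma flat_smooth_deriv:
  "flat_smooth f \<Longrightarrow> \<exists>f'. flat_smooth f' \<and> (\<forall>x. (f has_real_derivative f' x) (at x))"
proof (induction rule: flat_smooth.induct)
  case (base k c d)
  let ?g = "\<lambda>x. c * (exp_inv (k + 2) (c * x + d) + (- of_nat k) * exp_inv (k + 1) (c * x + d))"
  have "flat_smooth ?g" by (intro flat_smooth.intros)
  moreover have "((\<lambda>x. exp_inv k (c * x + d)) has_real_derivative ?g x) (at x)" for x
  proof -
    have "((\<lambda>x. exp_inv k (c * x + d)) has_real_derivative
       (exp_inv (k + 2) (c * x + d) - of_nat k * exp_inv (k + 1) (c * x + d)) * c) (at x)"
      by (rule DERIV_chain2[OF exp_inv_deriv]) (auto intro!: derivative_eq_intros)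
    then show ?thesis by (simp add: algebra_simps)
  qed
  ultimately show ?case by blast
next
  case (add f g)
  then obtain f' g' where "flat_smooth f'" "flat_smooth g'" 
    "\<And>x. (f has_real_derivative f' x) (at x)" "\<And>x. (g has_real_derivative g' x) (at x)" by blast
  then show ?case
    by (intro exI[of _ "\<lambda>x. f' x + g' x"]) (auto intro!: flat_smooth.intros derivative_eq_intros)
next
  case (mult f g)
  then obtain f' g' where "flat_smooth f'" "flat_smooth g'" 
    "\<And>x. (f has_real_derivative f' x) (at x)" "\<And>x. (g has_real_derivative g' x) (at x)" by blast
  then show ?case using mult.hyps
    by (intro exI[of _ "\<lambda>x. f' x * g x + f x * g' x"])
       (auto intro!: flat_smooth.intros derivative_eq_intros)
next
  case (scale f c)
  then obtain f' where "flat_smooth f'" 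
    "\<And>x. (f has_real_derivative f' x) (at x)" by blast
  then show ?case 
    by (intro exI[of _ "\<lambda>x. c * f' x"]) (auto intro!: flat_smooth.intros derivative_eq_intros)
qed

lemma flat_smooth_deriv_eq: "flat_smooth f \<Longrightarrow> flat_smooth (deriv f)"
  using flat_smooth_deriv by (metis DERIV_imp_deriv ext)

lemma flat_smooth_differentiable: "flat_smooth f \<Longrightarrow> f differentiable_on UNIV"
  using flat_smooth_deriv[of f]
  by (auto simp: differentiable_on_def real_differentiable_def intro: has_field_derivative_at_within)

lemma flat_smooth_continuous: "flat_smooth f \<Longrightarrow> continuous_on S f"
  using flat_smooth_differentiable differentiable_imp_continuous_on continuous_on_subset by blast

lemma flat_smooth_higher: "flat_smooth f \<Longrightarrow> (deriv ^^ n) f differentiable_on UNIV"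
proof -
  assume "flat_smooth f"
  then have "flat_smooth ((deriv ^^ n) f)"
    by (induction n) (auto intro: flat_smooth_deriv_eq)
  then show ?thesis by (rule flat_smooth_differentiable)
qed

lemma flat_smooth_affine: "flat_smooth f \<Longrightarrow> flat_smooth (\<lambda>x. f (a * x + b))"
proof (induction rule: flat_smooth.induct)
  case (base k c d)
  have "flat_smooth (\<lambda>x. exp_inv k ((c * a) * x + (c * b + d)))" by (rule flat_smooth.base)
  then show ?case by (simp add: algebra_simps)
qed (auto intro: flat_smooth.intros)

text \<open>
  The bump \<open>\<eta>\<close> is a multiple of \<open>exp (-1 / x - 1 / (1 - x))\<close> on \<open>(0, 1)\<close>, and \<open>H\<close> is its integral.
\<close>
lemma smooth_step_exists:
  obtains H \<eta> :: "real \<Rightarrow> real" where "flat_smooth \<eta>" "\<And>x. \<eta> x \<ge> 0" "\<And>x. x \<notin> {0<..<1} \<Longrightarrow> \<eta> x = 0"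
    "\<And>x. (H has_real_derivative \<eta> x) (at x)" "\<And>x. x \<le> 0 \<Longrightarrow> H x = 0" "\<And>x. x \<ge> 1 \<Longrightarrow> H x = 1"
    "\<And>x. 0 \<le> H x \<and> H x \<le> 1"
proof -
  define \<eta>0 where "\<eta>0 = (\<lambda>x. exp_inv 0 x * exp_inv 0 (1 - x))"
  have sm0: "flat_smooth \<eta>0"
    using flat_smooth.mult[OF flat_smooth.base[of 0 1 0] flat_smooth.base[of 0 "-1" 1]]
    by (simp add: \<eta>0_def algebra_simps)
  have pos0: "\<eta>0 x \<ge> 0" for x by (simp add: \<eta>0_def exp_inv_def)
  have supp0: "x \<notin> {0<..<1} \<Longrightarrow> \<eta>0 x = 0" for x by (auto simp: \<eta>0_def exp_inv_def)
  have cont0: "continuous_on S \<eta>0" for S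
    by (rule flat_smooth_continuous[OF sm0])
  \<comment> \<open>Any start left of the support would do; starting at \<open>-1\<close> makes every point with \<open>x \<ge> 0\<close> an interior point.\<close>
  define G where "G = (\<lambda>x. integral {-1..x} \<eta>0)"
  have G0: "G x = 0" if "x \<le> 0" for x
  proof -
    have "integral {-1..x} \<eta>0 = integral {-1..x} (\<lambda>_. 0)"
      by (rule integral_cong) (use that supp0 in auto)
    then show ?thesis by (simp add: G_def)
  qed
  have derG: "(G has_real_derivative \<eta>0 x) (at x)" for x
  proof (cases "x > -1")
    case True
    have "(G has_real_derivative \<eta>0 x) (at x within {-1..x+1})"
      unfolding G_def by (rule integral_has_real_derivative[OF cont0]) (use True in auto)
    then show ?thesis using True by (simp add: at_within_Icc_at)
  next
    case False
    have "((\<lambda>x. 0) has_real_derivative \<eta>0 x) (at x)" using supp0[of x] False by simp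
    then show ?thesis
      by (rule has_field_derivative_transform_within_open[of _ _ _ "{..<0}"]) (use False G0 in auto)
  qed
  have monoG: "G x \<le> G y" if "x \<le> y" for x y
    by (rule DERIV_nonneg_imp_nondecreasing[OF that]) (use derG pos0 in blast)
  have G1: "G x = G 1" if "x \<ge> 1" for x
  proof (cases "x = 1")
    case False
    have "\<exists>z>1. z < x \<and> G x - G 1 = (x - 1) * \<eta>0 z"
      by (rule MVT2) (use derG that False in auto)
    then show ?thesis using supp0 by auto
  qed simp
  have "G 1 > 0"
  proof -
    have "G 1 \<noteq> 0"
    proof
      assume "G 1 = 0"
      then have "G x = 0" if "x \<in> {0<..<1}" for x
        using monoG[of 0 x] monoG[of x 1] G0[of 0] that by auto
      then have "((\<lambda>x. 0) has_real_derivative \<eta>0 (1/2)) (at (1/2))"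
        by (intro has_field_derivative_transform_within_open[OF derG[of "1/2"], of "{0<..<1}"]) auto
      then have "\<eta>0 (1/2) = 0" using DERIV_unique[OF _ DERIV_const] by blast
      then show False by (simp add: \<eta>0_def exp_inv_def)
    qed
    then show ?thesis using monoG[of 0 1] G0[of 0] by auto
  qed
  show ?thesis
  proof (rule that[of "\<lambda>x. (1 / G 1) * \<eta>0 x" "\<lambda>x. (1 / G 1) * G x"])
    show "flat_smooth (\<lambda>x. (1 / G 1) * \<eta>0 x)" by (rule flat_smooth.scale[OF sm0])
    show "((\<lambda>x. (1 / G 1) * G x) has_real_derivative (1 / G 1) * \<eta>0 x) (at x)" for x
      by (rule DERIV_cmult[OF derG])
    show "0 \<le> (1 / G 1) * G x \<and> (1 / G 1) * G x \<le> 1" for x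
      using \<open>G 1 > 0\<close> monoG[of 0 x] monoG[of x 0] monoG[of x 1] G1[of x] G0[of 0] G0[of x]
      by (cases "x \<le> 0"; cases "x \<ge> 1") auto
    show "1 / G 1 * G x = 1" if "x \<ge> 1" for x using G1[OF that] \<open>G 1 > 0\<close> by simp
  qed (use pos0 supp0 G0 \<open>G 1 > 0\<close> in auto)
qed

lemma average_close:
  fixes \<psi> :: "real \<Rightarrow> real" and f :: "real \<Rightarrow> complex"
  assumes "a \<le> b" and \<psi>: "(\<psi> has_integral 1) {a..b}" "\<And>x. x \<in> {a..b} \<Longrightarrow> \<psi> x \<ge> 0"
    and cont: "continuous_on {a..b} \<psi>" "continuous_on {a..b} f"
    and f: "\<And>x. x \<in> {a..b} \<Longrightarrow> cmod (f x - v) \<le> \<epsilon>"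
  shows "cmod (integral {a..b} (\<lambda>x. \<psi> x *\<^sub>R f x) - v) \<le> \<epsilon>"
proof -
  have i1: "(\<lambda>x. \<psi> x *\<^sub>R (f x - v)) integrable_on {a..b}"
    by (intro integrable_continuous_real continuous_intros cont)
  have i2: "((\<lambda>x. \<psi> x *\<^sub>R v) has_integral v) {a..b}"
    using has_integral_scaleR_left[OF \<psi>(1), of v] by simp
  have "integral {a..b} (\<lambda>x. \<psi> x *\<^sub>R f x) = integral {a..b} (\<lambda>x. \<psi> x *\<^sub>R (f x - v) + \<psi> x *\<^sub>R v)"
    by (simp flip: scaleR_add_right)
  also have "\<dots> = integral {a..b} (\<lambda>x. \<psi> x *\<^sub>R (f x - v)) + v"
    using integral_add[OF i1 has_integral_integrable[OF i2]] i2 by (simp add: integral_unique)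
  finally have "integral {a..b} (\<lambda>x. \<psi> x *\<^sub>R f x) - v = integral {a..b} (\<lambda>x. \<psi> x *\<^sub>R (f x - v))" by simp
  also have "cmod \<dots> \<le> integral {a..b} (\<lambda>x. \<epsilon> * \<psi> x)"
  proof (rule integral_norm_bound_integral[OF i1])
    show "(\<lambda>x. \<epsilon> * \<psi> x) integrable_on {a..b}"
      by (intro integrable_continuous_real continuous_intros cont)
    show "cmod (\<psi> x *\<^sub>R (f x - v)) \<le> \<epsilon> * \<psi> x" if "x \<in> {a..b}" for x
      using mult_right_mono[OF f[OF that] \<psi>(2)[OF that]] \<psi>(2)[OF that] by (simp add: mult.commute)
  qed
  also have "\<dots> = \<epsilon>" using \<psi>(1) by (simp add: integral_unique)
  finally show ?thesis .
qed

lemma L_infinity_set_integrable: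
  assumes f: "L_infinity {l<..<r} f" and g: "continuous_on UNIV g" "\<And>x. \<bar>g x\<bar> \<le> M"
  shows "set_integrable lebesgue {l<..<r} (\<lambda>x. g x *\<^sub>R f x)"
proof -
  obtain C where C: "AE x in lebesgue_on {l<..<r}. cmod (f x) \<le> C" and fm: "f \<in> borel_measurable (lebesgue_on {l<..<r})"
    using f by (auto simp: L_infinity_def)
  have gm: "g \<in> borel_measurable (lebesgue_on {l<..<r})"
    using g(1) by (intro continuous_imp_measurable_on_sets_lebesgue) (auto intro: continuous_on_subset)
  have "integrable (lebesgue_on {l<..<r}) (\<lambda>x. g x *\<^sub>R f x)"
  proof (rule Bochner_Integration.integrable_bound[where f="\<lambda>x. M * C"])
    show "integrable (lebesgue_on {l<..<r}) (\<lambda>x. M * C)"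
      by (rule finite_measure.integrable_const) (simp add: finite_measure_lebesgue_on)
    show "(\<lambda>x. g x *\<^sub>R f x) \<in> borel_measurable (lebesgue_on {l<..<r})"
      using gm fm by (rule borel_measurable_scaleR)
    show "AE x in lebesgue_on {l<..<r}. norm (g x *\<^sub>R f x) \<le> norm (M * C)"
      using C
    proof eventually_elim
      case (elim x)
      have "norm (g x *\<^sub>R f x) = \<bar>g x\<bar> * cmod (f x)" by simp
      also have "\<dots> \<le> M * C" using elim g(2)[of x] by (intro mult_mono) (auto intro: order_trans[OF abs_ge_zero])
      finally show ?case by simp
    qed
  qed
  then show ?thesis by (simp add: integrable_restrict_space set_integrable_def)
qed

text \<open>
  The test function \<open>H ((x - c) / h) - H ((x - d) / h)\<close> is close to the indicator of \<open>[c, d]\<close>. Integrated against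
  the weak derivative \<open>g\<close> it gives at most \<open>C (d - c + h)\<close>, while its derivative integrated against \<open>f\<close> is a
  difference of averages of \<open>f\<close> near \<open>c\<close> and near \<open>d\<close>. Let \<open>h\<close> tend to zero.
\<close>
lemma weak_deriv_lipschitz:
  assumes fc: "continuous_on {l<..<r} f" and fL: "L_infinity {l<..<r} f"
    and gL: "L_infinity {l<..<r} g" and wd: "has_weak_deriv 1 {l<..<r} f g"
  shows "\<exists>L. L-lipschitz_on {l<..<r} f"
proof -
  obtain C0 where C0: "AE x in lebesgue_on {l<..<r}. cmod (g x) \<le> C0" 
    using gL by (auto simp: L_infinity_def)
  define C where "C = max C0 0"
  have C: "AE x in lebesgue_on {l<..<r}. cmod (g x) \<le> C" and Cpos: "C \<ge> 0"
    using C0 by (auto simp: C_def elim!: eventually_mono)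
  obtain H \<eta> :: "real \<Rightarrow> real" where sm: "flat_smooth \<eta>" and pos: "\<And>x. \<eta> x \<ge> 0" and supp: "\<And>x. x \<notin> {0<..<1} \<Longrightarrow> \<eta> x = 0"
    and derH: "\<And>x. (H has_real_derivative \<eta> x) (at x)" and H0: "\<And>x. x \<le> 0 \<Longrightarrow> H x = 0" and H1: "\<And>x. x \<ge> 1 \<Longrightarrow> H x = 1"
    and H01: "\<And>x. 0 \<le> H x \<and> H x \<le> 1"
    using smooth_step_exists by metis
  have main: "cmod (f c - f d) \<le> C * (d - c)" if cd: "l < c" "c < d" "d < r" for c d
  proof (rule field_le_epsilon)
    fix e :: real assume e: "e > 0"
    have "isCont f c" "isCont f d"
      using fc cd by (auto simp: continuous_on_eq_continuous_at)
    note cc = this[unfolded continuous_at_eps_delta, rule_format, of "e / 4"]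
    obtain h1 h2 where h12: "h1 > 0" "h2 > 0" and
      h1: "\<And>x. dist x c < h1 \<Longrightarrow> dist (f x) (f c) < e / 4" and
      h2: "\<And>x. dist x d < h2 \<Longrightarrow> dist (f x) (f d) < e / 4"
      using cc e by (auto simp: dist_norm)
    define h where "h = min (min (min (h1 / 2) (h2 / 2)) (min ((d - c) / 2) ((r - d) / 2))) (e / (2 * (C + 1)))"
    have h: "h > 0" "h < h1" "h < h2" "c + h < d" "d + h < r" "C * h \<le> e / 2"
    proof -
      have "0 < h1 / 2" "0 < h2 / 2" "0 < (d - c) / 2" "0 < (r - d) / 2" using h12 cd by auto
      moreover have "0 < e / (2 * (C + 1))" using e Cpos by (intro divide_pos_pos) auto
      ultimately show "h > 0" unfolding h_def min_less_iff_conj by blast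
      have hb: "h \<le> h1 / 2" "h \<le> h2 / 2" "h \<le> (d - c) / 2" "h \<le> (r - d) / 2" "h \<le> e / (2 * (C + 1))"
        unfolding h_def by (simp_all only: min_le_iff_disj order_refl simp_thms)
      from hb(5) have "h * (2 * (C + 1)) \<le> e" using Cpos by (subst (asm) pos_le_divide_eq) auto
      then have "2 * (C * h) + 2 * h \<le> e" by (simp only: algebra_simps)
      then show "C * h \<le> e / 2" using \<open>h > 0\<close> by linarith
      show "h < h1" using hb(1) h12 by linarith
      show "h < h2" using hb(2) h12 by linarith
      have "h * 2 \<le> d - c" "h * 2 \<le> r - d" using hb(3,4) by simp_all
      then show "c + h < d" "d + h < r" using cd \<open>h > 0\<close> by linarith+
    qed
    \<comment> \<open>The affine argument is spelt \<open>a x + b\<close> to match the closure property; \<open>\<Psi> z\<close> is the bump of width \<open>h\<close> to the right of \<open>z\<close>.\<close>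
    define \<Psi> where "\<Psi> z x = (1 / h) * \<eta> ((1 / h) * x + (- z / h))" for z x
    define \<phi> where "\<phi> x = H ((x - c) / h) - H ((x - d) / h)" for x
    have sm\<Psi>: "flat_smooth (\<Psi> z)" for z
      unfolding \<Psi>_def by (intro flat_smooth.scale flat_smooth_affine sm)
    have \<Psi>_eq: "\<Psi> z x = (1 / h) * \<eta> ((x - z) / h)" for z x
      by (simp add: \<Psi>_def diff_divide_distrib)
    have cont\<Psi>: "continuous_on S (\<Psi> z)" for S z
      by (rule flat_smooth_continuous[OF sm\<Psi>])
    have \<Psi>pos: "\<Psi> z x \<ge> 0" for z x using pos h by (simp add: \<Psi>_def)
    have \<Psi>supp: "\<Psi> z x = 0" if "x \<notin> {z..z+h}" for z x
    proof -
      have "(x - z) / h \<notin> {0<..<1}" using that h by (auto simp: field_simps)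
      then show ?thesis using supp by (simp add: \<Psi>_eq)
    qed
    have der\<Psi>: "((\<lambda>x. H ((x - z) / h)) has_real_derivative \<Psi> z x) (at x)" for z x
    proof -
      have "((\<lambda>x. (x - z) / h) has_real_derivative 1 / h) (at x)"
        using h(1) by (auto intro!: derivative_eq_intros)
      from DERIV_chain2[OF derH this] show ?thesis by (simp add: \<Psi>_eq)
    qed
    have \<Psi>int: "(\<Psi> z has_integral 1) {z..z+h}" for z
    proof -
      have "(\<Psi> z has_integral (H ((z + h - z) / h) - H ((z - z) / h))) {z..z+h}"
        by (rule fundamental_theorem_of_calculus)
           (use h(1) der\<Psi> in \<open>auto simp flip: has_real_derivative_iff_has_vector_derivative intro: has_field_derivative_at_within\<close>)
      then show ?thesis using h(1) H0 H1 by simp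
    qed
    have der\<phi>: "(\<phi> has_real_derivative (\<Psi> c x + (-1) * \<Psi> d x)) (at x)" for x
      unfolding \<phi>_def using DERIV_diff[OF der\<Psi>[where z=c and x=x] der\<Psi>[where z=d and x=x]] by simp
    have deriv\<phi>: "deriv \<phi> = (\<lambda>x. \<Psi> c x + (-1) * \<Psi> d x)"
      using der\<phi> DERIV_imp_deriv by blast
    have \<phi>supp: "\<phi> x = 0" if "x \<notin> {c..d+h}" for x
    proof (cases "x < c")
      case True
      then show ?thesis using H0 h(1) cd by (simp add: \<phi>_def field_simps)
    next
      case False
      then have "(x - c) / h \<ge> 1" "(x - d) / h \<ge> 1" using that h cd by (auto simp: field_simps)
      then show ?thesis using H1 by (simp add: \<phi>_def)
    qed
    have test: "test_function {l<..<r} \<phi>"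
      unfolding test_function_def
    proof (intro conjI allI exI)
      fix n show "(deriv ^^ n) \<phi> differentiable_on UNIV"
      proof (cases n)
        case 0
        then show ?thesis using der\<phi>
          by (auto simp: differentiable_on_def real_differentiable_def intro: has_field_derivative_at_within)
      next
        case (Suc k)
        have "flat_smooth (deriv \<phi>)" unfolding deriv\<phi> by (intro flat_smooth.intros sm\<Psi>)
        then show ?thesis using flat_smooth_higher unfolding Suc funpow_Suc_right by simp
      qed
      show "compact {c..d+h}" by simp
    qed (use cd h \<phi>supp in auto)
    have \<phi>abs: "\<bar>\<phi> x\<bar> \<le> 1" for x
      using H01[of "(x - c) / h"] H01[of "(x - d) / h"] by (auto simp: \<phi>_def abs_le_iff)
    have \<phi>cont: "continuous_on S \<phi>" for S
      by (rule DERIV_continuous_on) (rule has_field_derivative_at_within[OF der\<phi>])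
    have eq: "(LINT x:{l<..<r}|lebesgue. deriv \<phi> x *\<^sub>R f x) = - (LINT x:{l<..<r}|lebesgue. \<phi> x *\<^sub>R g x)"
      using wd test by (simp add: has_weak_deriv_def)
    have piece: "((\<lambda>x. \<Psi> z x *\<^sub>R f x) has_integral integral {z..z+h} (\<lambda>x. \<Psi> z x *\<^sub>R f x)) {l<..<r} \<and>
        cmod (integral {z..z+h} (\<lambda>x. \<Psi> z x *\<^sub>R f x) - f z) \<le> e / 4"
      if z: "l < z" "z + h < r" "\<And>x. dist x z < h' \<Longrightarrow> dist (f x) (f z) < e / 4" "h < h'" for z h'
    proof
      have fz: "continuous_on {z..z+h} f" by (rule continuous_on_subset[OF fc]) (use z in auto)
      have "(\<lambda>x. \<Psi> z x *\<^sub>R f x) integrable_on {z..z+h}"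
        by (intro integrable_continuous_real continuous_intros cont\<Psi> fz)
      then have "((\<lambda>x. \<Psi> z x *\<^sub>R f x) has_integral integral {z..z+h} (\<lambda>x. \<Psi> z x *\<^sub>R f x)) {z..z+h}"
        by (rule integrable_integral)
      then show "((\<lambda>x. \<Psi> z x *\<^sub>R f x) has_integral integral {z..z+h} (\<lambda>x. \<Psi> z x *\<^sub>R f x)) {l<..<r}"
        by (rule has_integral_on_superset) (use z \<Psi>supp in auto)
      show "cmod (integral {z..z+h} (\<lambda>x. \<Psi> z x *\<^sub>R f x) - f z) \<le> e / 4"
      proof (rule average_close[OF _ \<Psi>int \<Psi>pos cont\<Psi> fz])
        show "z \<le> z + h" using h by simp
        fix x assume "x \<in> {z..z+h}"
        then have "dist x z < h'" using z(4) by (auto simp: dist_real_def)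
        then show "cmod (f x - f z) \<le> e / 4" using z(3) by (simp add: dist_norm less_imp_le)
      qed
    qed
    let ?Ic = "integral {c..c+h} (\<lambda>x. \<Psi> c x *\<^sub>R f x)" and ?Id = "integral {d..d+h} (\<lambda>x. \<Psi> d x *\<^sub>R f x)"
    have pc: "((\<lambda>x. \<Psi> c x *\<^sub>R f x) has_integral ?Ic) {l<..<r}" "cmod (?Ic - f c) \<le> e / 4"
      using piece[of c h1] cd h h1 by auto
    have pd: "((\<lambda>x. \<Psi> d x *\<^sub>R f x) has_integral ?Id) {l<..<r}" "cmod (?Id - f d) \<le> e / 4"
      using piece[of d h2] cd h h2 by auto
    have L: "(LINT x:{l<..<r}|lebesgue. deriv \<phi> x *\<^sub>R f x) = ?Ic - ?Id"
    proof -
      have "\<exists>M. \<forall>x. \<bar>deriv \<phi> x\<bar> \<le> M"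
      proof -
        have "continuous_on {0..1} \<eta>" by (rule flat_smooth_continuous[OF sm])
        then obtain x0 where x0: "x0 \<in> {0..1}" "\<And>x. x \<in> {0..1} \<Longrightarrow> \<eta> x \<le> \<eta> x0"
          using continuous_attains_sup[of "{0..1::real}" \<eta>] by auto
        have "\<eta> x \<le> \<eta> x0" for x
          using x0(2)[of x] supp[of x] pos[of x0] by (cases "x \<in> {0..1}") auto
        then have \<Psi>le: "\<Psi> z x \<le> \<eta> x0 / h" for z x
          using h(1) by (simp add: \<Psi>_eq divide_right_mono)
        show ?thesis
        proof (intro exI allI)
          show "\<bar>deriv \<phi> x\<bar> \<le> \<eta> x0 / h" for x
            using \<Psi>le[of c x] \<Psi>le[of d x] \<Psi>pos[of c x] \<Psi>pos[of d x] unfolding deriv\<phi> by linarith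
        qed
      qed
      then obtain M where M: "\<And>x. \<bar>deriv \<phi> x\<bar> \<le> M" by blast
      have cd': "continuous_on UNIV (deriv \<phi>)" unfolding deriv\<phi> by (intro continuous_intros cont\<Psi>)
      have "(LINT x:{l<..<r}|lebesgue. deriv \<phi> x *\<^sub>R f x) = integral {l<..<r} (\<lambda>x. deriv \<phi> x *\<^sub>R f x)"
        by (intro set_lebesgue_integral_eq_integral L_infinity_set_integrable[OF fL cd' M])
      also have "\<dots> = ?Ic - ?Id"
        using has_integral_diff[OF pc(1) pd(1)]
        by (intro integral_unique) (simp add: deriv\<phi> scaleR_diff_left)
      finally show ?thesis .
    qed
    have R: "cmod (LINT x:{l<..<r}|lebesgue. \<phi> x *\<^sub>R g x) \<le> C * (d + h - c)"
    proof -
      let ?k = "\<lambda>x. indicator {l<..<r} x *\<^sub>R \<phi> x *\<^sub>R g x"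
      have ik: "integrable lebesgue ?k"
        using L_infinity_set_integrable[OF gL \<phi>cont \<phi>abs] by (simp add: set_integrable_def)
      have "cmod (LINT x|lebesgue. ?k x) \<le> (LINT x|lebesgue. norm (?k x))"
        by (rule integral_norm_bound)
      also have "\<dots> \<le> (LINT x|lebesgue. C * indicator {c..d+h} x)"
      proof (rule integral_mono_AE)
        show "integrable lebesgue (\<lambda>x. norm (?k x))" using ik by (rule integrable_norm)
        show "integrable lebesgue (\<lambda>x. C * indicator {c..d+h} x)"
          by (intro integrable_mult_right integrable_real_indicator) (auto simp: emeasure_lborel_Icc_eq)
        have "AE x in lebesgue. x \<in> {l<..<r} \<longrightarrow> cmod (g x) \<le> C"
          using C by (subst (asm) AE_restrict_space_iff) auto
        then show "AE x in lebesgue. norm (?k x) \<le> C * indicator {c..d+h} x"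
        proof eventually_elim
          case (elim x)
          show ?case
          proof (cases "x \<in> {l<..<r} \<and> x \<in> {c..d+h}")
            case True
            then have "\<bar>\<phi> x\<bar> * cmod (g x) \<le> 1 * C" using elim \<phi>abs[of x] by (intro mult_mono) auto
            then show ?thesis using True by simp
          next
            case False
            then show ?thesis using \<phi>supp[of x] Cpos by (auto simp: indicator_def)
          qed
        qed
      qed
      also have "\<dots> = C * (d + h - c)" using cd h by simp
      finally show ?thesis by (simp add: set_lebesgue_integral_def)
    qed
    have "cmod (u - v) \<le> cmod (P - Q) + cmod (P - u) + cmod (Q - v)" for u v P Q :: complex
      by norm
    note 1 = this[of "f c" "f d" ?Ic ?Id]
    have 2: "cmod (?Ic - ?Id) \<le> C * (d + h - c)"
      using R unfolding L[symmetric] eq norm_minus_cancel .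
    have "C * (d + h - c) = C * (d - c) + C * h" by (simp add: algebra_simps)
    then show "cmod (f c - f d) \<le> C * (d - c) + e" using 1 2 h(6) pc(2) pd(2) by linarith
  qed
  have "C-lipschitz_on {l<..<r} f"
  proof (rule lipschitz_onI)
    fix x y assume "x \<in> {l<..<r}" "y \<in> {l<..<r}"
    then show "dist (f x) (f y) \<le> C * dist x y"
      using main[of x y] main[of y x] by (cases x y rule: linorder_cases) (auto simp: dist_norm norm_minus_commute)
  qed (rule Cpos)
  then show ?thesis by blast
qed

text \<open>
  A Lipschitz function on an interval is uniformly continuous, so it extends to the closure.
\<close>
lemma W2_infinity_extension:
  assumes "W2_infinity {l<..<r} f" "l < r"
  obtains F where "continuous_on {l..r} F" "\<And>x. x \<in> {l<..<r} \<Longrightarrow> F x = f x"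
    "\<And>x. x \<in> {l..r} \<Longrightarrow> closure_ext {l<..<r} f x = F x"
proof -
  obtain L where "L-lipschitz_on {l<..<r} f"
    using assms weak_deriv_lipschitz unfolding W2_infinity_def by blast
  then have uc: "uniformly_continuous_on {l<..<r} f" by (rule lipschitz_on_uniformly_continuous)
  obtain F where "uniformly_continuous_on (closure {l<..<r}) F" and F: "\<And>x. x \<in> {l<..<r} \<Longrightarrow> f x = F x"
    using uniformly_continuous_on_extension_on_closure[OF uc] by metis
  then have Fc: "continuous_on {l..r} F" using assms(2) by (simp add: uniformly_continuous_imp_continuous)
  show ?thesis
  proof (rule that[OF Fc])
    show "closure_ext {l<..<r} f x = F x" if x: "x \<in> {l..r}" for x
    proof -
      have "(F \<longlongrightarrow> F x) (at x within {l<..<r})"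
        by (rule tendsto_within_subset[where S="{l..r}" and f=F])
          (use Fc x in \<open>auto simp: continuous_on_def\<close>)
      then have "(f \<longlongrightarrow> F x) (at x within {l<..<r})"
        by (rule Lim_transform_eventually) (auto simp: eventually_at_filter F)
      moreover have "x islimpt {l<..<r}"
      proof -
        consider "x = l" | "x = r" | "x \<in> interior {l<..<r}" using x by fastforce
        then show ?thesis
          using islimpt_greaterThanLessThan1[OF assms(2)] islimpt_greaterThanLessThan2[OF assms(2)]
            interior_limit_point by cases auto
      qed
      then have "at x within {l<..<r} \<noteq> bot" by (simp add: trivial_limit_within)
      ultimately show ?thesis unfolding closure_ext_def by (intro tendsto_Lim)
    qed
  qed (use F in auto)
qed

section \<open>The initial value problem as an entire function of the spectral parameter\<close>

text \<open>
  The bound is required at every point. A bound that holds almost everywhere can always be turned into this by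
  changing the function on a null set, which leaves the integral equations unchanged.
\<close>
definition bounded_coeff :: "real \<Rightarrow> real \<Rightarrow> real \<Rightarrow> (real \<Rightarrow> complex) \<Rightarrow> bool" where
  "bounded_coeff a b K g \<longleftrightarrow> g \<in> borel_measurable (lebesgue_on {a..b}) \<and> (\<forall>t\<in>{a..b}. cmod (g t) \<le> K)"

lemma bounded_coeffD: "bounded_coeff a b K g \<Longrightarrow> t \<in> {a..b} \<Longrightarrow> cmod (g t) \<le> K"
  by (simp add: bounded_coeff_def)

lemma bounded_coeff_nonneg: "bounded_coeff a b K g \<Longrightarrow> t \<in> {a..b} \<Longrightarrow> K \<ge> 0"
  using bounded_coeffD norm_ge_zero order_trans by blast

lemma bounded_coeff_integrable:
  assumes g: "bounded_coeff a b K g" and f: "continuous_on {a..b} f"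
  shows "(\<lambda>s. g s * f s) integrable_on {a..b}"
proof -
  have "bounded (f ` {a..b})" using f by (intro compact_imp_bounded compact_continuous_image) auto
  then obtain M where M: "\<And>t. t \<in> {a..b} \<Longrightarrow> cmod (f t) \<le> M" unfolding bounded_iff by blast
  show ?thesis
  proof (rule measurable_bounded_by_integrable_imp_integrable)
    have "f \<in> borel_measurable (lebesgue_on {a..b})"
      using f by (rule continuous_imp_measurable_on_sets_lebesgue) simp
    then show "(\<lambda>s. g s * f s) \<in> borel_measurable (lebesgue_on {a..b})"
      using g by (auto simp: bounded_coeff_def)
    show "(\<lambda>s. K * M) integrable_on {a..b}" by (rule integrable_const_ivl)
    show "cmod (g t * f t) \<le> K * M" if "t \<in> {a..b}" for t
      unfolding norm_mult
      by (intro mult_mono bounded_coeffD[OF g that] M[OF that] bounded_coeff_nonneg[OF g that] norm_ge_zero)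
  qed simp
qed

lemma bounded_coeff_integrable_sub:
  assumes "bounded_coeff a b K g" "continuous_on {a..b} f" "t \<in> {a..b}"
  shows "(\<lambda>s. g s * f s) integrable_on {a..t}"
  by (rule integrable_on_subinterval[OF bounded_coeff_integrable[OF assms(1,2)]]) (use assms in auto)

lemma bounded_coeff_continuous_integral:
  assumes "bounded_coeff a b K g" "continuous_on {a..b} f"
  shows "continuous_on {a..b} (\<lambda>t. integral {a..t} (\<lambda>s. g s * f s))"
  by (rule indefinite_integral_continuous_1[OF bounded_coeff_integrable[OF assms]])

text \<open>
  This estimate drives both the convergence of the Picard series and uniqueness: each integration gains a factor
  \<open>K (t - a) / (n + 1)\<close>.
\<close>
lemma volterra_bound_step:
  assumes g: "bounded_coeff a b K g" and f: "continuous_on {a..b} f"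
    and le: "\<And>s. s \<in> {a..b} \<Longrightarrow> cmod (f s) \<le> M * (K * (s - a)) ^ n / fact n" and t: "t \<in> {a..b}"
  shows "cmod (integral {a..t} (\<lambda>s. g s * f s)) \<le> M * (K * (t - a)) ^ Suc n / fact (Suc n)"
proof -
  have der: "((\<lambda>s. M * (K * (s - a)) ^ Suc n / fact (Suc n)) has_vector_derivative
       K * (M * (K * (s - a)) ^ n / fact n)) (at s within {a..t})" for s
    unfolding has_real_derivative_iff_has_vector_derivative[symmetric]
    by (rule derivative_eq_intros refl | simp)+
  have I: "((\<lambda>s. K * (M * (K * (s - a)) ^ n / fact n)) has_integral
      (M * (K * (t - a)) ^ Suc n / fact (Suc n) - M * (K * (a - a)) ^ Suc n / fact (Suc n))) {a..t}"
    by (rule fundamental_theorem_of_calculus) (use t der in auto)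
  have "cmod (integral {a..t} (\<lambda>s. g s * f s)) \<le> integral {a..t} (\<lambda>s. K * (M * (K * (s - a)) ^ n / fact n))"
  proof (rule Henstock_Kurzweil_Integration.integral_norm_bound_integral)
    show "(\<lambda>s. g s * f s) integrable_on {a..t}" by (rule bounded_coeff_integrable_sub[OF g f t])
    show "(\<lambda>s. K * (M * (K * (s - a)) ^ n / fact n)) integrable_on {a..t}" using I by blast
    show "cmod (g s * f s) \<le> K * (M * (K * (s - a)) ^ n / fact n)" if "s \<in> {a..t}" for s
    proof -
      have s: "s \<in> {a..b}" using that t by auto
      show ?thesis unfolding norm_mult
        by (intro mult_mono bounded_coeffD[OF g s] le[OF s] bounded_coeff_nonneg[OF g s] norm_ge_zero)
    qed
  qed
  also have "\<dots> = M * (K * (t - a)) ^ Suc n / fact (Suc n)"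
    unfolding integral_unique[OF I] by simp
  finally show ?thesis .
qed

text \<open>
  The system \<open>y' = \<alpha> u\<close>, \<open>u' = \<beta> y\<close> in integrated form, with \<open>z True = y\<close>, \<open>z False = u\<close>,
  \<open>g True = \<alpha>\<close> and \<open>g False = \<beta>\<close>. The index in \<open>bool\<close> states both equations at once, and negation exchanges
  the components.
\<close>
definition volterra_solution :: "real \<Rightarrow> real \<Rightarrow> (bool \<Rightarrow> real \<Rightarrow> complex) \<Rightarrow> (bool \<Rightarrow> real \<Rightarrow> complex) \<Rightarrow> bool" where
  "volterra_solution a b g z \<longleftrightarrow> (\<forall>i. continuous_on {a..b} (z i) \<and>
     (\<forall>t\<in>{a..b}. z i t = z i a + integral {a..t} (\<lambda>s. g i s * z (\<not> i) s)))"

primrec volterra_iter :: "real \<Rightarrow> (bool \<Rightarrow> real \<Rightarrow> complex) \<Rightarrow> (bool \<Rightarrow> complex) \<Rightarrow> nat \<Rightarrow> bool \<Rightarrow> real \<Rightarrow> complex" where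
  "volterra_iter a g c 0 = (\<lambda>i t. c i)"
| "volterra_iter a g c (Suc n) = (\<lambda>i t. integral {a..t} (\<lambda>s. g i s * volterra_iter a g c n (\<not> i) s))"

definition volterra_sum :: "real \<Rightarrow> (bool \<Rightarrow> real \<Rightarrow> complex) \<Rightarrow> (bool \<Rightarrow> complex) \<Rightarrow> bool \<Rightarrow> real \<Rightarrow> complex" where
  "volterra_sum a g c i t = (\<Sum>n. volterra_iter a g c n i t)"

lemma volterra_iter_continuous:
  assumes "\<And>i. bounded_coeff a b K (g i)"
  shows "continuous_on {a..b} (volterra_iter a g c n i)"
proof (induction n arbitrary: i)
  case 0
  then show ?case by simp
next
  case (Suc n)
  show ?case unfolding volterra_iter.simps
    by (rule bounded_coeff_continuous_integral[OF assms Suc])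
qed

lemma volterra_iter_bound:
  assumes g: "\<And>i. bounded_coeff a b K (g i)" and t: "t \<in> {a..b}"
  shows "cmod (volterra_iter a g c n i t) \<le> (cmod (c True) + cmod (c False)) * (K * (t - a)) ^ n / fact n"
  using t
proof (induction n arbitrary: i t)
  case 0
  then show ?case by (cases i) auto
next
  case (Suc n)
  show ?case unfolding volterra_iter.simps
    by (rule volterra_bound_step[OF g volterra_iter_continuous[OF g] Suc.IH Suc.prems])
qed

lemma volterra_iter_bound_uniform:
  assumes g: "\<And>i. bounded_coeff a b K (g i)" and t: "t \<in> {a..b}"
  shows "cmod (volterra_iter a g c n i t) \<le> (cmod (c True) + cmod (c False)) * ((K * (b - a)) ^ n / fact n)"
proof -
  have "K \<ge> 0" by (rule bounded_coeff_nonneg[OF g t])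
  then have "(K * (t - a)) ^ n \<le> (K * (b - a)) ^ n" using t by (intro power_mono mult_left_mono) auto
  then have "(cmod (c True) + cmod (c False)) * (K * (t - a)) ^ n / fact n \<le> (cmod (c True) + cmod (c False)) * ((K * (b - a)) ^ n / fact n)"
    by (simp add: divide_right_mono mult_left_mono)
  then show ?thesis using volterra_iter_bound[where g=g and c=c and n=n and i=i, OF g t] by linarith
qed

lemma summable_power_over_fact: "summable (\<lambda>n. M * (x ^ n / fact n :: real))"
  using summable_exp[of x] by (intro summable_mult) (simp add: field_simps)

lemma volterra_sum_uniform_limit:
  assumes g: "\<And>i. bounded_coeff a b K (g i)"
  shows "uniform_limit {a..b} (\<lambda>N t. \<Sum>n<N. volterra_iter a g c n i t) (volterra_sum a g c i) sequentially"
  unfolding volterra_sum_def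
  by (rule Weierstrass_m_test[OF volterra_iter_bound_uniform[OF g] summable_power_over_fact])

lemma volterra_sum_start: "volterra_sum a g c i a = c i"
proof -
  have "(\<lambda>n. volterra_iter a g c n i a) sums (\<Sum>n\<in>{0}. volterra_iter a g c n i a)"
  proof (rule sums_finite)
    fix n :: nat assume "n \<notin> {0}"
    then obtain k where "n = Suc k" using not0_implies_Suc by auto
    then show "volterra_iter a g c n i a = 0" by simp
  qed simp
  then show ?thesis by (simp add: volterra_sum_def sums_iff)
qed

text \<open>
  The partial sums satisfy the recursion \<open>S (N + 1) = c + \<integral> g S N\<close>; dominated convergence passes to the limit, since
  the coefficients are merely measurable.
\<close>
lemma volterra_sum_solution:
  assumes g: "\<And>i. bounded_coeff a b K (g i)"
  shows "volterra_solution a b g (volterra_sum a g c)"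
  unfolding volterra_solution_def
proof (intro allI conjI ballI)
  let ?S = "\<lambda>i N t. \<Sum>n<N. volterra_iter a g c n i t"
  have contS: "continuous_on {a..b} (?S i N)" for i N
    by (intro continuous_intros volterra_iter_continuous[OF g])
  show cont: "continuous_on {a..b} (volterra_sum a g c i)" for i
    by (rule uniform_limit_theorem[OF _ volterra_sum_uniform_limit[OF g]]) (auto intro!: always_eventually contS)
  fix i t assume t: "t \<in> {a..b}"
  let ?B = "\<Sum>n. (cmod (c True) + cmod (c False)) * ((K * (b - a)) ^ n / fact n)"
  have K0: "K \<ge> 0" by (rule bounded_coeff_nonneg[OF g t])
  have lim: "(\<lambda>N. ?S i N s) \<longlonglongrightarrow> volterra_sum a g c i s" if "s \<in> {a..b}" for s i
    by (rule tendsto_uniform_limitI[OF volterra_sum_uniform_limit[OF g] that])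
  have SB: "cmod (?S i N s) \<le> ?B" if s: "s \<in> {a..b}" for i N s
  proof -
    have "cmod (?S i N s) \<le> (\<Sum>n<N. (cmod (c True) + cmod (c False)) * ((K * (b - a)) ^ n / fact n))"
      by (rule sum_norm_le) (rule volterra_iter_bound_uniform[OF g s])
    also have "\<dots> \<le> ?B"
      by (rule sum_le_suminf[OF summable_power_over_fact]) (use K0 t in auto)
    finally show ?thesis .
  qed
  have rec: "?S i (Suc N) t = c i + integral {a..t} (\<lambda>s. g i s * ?S (\<not> i) N s)" for N
  proof -
    have "integral {a..t} (\<lambda>s. g i s * ?S (\<not> i) N s) = (\<Sum>n<N. integral {a..t} (\<lambda>s. g i s * volterra_iter a g c n (\<not> i) s))"
      unfolding sum_distrib_left
      by (rule integral_sum) (auto intro: bounded_coeff_integrable_sub[OF g volterra_iter_continuous[OF g] t])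
    then show ?thesis by (simp add: sum.lessThan_Suc_shift del: sum.lessThan_Suc)
  qed
  have "(\<lambda>N. integral {a..t} (\<lambda>s. g i s * ?S (\<not> i) N s)) \<longlonglongrightarrow> integral {a..t} (\<lambda>s. g i s * volterra_sum a g c (\<not> i) s)"
  proof (rule dominated_convergence(2))
    show "(\<lambda>s. g i s * ?S (\<not> i) N s) integrable_on {a..t}" for N
      by (rule bounded_coeff_integrable_sub[OF g contS t])
    show "(\<lambda>s. K * ?B) integrable_on {a..t}" by (rule integrable_const_ivl)
    show "cmod (g i s * ?S (\<not> i) N s) \<le> K * ?B" if "s \<in> {a..t}" for N s
    proof -
      have s: "s \<in> {a..b}" using that t by auto
      show ?thesis unfolding norm_mult
        by (intro mult_mono bounded_coeffD[OF g s] SB[OF s] K0 norm_ge_zero)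
    qed
    show "(\<lambda>N. g i s * ?S (\<not> i) N s) \<longlonglongrightarrow> g i s * volterra_sum a g c (\<not> i) s" if "s \<in> {a..t}" for s
      by (intro tendsto_intros lim) (use that t in auto)
  qed
  then have "(\<lambda>N. c i + integral {a..t} (\<lambda>s. g i s * ?S (\<not> i) N s)) \<longlonglongrightarrow> c i + integral {a..t} (\<lambda>s. g i s * volterra_sum a g c (\<not> i) s)"
    by (intro tendsto_intros)
  then have "(\<lambda>N. ?S i (Suc N) t) \<longlonglongrightarrow> c i + integral {a..t} (\<lambda>s. g i s * volterra_sum a g c (\<not> i) s)"
    unfolding rec .
  then have "(\<lambda>N. ?S i N t) \<longlonglongrightarrow> c i + integral {a..t} (\<lambda>s. g i s * volterra_sum a g c (\<not> i) s)"
    by (rule LIMSEQ_imp_Suc)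
  then show "volterra_sum a g c i t = volterra_sum a g c i a + integral {a..t} (\<lambda>s. g i s * volterra_sum a g c (\<not> i) s)"
    using lim[OF t, of i] LIMSEQ_unique unfolding volterra_sum_start by blast
qed

lemma volterra_solution_lincomb:
  assumes g: "\<And>i. bounded_coeff a b K (g i)"
    and z: "volterra_solution a b g z" and w: "volterra_solution a b g w"
  shows "volterra_solution a b g (\<lambda>i t. \<alpha> * z i t + \<beta> * w i t)"
  unfolding volterra_solution_def
proof (intro allI conjI ballI)
  have zc: "continuous_on {a..b} (z i)" and wc: "continuous_on {a..b} (w i)" for i
    using z w by (auto simp: volterra_solution_def)
  show "continuous_on {a..b} (\<lambda>t. \<alpha> * z i t + \<beta> * w i t)" for i by (intro continuous_intros zc wc)
  fix i t assume t: "t \<in> {a..b}"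
  have "integral {a..t} (\<lambda>s. g i s * (\<alpha> * z (\<not> i) s + \<beta> * w (\<not> i) s))
      = integral {a..t} (\<lambda>s. \<alpha> * (g i s * z (\<not> i) s) + \<beta> * (g i s * w (\<not> i) s))"
    by (simp add: algebra_simps)
  also have "\<dots> = integral {a..t} (\<lambda>s. \<alpha> * (g i s * z (\<not> i) s)) + integral {a..t} (\<lambda>s. \<beta> * (g i s * w (\<not> i) s))"
    by (intro integral_add integrable_on_mult_right bounded_coeff_integrable_sub[OF g _ t] zc wc)
  also have "\<dots> = \<alpha> * (z i t - z i a) + \<beta> * (w i t - w i a)"
  proof -
    have "integral {a..t} (\<lambda>s. g i s * z (\<not> i) s) = z i t - z i a"
      using z t unfolding volterra_solution_def by (metis add_diff_cancel_left')
    moreover have "integral {a..t} (\<lambda>s. g i s * w (\<not> i) s) = w i t - w i a"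
      using w t unfolding volterra_solution_def by (metis add_diff_cancel_left')
    ultimately show ?thesis by simp
  qed
  finally show "\<alpha> * z i t + \<beta> * w i t = \<alpha> * z i a + \<beta> * w i a + integral {a..t} (\<lambda>s. g i s * (\<alpha> * z (\<not> i) s + \<beta> * w (\<not> i) s))"
    by (simp add: algebra_simps)
qed

text \<open>
  A solution with zero initial value is a fixed point of the integral operator, so the gain of
  \<open>volterra_bound_step\<close> can be iterated indefinitely.
\<close>
lemma volterra_solution_zero:
  assumes g: "\<And>i. bounded_coeff a b K (g i)" and z: "volterra_solution a b g z" and z0: "\<And>i. z i a = 0"
    and t: "t \<in> {a..b}"
  shows "z i t = 0"
proof -
  have zc: "continuous_on {a..b} (z i)" for i using z by (auto simp: volterra_solution_def)
  have "bounded (z True ` {a..b} \<union> z False ` {a..b})"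
    by (intro bounded_Un[THEN iffD2] conjI compact_imp_bounded compact_continuous_image zc) auto
  then obtain M where "\<forall>x\<in>z True ` {a..b} \<union> z False ` {a..b}. cmod x \<le> M" by (auto simp: bounded_iff)
  then have M: "cmod (z i t) \<le> M" if "t \<in> {a..b}" for i t using that by (cases i) auto
  have "cmod (z i t) \<le> M * (K * (t - a)) ^ n / fact n" if "t \<in> {a..b}" for n i t
    using that
  proof (induction n arbitrary: i t)
    case 0
    then show ?case using M by simp
  next
    case (Suc n)
    have "z i t = integral {a..t} (\<lambda>s. g i s * z (\<not> i) s)"
      using z z0 Suc.prems by (auto simp: volterra_solution_def)
    then show ?case using volterra_bound_step[OF g zc Suc.IH Suc.prems, of i "\<not> i"] by simp
  qed
  then have "cmod (z i t) \<le> M * ((K * (t - a)) ^ n / fact n)" for n using t by simp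
  moreover have "(\<lambda>n. M * ((K * (t - a)) ^ n / fact n)) \<longlonglongrightarrow> 0"
    by (rule summable_LIMSEQ_zero[OF summable_power_over_fact])
  ultimately have "cmod (z i t) \<le> 0"
    by (intro LIMSEQ_le_const[of _ 0]) auto
  then show ?thesis by simp
qed

lemma volterra_solution_eq:
  assumes g: "\<And>i. bounded_coeff a b K (g i)" and z: "volterra_solution a b g z"
    and t: "t \<in> {a..b}"
  shows "z i t = z True a * volterra_sum a g (\<lambda>j. of_bool j) i t + z False a * volterra_sum a g (\<lambda>j. of_bool (\<not> j)) i t"
proof -
  let ?T = "volterra_sum a g (\<lambda>j. of_bool j)" and ?F = "volterra_sum a g (\<lambda>j. of_bool (\<not> j))"
  have "volterra_solution a b g (\<lambda>i t. z True a * ?T i t + z False a * ?F i t)"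
    by (rule volterra_solution_lincomb[OF g volterra_sum_solution[OF g] volterra_sum_solution[OF g]])
  then have "volterra_solution a b g (\<lambda>i t. 1 * z i t + (-1) * (z True a * ?T i t + z False a * ?F i t))"
    by (rule volterra_solution_lincomb[OF g z])
  then have "1 * z i t + (-1) * (z True a * ?T i t + z False a * ?F i t) = 0"
  proof (rule volterra_solution_zero[OF g _ _ t])
    show "1 * z i a + (-1) * (z True a * ?T i a + z False a * ?F i a) = 0" for i
      by (cases i) (simp_all add: volterra_sum_start)
  qed
  then show ?thesis by (simp add: algebra_simps)
qed

text \<open>
  Functions \<open>f \<mu> t\<close> that are polynomials in \<open>\<mu>\<close> with continuous coefficients on \<open>[a, b]\<close>. Generating
  them inductively avoids differentiation under the integral sign: the integral operators preserve the class term by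
  term.
\<close>
inductive entire_family :: "real \<Rightarrow> real \<Rightarrow> (complex \<Rightarrow> real \<Rightarrow> complex) \<Rightarrow> bool" for a b where
  const: "continuous_on {a..b} f \<Longrightarrow> entire_family a b (\<lambda>\<mu>. f)"
| add: "entire_family a b f \<Longrightarrow> entire_family a b h \<Longrightarrow> entire_family a b (\<lambda>\<mu> t. f \<mu> t + h \<mu> t)"
| times: "entire_family a b f \<Longrightarrow> entire_family a b (\<lambda>\<mu> t. \<mu> * f \<mu> t)"
| cong: "entire_family a b f \<Longrightarrow> (\<And>\<mu> t. t \<in> {a..b} \<Longrightarrow> h \<mu> t = f \<mu> t) \<Longrightarrow> entire_family a b h"

lemma entire_family_continuous:
  assumes "entire_family a b f" shows "continuous_on {a..b} (f \<mu>)"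
proof -
  have "\<forall>\<mu>. continuous_on {a..b} (f \<mu>)"
    using assms
  proof (induct f rule: entire_family.induct)
    case (const f)
    then show ?case by blast
  next
    case (add f h)
    then show ?case by (simp add: continuous_on_add)
  next
    case (times f)
    then show ?case by (simp add: continuous_on_mult_left)
  next
    case (cong f h)
    show ?case
    proof
      fix \<mu> show "continuous_on {a..b} (h \<mu>)"
        using cong(2)[rule_format, of \<mu>] by (rule continuous_on_eq) (metis cong(3))
    qed
  qed
  then show ?thesis by blast
qed

lemma entire_family_holomorphic:
  assumes "entire_family a b f" "t \<in> {a..b}" shows "(\<lambda>\<mu>. f \<mu> t) holomorphic_on S"
  using assms(1)
proof (induct f rule: entire_family.induct)
  case (const f)
  show ?case by (rule holomorphic_on_const)
next
  case (add f h)
  show ?case by (rule holomorphic_on_add[OF add(2) add(4)])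
next
  case (times f)
  show ?case by (rule holomorphic_on_mult[OF holomorphic_on_ident times(2)])
next
  case (cong f h)
  have eq: "h \<mu> t = f \<mu> t" for \<mu> by (rule cong(3)[OF assms(2)])
  show ?case unfolding eq by (rule cong(2))
qed

lemma entire_family_integral:
  assumes g: "bounded_coeff a b K g"
  shows "entire_family a b f \<Longrightarrow> entire_family a b (\<lambda>\<mu> t. integral {a..t} (\<lambda>s. g s * f \<mu> s))"
proof (induction f rule: entire_family.induct)
  case (const f)
  show ?case by (rule entire_family.const[OF bounded_coeff_continuous_integral[OF g const]])
next
  case (add f h)
  show ?case
  proof (rule entire_family.cong[OF entire_family.add[OF add.IH]])
    fix \<mu> t assume t: "t \<in> {a..b}"
    show "integral {a..t} (\<lambda>s. g s * (f \<mu> s + h \<mu> s)) = integral {a..t} (\<lambda>s. g s * f \<mu> s) + integral {a..t} (\<lambda>s. g s * h \<mu> s)"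
      unfolding distrib_left
      by (intro integral_add bounded_coeff_integrable_sub[OF g _ t] entire_family_continuous add.hyps)
  qed
next
  case (times f)
  show ?case
  proof (rule entire_family.cong[OF entire_family.times[OF times.IH]])
    fix \<mu> t
    show "integral {a..t} (\<lambda>s. g s * (\<mu> * f \<mu> s)) = \<mu> * integral {a..t} (\<lambda>s. g s * f \<mu> s)"
      by (simp add: mult.left_commute)
  qed
next
  case (cong f h)
  show ?case
  proof (rule entire_family.cong[OF cong.IH])
    fix \<mu> t assume "t \<in> {a..b}"
    then show "integral {a..t} (\<lambda>s. g s * h \<mu> s) = integral {a..t} (\<lambda>s. g s * f \<mu> s)"
      by (intro integral_cong) (use cong.hyps in auto)
  qed
qed

lemma volterra_iter_entire:
  assumes A: "\<And>i. bounded_coeff a b K (A i)" and B: "\<And>i. bounded_coeff a b K (B i)"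
  shows "entire_family a b (\<lambda>\<mu>. volterra_iter a (\<lambda>i s. A i s + \<mu> * B i s) c n i)"
proof (induction n arbitrary: i)
  case 0
  then show ?case by (simp add: entire_family.const)
next
  case (Suc n)
  let ?v = "\<lambda>\<mu>. volterra_iter a (\<lambda>i s. A i s + \<mu> * B i s) c n (\<not> i)"
  show ?case
    unfolding volterra_iter.simps
  proof (rule entire_family.cong[OF entire_family.add[OF entire_family_integral[OF A[of i] Suc[of "\<not> i"]]
          entire_family.times[OF entire_family_integral[OF B[of i] Suc[of "\<not> i"]]]]])
    fix \<mu> t assume t: "t \<in> {a..b}"
    have "integral {a..t} (\<lambda>s. (A i s + \<mu> * B i s) * ?v \<mu> s) = integral {a..t} (\<lambda>s. A i s * ?v \<mu> s + \<mu> * (B i s * ?v \<mu> s))"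
      by (simp add: algebra_simps)
    also have "\<dots> = integral {a..t} (\<lambda>s. A i s * ?v \<mu> s) + integral {a..t} (\<lambda>s. \<mu> * (B i s * ?v \<mu> s))"
      by (intro integral_add integrable_on_mult_right bounded_coeff_integrable_sub[OF A _ t] bounded_coeff_integrable_sub[OF B _ t]
         entire_family_continuous[OF Suc])
    finally show "integral {a..t} (\<lambda>s. (A i s + \<mu> * B i s) * ?v \<mu> s) = integral {a..t} (\<lambda>s. A i s * ?v \<mu> s) + \<mu> * integral {a..t} (\<lambda>s. B i s * ?v \<mu> s)"
      by simp
  qed
qed

lemma bounded_coeff_affine:
  assumes A: "bounded_coeff a b K A" and B: "bounded_coeff a b K B" and "cmod \<mu> \<le> R"
  shows "bounded_coeff a b (K + R * K) (\<lambda>s. A s + \<mu> * B s)"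
  unfolding bounded_coeff_def
proof (intro conjI ballI)
  show "(\<lambda>s. A s + \<mu> * B s) \<in> borel_measurable (lebesgue_on {a..b})"
    using A B by (auto simp: bounded_coeff_def)
  fix t assume t: "t \<in> {a..b}"
  have "cmod (A t + \<mu> * B t) \<le> cmod (A t) + cmod \<mu> * cmod (B t)"
    by (metis norm_mult norm_triangle_ineq)
  also have "\<dots> \<le> K + R * K"
    by (intro add_mono mult_mono bounded_coeffD[OF A t] bounded_coeffD[OF B t] norm_ge_zero assms(3)
       order_trans[OF norm_ge_zero assms(3)])
  finally show "cmod (A t + \<mu> * B t) \<le> K + R * K" .
qed

text \<open>
  The Picard series converges uniformly for \<open>\<mu>\<close> in a disc, so its sum inherits holomorphy from its terms.
\<close>
lemma volterra_sum_holomorphic: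
  assumes A: "\<And>i. bounded_coeff a b K (A i)" and B: "\<And>i. bounded_coeff a b K (B i)" and t: "t \<in> {a..b}"
  shows "(\<lambda>\<mu>. volterra_sum a (\<lambda>i s. A i s + \<mu> * B i s) c i t) holomorphic_on UNIV"
proof (rule holomorphic_uniform_sequence[OF open_UNIV])
  let ?v = "\<lambda>n \<mu>. volterra_iter a (\<lambda>i s. A i s + \<mu> * B i s) c n i t"
  show "(\<lambda>\<mu>. \<Sum>n<N. ?v n \<mu>) holomorphic_on UNIV" for N
    by (intro holomorphic_intros entire_family_holomorphic[OF volterra_iter_entire[OF A B] t])
  fix \<mu>0 :: complex
  have "uniform_limit (cball \<mu>0 1) (\<lambda>N \<mu>. \<Sum>n<N. ?v n \<mu>) (\<lambda>\<mu>. \<Sum>n. ?v n \<mu>) sequentially"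
  proof (rule Weierstrass_m_test[OF _ summable_power_over_fact])
    fix n \<mu> assume "\<mu> \<in> cball \<mu>0 1"
    then have "cmod \<mu> \<le> cmod \<mu>0 + 1"
      using norm_triangle_sub[of \<mu> \<mu>0] by (auto simp: dist_norm norm_minus_commute)
    then show "cmod (?v n \<mu>) \<le> (cmod (c True) + cmod (c False)) * (((K + (cmod \<mu>0 + 1) * K) * (b - a)) ^ n / fact n)"
      by (intro volterra_iter_bound_uniform bounded_coeff_affine A B t)
  qed
  then show "\<exists>d>0. cball \<mu>0 d \<subseteq> UNIV \<and> uniform_limit (cball \<mu>0 d) (\<lambda>N \<mu>. \<Sum>n<N. ?v n \<mu>)
      (\<lambda>\<mu>. volterra_sum a (\<lambda>i s. A i s + \<mu> * B i s) c i t) sequentially"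
    by (intro exI[of _ 1]) (simp add: volterra_sum_def)
qed

lemma bounded_coeff_mono: "bounded_coeff a b K g \<Longrightarrow> K \<le> K' \<Longrightarrow> bounded_coeff a b K' g"
  unfolding bounded_coeff_def by fastforce

text \<open>
  The fundamental theorem is applied on every \<open>[a, t]\<close>; continuity of \<open>z\<close> is then a property of indefinite
  integrals.
\<close>
lemma abs_continuous_volterra_solution:
  assumes ab: "a \<le> b" and ac: "\<And>i. abs_continuous_on {a..b} (z i)" and N: "negligible N"
    and der: "\<And>i t. t \<in> {a..b} - N \<Longrightarrow> (z i has_vector_derivative g i t * z (\<not> i) t) (at t within {a..b})"
  shows "volterra_solution a b g z"
proof -
  have I: "((\<lambda>s. g i s * z (\<not> i) s) has_integral (z i t - z i a)) {a..t}" if t: "t \<in> {a..b}" for i t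
  proof (rule abs_continuous_has_integral[OF _ _ N])
    show "abs_continuous_on {a..t} (z i)" by (rule abs_continuous_on_subset[OF ac]) (use t in auto)
    show "(z i has_vector_derivative g i s * z (\<not> i) s) (at s within {a..t})" if "s \<in> {a..t} - N" for s
      by (rule has_vector_derivative_within_subset[OF der]) (use that t in auto)
  qed (use t in auto)
  have eq: "z i t = z i a + integral {a..t} (\<lambda>s. g i s * z (\<not> i) s)" if t: "t \<in> {a..b}" for i t
    using integral_unique[OF I[OF t]] by simp
  have "continuous_on {a..b} (z i)" for i
  proof -
    have "(\<lambda>s. g i s * z (\<not> i) s) integrable_on {a..b}" using I[of b] ab by auto
    then have "continuous_on {a..b} (\<lambda>t. z i a + integral {a..t} (\<lambda>s. g i s * z (\<not> i) s))"
      by (intro continuous_intros indefinite_integral_continuous_1)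
    then show ?thesis by (rule continuous_on_eq) (simp add: eq[symmetric])
  qed
  then show ?thesis using eq unfolding volterra_solution_def by blast
qed

lemma volterra_solutionD:
  "volterra_solution a b g z \<Longrightarrow> t \<in> {a..b} \<Longrightarrow> z i t = z i a + integral {a..t} (\<lambda>s. g i s * z (\<not> i) s)"
  unfolding volterra_solution_def by blast

lemma volterra_solution_lipschitz:
  assumes g: "\<And>i. bounded_coeff a b K (g i)" and z: "volterra_solution a b g z"
  shows "lipschitz_Icc a b (z i)"
proof (cases "a \<le> b")
  case True
  have zc: "continuous_on {a..b} (z i)" for i using z by (auto simp: volterra_solution_def)
  have "bounded (z (\<not> i) ` {a..b})" by (intro compact_imp_bounded compact_continuous_image zc) auto
  then obtain M where M: "\<And>t. t \<in> {a..b} \<Longrightarrow> cmod (z (\<not> i) t) \<le> M" unfolding bounded_iff by blast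
  have K: "K \<ge> 0" using bounded_coeff_nonneg[OF g[of i], of a] True by simp
  have M0: "M \<ge> 0" using order_trans[OF norm_ge_zero M[of a]] True by simp
  have le: "cmod (z i t - z i s) \<le> K * M * (t - s)" if st: "a \<le> s" "s \<le> t" "t \<le> b" for s t
  proof -
    let ?f = "\<lambda>s. g i s * z (\<not> i) s"
    have int: "?f integrable_on {a..t}" by (rule bounded_coeff_integrable_sub[OF g zc]) (use st in auto)
    have "z i t = z i a + integral {a..t} ?f"
      by (rule volterra_solutionD[OF z]) (use st in auto)
    moreover have "z i s = z i a + integral {a..s} ?f"
      by (rule volterra_solutionD[OF z]) (use st in auto)
    ultimately have eq: "z i t - z i s = integral {s..t} ?f"
      using Henstock_Kurzweil_Integration.integral_combine[OF st(1,2) int] by algebra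
    have int': "?f integrable_on {s..t}" by (rule integrable_on_subinterval[OF int]) (use st in auto)
    have "cmod (integral {s..t} ?f) \<le> K * M * measure lborel {s..t}"
    proof (rule has_integral_bound_real[OF _ finite.emptyI integrable_integral[OF int']])
      show "0 \<le> K * M" using K M0 by simp
      show "cmod (?f v) \<le> K * M" if "v \<in> {s..t} - {}" for v
      proof -
        have v: "v \<in> {a..b}" using that st by auto
        show ?thesis unfolding norm_mult by (intro mult_mono bounded_coeffD[OF g v] M[OF v] K norm_ge_zero)
      qed
    qed
    then have "cmod (integral {s..t} ?f) \<le> K * M * (t - s)" using st by simp
    then show ?thesis unfolding eq .
  qed
  have "(K * M)-lipschitz_on {a..b} (z i)"
  proof (rule lipschitz_onI)
    fix s t assume "s \<in> {a..b}" "t \<in> {a..b}"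
    then show "dist (z i s) (z i t) \<le> K * M * dist s t"
      using le[of s t] le[of t s] by (cases "s \<le> t") (auto simp: dist_norm norm_minus_commute)
  qed (use K M0 in simp)
  then show ?thesis unfolding lipschitz_Icc_def by blast
qed (auto simp: lipschitz_Icc_def lipschitz_on_def intro: exI[of _ 0])

text \<open>
  The converse of \<open>abs_continuous_volterra_solution\<close>, together with \<open>volterra_solution_lipschitz\<close>.
\<close>
lemma volterra_solution_ae_derivative:
  assumes g: "\<And>i. bounded_coeff a b K (g i)" and z: "volterra_solution a b g z"
  obtains N where "negligible N"
    "\<And>i t. t \<in> {a..b} - N \<Longrightarrow> (z i has_vector_derivative g i t * z (\<not> i) t) (at t within {a..b})"
proof -
  have zc: "continuous_on {a..b} (z i)" for i using z by (auto simp: volterra_solution_def)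
  have "\<exists>N. negligible N \<and> (\<forall>t\<in>{a..b} - N. (z i has_vector_derivative g i t * z (\<not> i) t) (at t within {a..b}))" for i
  proof -
    let ?f = "\<lambda>s. g i s * z (\<not> i) s"
    obtain N where N: "negligible N" "\<And>t. t \<in> {a..b} - N \<Longrightarrow> ((\<lambda>t. integral {a..t} ?f) has_vector_derivative ?f t) (at t within {a..b})"
      using indefinite_integral_has_vector_derivative_ae[OF bounded_coeff_integrable[OF g zc]] by blast
    have "(z i has_vector_derivative ?f t) (at t within {a..b})" if t: "t \<in> {a..b} - N" for t
    proof -
      have "((\<lambda>t. z i a + integral {a..t} ?f) has_vector_derivative (0 + ?f t)) (at t within {a..b})"
        by (intro has_vector_derivative_add has_vector_derivative_const N(2)[OF t])
      then have "((\<lambda>t. z i a + integral {a..t} ?f) has_vector_derivative ?f t) (at t within {a..b})" by simp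
      then show ?thesis
        by (rule has_vector_derivative_transform[rotated 2]) (use t volterra_solutionD[OF z] in blast)+
    qed
    then show ?thesis using N(1) by blast
  qed
  then obtain N where N: "\<And>i. negligible (N i)"
    "\<And>i t. t \<in> {a..b} - N i \<Longrightarrow> (z i has_vector_derivative g i t * z (\<not> i) t) (at t within {a..b})" by metis
  show ?thesis
  proof (rule that[of "N True \<union> N False"])
    show "negligible (N True \<union> N False)" using N(1) by simp
    show "(z i has_vector_derivative g i t * z (\<not> i) t) (at t within {a..b})" if "t \<in> {a..b} - (N True \<union> N False)" for i t
      by (rule N(2)) (use that in \<open>cases i; auto\<close>)
  qed
qed

text \<open>
  The columns \<open>T\<close> and \<open>F\<close> below form the monodromy matrix, and \<open>D = det (monodromy - e)\<close> vanishes exactly if this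
  two-by-two matrix has a kernel.
\<close>
lemma quasi_periodic_zeros:
  fixes A B :: "bool \<Rightarrow> real \<Rightarrow> complex" and e :: complex
  assumes ab: "a < b" and A: "\<And>i. bounded_coeff a b K (A i)" and B: "\<And>i. bounded_coeff a b K (B i)"
  obtains D where "D holomorphic_on UNIV"
    "\<And>\<mu>. D \<mu> = 0 \<longleftrightarrow> (\<exists>z. volterra_solution a b (\<lambda>i s. A i s + \<mu> * B i s) z \<and>
        (\<exists>i. z i a \<noteq> 0) \<and> (\<forall>i. z i b = e * z i a))"
proof -
  define g where "g \<mu> i s = A i s + \<mu> * B i s" for \<mu> i s
  define T F where "T \<mu> = volterra_sum a (g \<mu>) (\<lambda>j. of_bool j)"
    and "F \<mu> = volterra_sum a (g \<mu>) (\<lambda>j. of_bool (\<not> j))" for \<mu>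
  define D where "D \<mu> = (T \<mu> True b - e) * (F \<mu> False b - e) - F \<mu> True b * T \<mu> False b" for \<mu>
  have b: "b \<in> {a..b}" using ab by auto
  have gb: "bounded_coeff a b (K + cmod \<mu> * K) (g \<mu> i)" for \<mu> i
    unfolding g_def by (rule bounded_coeff_affine[OF A B order_refl])
  have holT: "(\<lambda>\<mu>. T \<mu> i b) holomorphic_on UNIV" and holF: "(\<lambda>\<mu>. F \<mu> i b) holomorphic_on UNIV" for i
    unfolding T_def F_def g_def by (rule volterra_sum_holomorphic[OF A B b])+
  show ?thesis
  proof
    show "D holomorphic_on UNIV" unfolding D_def by (intro holomorphic_intros holT holF)
    show "D \<mu> = 0 \<longleftrightarrow> (\<exists>z. volterra_solution a b (\<lambda>i s. A i s + \<mu> * B i s) z \<and>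
        (\<exists>i. z i a \<noteq> 0) \<and> (\<forall>i. z i b = e * z i a))" for \<mu>
    proof
      assume D: "D \<mu> = 0"
      have "\<exists>\<alpha> \<beta>. (\<alpha> \<noteq> 0 \<or> \<beta> \<noteq> 0) \<and> \<alpha> * (T \<mu> True b - e) + \<beta> * F \<mu> True b = 0 \<and>
          \<alpha> * T \<mu> False b + \<beta> * (F \<mu> False b - e) = 0"
      proof (cases "T \<mu> True b - e = 0 \<and> F \<mu> True b = 0")
        case False
        \<comment> \<open>A nonzero row of a singular two-by-two matrix, rotated by a right angle, spans its kernel.\<close>
        then show ?thesis using D
          by (intro exI[of _ "- F \<mu> True b"] exI[of _ "T \<mu> True b - e"]) (auto simp: D_def algebra_simps)
      next
        case True
        show ?thesis
        proof (cases "T \<mu> False b = 0 \<and> F \<mu> False b - e = 0")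
          case False
          then show ?thesis using True
            by (intro exI[of _ "- (F \<mu> False b - e)"] exI[of _ "T \<mu> False b"]) (auto simp: algebra_simps)
        next
          case True2: True
          then show ?thesis using True by (intro exI[of _ 1] exI[of _ 0]) auto
        qed
      qed
      then obtain \<alpha> \<beta> where nz: "\<alpha> \<noteq> 0 \<or> \<beta> \<noteq> 0" and eqs: "\<alpha> * (T \<mu> True b - e) + \<beta> * F \<mu> True b = 0"
         "\<alpha> * T \<mu> False b + \<beta> * (F \<mu> False b - e) = 0" by blast
      let ?z = "\<lambda>i t. \<alpha> * T \<mu> i t + \<beta> * F \<mu> i t"
      have start: "?z True a = \<alpha>" "?z False a = \<beta>"
        by (simp_all add: T_def F_def volterra_sum_start)
      have "volterra_solution a b (g \<mu>) ?z"
        unfolding T_def F_def by (intro volterra_solution_lincomb[OF gb] volterra_sum_solution[OF gb])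
      moreover have "?z i b = e * ?z i a" for i
        using eqs start by (cases i) (simp_all add: algebra_simps)
      moreover have "\<exists>i. ?z i a \<noteq> 0" using nz start by metis
      ultimately show "\<exists>z. volterra_solution a b (\<lambda>i s. A i s + \<mu> * B i s) z \<and>
        (\<exists>i. z i a \<noteq> 0) \<and> (\<forall>i. z i b = e * z i a)" unfolding g_def by blast
    next
      assume "\<exists>z. volterra_solution a b (\<lambda>i s. A i s + \<mu> * B i s) z \<and>
        (\<exists>i. z i a \<noteq> 0) \<and> (\<forall>i. z i b = e * z i a)"
      then obtain z where z: "volterra_solution a b (g \<mu>) z" "\<exists>i. z i a \<noteq> 0" "\<And>i. z i b = e * z i a"
        unfolding g_def by blast
      have zb: "z i b = z True a * T \<mu> i b + z False a * F \<mu> i b" for i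
        unfolding T_def F_def by (rule volterra_solution_eq[OF gb z(1) b])
      have e1: "z True a * (T \<mu> True b - e) + z False a * F \<mu> True b = 0"
        using zb[of True] z(3)[of True] by (simp add: algebra_simps)
      have e2: "z True a * T \<mu> False b + z False a * (F \<mu> False b - e) = 0"
        using zb[of False] z(3)[of False] by (simp add: algebra_simps)
      have "z True a * D \<mu> = 0" using e1 e2 unfolding D_def by algebra
      moreover have "z False a * D \<mu> = 0" using e1 e2 unfolding D_def by algebra
      moreover have "z True a \<noteq> 0 \<or> z False a \<noteq> 0" using z(2) by (metis (full_types))
      ultimately show "D \<mu> = 0" by auto
    qed
  qed
qed

section \<open>A quadratic form that increases along solutions\<close>

lemma cmod_add_squared_le: "(cmod (x + y))\<^sup>2 \<le> 2 * (cmod x)\<^sup>2 + 2 * (cmod y)\<^sup>2"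
proof -
  have "(cmod (x + y))\<^sup>2 \<le> (cmod x + cmod y)\<^sup>2"
    by (intro power_mono norm_triangle_ineq) auto
  also have "\<dots> \<le> 2 * (cmod x)\<^sup>2 + 2 * (cmod y)\<^sup>2"
    using sum_squares_ge_zero[of "cmod x - cmod y" 0] by (simp add: power2_eq_square algebra_simps)
  finally show ?thesis .
qed

text \<open>
  With \<open>P = U + s1 Y\<close> and \<open>M = U - s1 Y\<close>, the right-hand side is a form in \<open>\<alpha> P + \<beta> M\<close> and \<open>\<beta> P + \<alpha> M\<close>. The
  hypothesis \<open>s1 + s2 \<noteq> 0\<close> says \<open>\<alpha> \<noteq> 0\<close>: a part of the growing mode \<open>P\<close> survives the interface. A small weight
  on \<open>P\<close> and a large weight on \<open>M\<close> in front of the interface pay for everything else.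
  Smaller \<open>h\<close> are admitted as well so that one value can serve all interfaces.
\<close>
lemma interface_form:
  fixes s1 s2 :: complex
  assumes "s1 \<noteq> 0" "s1 + s2 \<noteq> 0"
  obtains \<eta> where "\<eta> > 0" "\<And>h U Y. 0 < h \<Longrightarrow> h \<le> \<eta> \<Longrightarrow>
     h * (cmod (U + s1 * Y))\<^sup>2 - (1 / h) * (cmod (U - s1 * Y))\<^sup>2
       \<le> (cmod (U + s2 * Y))\<^sup>2 - h * (cmod (U - s2 * Y))\<^sup>2"
proof -
  define \<alpha> \<beta> where "\<alpha> = (s1 + s2) / (2 * s1)" and "\<beta> = (s1 - s2) / (2 * s1)"
  define A B where "A = (cmod \<alpha>)\<^sup>2" and "B = (cmod \<beta>)\<^sup>2"
  have A: "A > 0" using assms by (simp add: A_def \<alpha>_def)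
  have B: "B \<ge> 0" by (simp add: B_def)
  define \<eta> where "\<eta> = min 1 (min (A / (2 * (1 + 2 * B))) (1 / (1 + B + 2 * A)))"
  show ?thesis
  proof
    show "\<eta> > 0" using A B by (simp add: \<eta>_def)
    fix h :: real and U Y :: complex
    assume h: "0 < h" "h \<le> \<eta>"
    define P M where "P = U + s1 * Y" and "M = U - s1 * Y"
    have Wp: "U + s2 * Y = \<alpha> * P + \<beta> * M" and Wm: "U - s2 * Y = \<beta> * P + \<alpha> * M"
      using assms(1) by (simp_all add: \<alpha>_def \<beta>_def P_def M_def field_simps)
    have "A * (cmod P)\<^sup>2 = (cmod ((U + s2 * Y) + (- \<beta> * M)))\<^sup>2"
      unfolding Wp by (simp add: A_def norm_mult power_mult_distrib)
    also have "\<dots> \<le> 2 * (cmod (U + s2 * Y))\<^sup>2 + 2 * (B * (cmod M)\<^sup>2)"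
      using cmod_add_squared_le[of "U + s2 * Y" "- \<beta> * M"] by (simp add: B_def norm_mult power_mult_distrib)
    finally have 1: "(cmod (U + s2 * Y))\<^sup>2 \<ge> A / 2 * (cmod P)\<^sup>2 - B * (cmod M)\<^sup>2" by simp
    have "(cmod (U - s2 * Y))\<^sup>2 \<le> 2 * (B * (cmod P)\<^sup>2) + 2 * (A * (cmod M)\<^sup>2)"
      using cmod_add_squared_le[of "\<beta> * P" "\<alpha> * M"] unfolding Wm by (simp add: A_def B_def norm_mult power_mult_distrib)
    then have 2: "h * (cmod (U - s2 * Y))\<^sup>2 \<le> h * (2 * (B * (cmod P)\<^sup>2) + 2 * (A * (cmod M)\<^sup>2))"
      using h by (intro mult_left_mono) auto
    have "h \<le> A / (2 * (1 + 2 * B))" using h by (simp add: \<eta>_def)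
    then have "h * (2 * (1 + 2 * B)) \<le> A" using B by (subst (asm) pos_le_divide_eq) auto
    then have "h + 2 * (h * B) \<le> A / 2" by (simp add: algebra_simps)
    then have 3: "(h + 2 * (h * B)) * (cmod P)\<^sup>2 \<le> A / 2 * (cmod P)\<^sup>2" by (intro mult_right_mono) auto
    have "h \<le> 1 / (1 + B + 2 * A)" using h by (simp add: \<eta>_def)
    then have "h * (1 + B + 2 * A) \<le> 1" using A B by (subst (asm) pos_le_divide_eq) auto
    then have "1 + B + 2 * A \<le> 1 / h" using h by (subst pos_le_divide_eq) (auto simp: mult.commute)
    moreover have "h * A \<le> 1 * A" using h A by (intro mult_right_mono) (auto simp: \<eta>_def)
    ultimately have "B + 2 * (h * A) \<le> 1 / h" by simp
    then have 4: "(B + 2 * (h * A)) * (cmod M)\<^sup>2 \<le> 1 / h * (cmod M)\<^sup>2" by (intro mult_right_mono) auto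
    show "h * (cmod (U + s1 * Y))\<^sup>2 - (1 / h) * (cmod (U - s1 * Y))\<^sup>2
       \<le> (cmod (U + s2 * Y))\<^sup>2 - h * (cmod (U - s2 * Y))\<^sup>2"
      using 1 2 3 4 unfolding P_def[symmetric] M_def[symmetric] by (simp only: algebra_simps)
  qed
qed

text \<open>
  A polynomial close to \<open>s\<close>, corrected by an affine function to match the end values. The exact end values keep the
  interface condition in terms of \<open>s\<close>.
\<close>
lemma smooth_approximation:
  fixes s :: "real \<Rightarrow> complex"
  assumes "c < d" "continuous_on {c..d} s" "\<epsilon> > 0"
  obtains \<sigma> \<sigma>' where "continuous_on {c..d} \<sigma>'"
    "\<And>t. t \<in> {c..d} \<Longrightarrow> (\<sigma> has_vector_derivative \<sigma>' t) (at t within {c..d})"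
    "\<And>t. t \<in> {c..d} \<Longrightarrow> cmod (\<sigma> t - s t) \<le> \<epsilon>" "\<sigma> c = s c" "\<sigma> d = s d"
proof -
  obtain g where g: "polynomial_function g" "\<And>t. t \<in> {c..d} \<Longrightarrow> cmod (s t - g t) < \<epsilon> / 2"
    using Stone_Weierstrass_polynomial_function[of "{c..d}" s "\<epsilon> / 2"] assms by auto
  obtain g' where g': "polynomial_function g'" "\<And>t. (g has_vector_derivative g' t) (at t)"
    using has_vector_derivative_polynomial_function[OF g(1)] by blast
  define \<tau> where "\<tau> t = (t - c) / (d - c)" for t
  have \<tau>: "((\<lambda>t. \<tau> t) has_real_derivative 1 / (d - c)) (at t within S)" for t S
    unfolding \<tau>_def using assms(1) by (auto intro!: derivative_eq_intros)
  define \<sigma> where "\<sigma> t = g t + (1 - \<tau> t) *\<^sub>R (s c - g c) + \<tau> t *\<^sub>R (s d - g d)" for t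
  define \<sigma>' where "\<sigma>' t = g' t + (- (1 / (d - c))) *\<^sub>R (s c - g c) + (1 / (d - c)) *\<^sub>R (s d - g d)" for t
  show ?thesis
  proof
    have "continuous_on {c..d} g'" using g'(1) by (rule continuous_on_polymonial_function)
    then show "continuous_on {c..d} \<sigma>'" unfolding \<sigma>'_def by (intro continuous_intros)
    show "(\<sigma> has_vector_derivative \<sigma>' t) (at t within {c..d})" for t
      unfolding \<sigma>_def \<sigma>'_def
      by (rule derivative_eq_intros has_vector_derivative_at_within[OF g'(2)] \<tau> refl | simp)+
    show "cmod (\<sigma> t - s t) \<le> \<epsilon>" if t: "t \<in> {c..d}" for t
    proof -
      have \<tau>01: "0 \<le> \<tau> t" "\<tau> t \<le> 1" using t assms(1) by (auto simp: \<tau>_def)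
      have "\<sigma> t - s t = (1 - \<tau> t) *\<^sub>R (s c - g c) + \<tau> t *\<^sub>R (s d - g d) - (s t - g t)"
        by (simp add: \<sigma>_def)
      also have "cmod \<dots> \<le> cmod ((1 - \<tau> t) *\<^sub>R (s c - g c)) + cmod (\<tau> t *\<^sub>R (s d - g d)) + cmod (s t - g t)"
        by (rule order_trans[OF norm_triangle_ineq4 add_right_mono[OF norm_triangle_ineq]])
      also have "\<dots> \<le> (1 - \<tau> t) * (\<epsilon> / 2) + \<tau> t * (\<epsilon> / 2) + \<epsilon> / 2"
      proof -
        have gc: "cmod (s c - g c) \<le> \<epsilon> / 2" and gd: "cmod (s d - g d) \<le> \<epsilon> / 2" and gt: "cmod (s t - g t) \<le> \<epsilon> / 2"
          using g(2)[of c] g(2)[of d] g(2)[OF t] assms(1) by auto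
        have "cmod ((1 - \<tau> t) *\<^sub>R (s c - g c)) \<le> (1 - \<tau> t) * (\<epsilon> / 2)"
          using mult_left_mono[OF gc, of "1 - \<tau> t"] \<tau>01 by simp
        moreover have "cmod (\<tau> t *\<^sub>R (s d - g d)) \<le> \<tau> t * (\<epsilon> / 2)"
          using mult_left_mono[OF gd, of "\<tau> t"] \<tau>01 by simp
        ultimately show ?thesis using gt by (intro add_mono)
      qed
      also have "\<dots> = \<epsilon>" by (simp add: field_simps)
      finally show ?thesis .
    qed
  qed (use assms(1) in \<open>auto simp: \<sigma>_def \<tau>_def\<close>)
qed

text \<open>
  The first expression is \<open>P' - \<kappa> r P\<close> for \<open>P = u + \<kappa> \<sigma> y\<close>, with the derivatives of \<open>y\<close> and \<open>u\<close> taken from the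
  differential equation; it would vanish for \<open>\<sigma> = s\<close>, \<open>d\<sigma> = 0\<close>, \<open>q = 0\<close>. Both \<open>\<kappa> y\<close> and \<open>u\<close> are combinations of
  \<open>u \<plusminus> \<kappa> \<sigma> y\<close> with coefficients that stay bounded as \<open>\<kappa>\<close> grows, so the term from \<open>q\<close> is bounded and the term
  from \<open>\<sigma> - s\<close> is of order \<open>\<epsilon> \<bar>\<kappa>\<bar>\<close>. Replacing \<open>\<kappa>\<close> by \<open>-\<kappa>\<close> covers \<open>u - \<kappa> \<sigma> y\<close>.
\<close>
lemma wkb_error_bound:
  fixes s \<sigma> d\<sigma> \<kappa> q y u :: complex and r :: real
  assumes "s0 > 0" "cmod s \<ge> s0" "cmod \<sigma> \<ge> s0" "cmod (\<sigma> - s) \<le> \<epsilon>" "0 \<le> r" "r \<le> R" "1 \<le> cmod \<kappa>"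
    "cmod q \<le> Cq" "cmod d\<sigma> \<le> Cs"
  shows "cmod ((q + \<kappa>\<^sup>2 * r * s) * y + \<kappa> * (d\<sigma> * y + \<sigma> * (r / s * u)) - \<kappa> * r * (u + \<kappa> * \<sigma> * y))
     \<le> (cmod \<kappa> * R * \<epsilon> / s0 + (Cq + Cs) / (2 * s0)) * (cmod (u + \<kappa> * \<sigma> * y) + cmod (u - \<kappa> * \<sigma> * y))"
proof -
  define S where "S = cmod (u + \<kappa> * \<sigma> * y) + cmod (u - \<kappa> * \<sigma> * y)"
  have nz: "s \<noteq> 0" "\<sigma> \<noteq> 0" "\<kappa> \<noteq> 0" using assms by auto
  have \<epsilon>: "\<epsilon> \<ge> 0" using assms(4) norm_ge_zero order_trans by blast
  have "2 * (cmod \<kappa> * cmod \<sigma> * cmod y) = cmod ((u + \<kappa> * \<sigma> * y) - (u - \<kappa> * \<sigma> * y))"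
    by (simp add: norm_mult)
  also have "\<dots> \<le> S" unfolding S_def by (rule norm_triangle_ineq4)
  finally have y1: "cmod \<kappa> * cmod \<sigma> * cmod y \<le> S / 2" by simp
  have "s0 * (cmod \<kappa> * cmod y) \<le> cmod \<sigma> * (cmod \<kappa> * cmod y)" using assms(3) by (intro mult_right_mono) auto
  then have ky: "cmod \<kappa> * cmod y \<le> S / (2 * s0)" using y1 assms(1) by (simp add: field_simps)
  have "1 * cmod y \<le> cmod \<kappa> * cmod y" using assms(7) by (intro mult_right_mono) auto
  then have yy: "cmod y \<le> S / (2 * s0)" using ky by simp
  have "2 * cmod u = cmod ((u + \<kappa> * \<sigma> * y) + (u - \<kappa> * \<sigma> * y))" by (simp add: norm_mult)
  also have "\<dots> \<le> S" unfolding S_def by (rule norm_triangle_ineq)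
  finally have uu: "cmod u \<le> S / 2" by simp
  have S0: "S \<ge> 0" by (simp add: S_def)
  have eq: "(q + \<kappa>\<^sup>2 * r * s) * y + \<kappa> * (d\<sigma> * y + \<sigma> * (r / s * u)) - \<kappa> * r * (u + \<kappa> * \<sigma> * y)
     = \<kappa> * r * (s - \<sigma>) * (\<kappa> * y) + \<kappa> * r * ((\<sigma> - s) / s) * u + q * y + d\<sigma> * (\<kappa> * y)"
    using nz by (simp add: field_simps power2_eq_square)
  have t1: "cmod (\<kappa> * r * (s - \<sigma>) * (\<kappa> * y)) \<le> cmod \<kappa> * R * \<epsilon> * (S / (2 * s0))"
    unfolding norm_mult
    using assms ky \<epsilon> by (intro mult_mono) (auto simp: norm_minus_commute norm_mult)
  have t2: "cmod (\<kappa> * r * ((\<sigma> - s) / s) * u) \<le> cmod \<kappa> * R * (\<epsilon> / s0) * (S / 2)"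
    unfolding norm_mult norm_divide
    using assms uu \<epsilon> by (intro mult_mono frac_le) auto
  have t3: "cmod (q * y) \<le> Cq * (S / (2 * s0))"
    unfolding norm_mult using assms yy order_trans[OF norm_ge_zero assms(8)] by (intro mult_mono) auto
  have t4: "cmod (d\<sigma> * (\<kappa> * y)) \<le> Cs * (S / (2 * s0))"
    unfolding norm_mult[of d\<sigma>] using assms ky order_trans[OF norm_ge_zero assms(9)] by (intro mult_mono) (auto simp: norm_mult)
  have "cmod (\<kappa> * r * (s - \<sigma>) * (\<kappa> * y) + \<kappa> * r * ((\<sigma> - s) / s) * u + q * y + d\<sigma> * (\<kappa> * y))
    \<le> cmod (\<kappa> * r * (s - \<sigma>) * (\<kappa> * y)) + cmod (\<kappa> * r * ((\<sigma> - s) / s) * u) + cmod (q * y) + cmod (d\<sigma> * (\<kappa> * y))"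
    by norm
  also have "\<dots> \<le> cmod \<kappa> * R * \<epsilon> * (S / (2 * s0)) + cmod \<kappa> * R * (\<epsilon> / s0) * (S / 2) + Cq * (S / (2 * s0)) + Cs * (S / (2 * s0))"
    using t1 t2 t3 t4 by linarith
  also have "\<dots> = (cmod \<kappa> * R * \<epsilon> / s0 + (Cq + Cs) / (2 * s0)) * S"
    using assms(1) by (simp add: field_simps)
  finally show ?thesis unfolding eq S_def .
qed

text \<open>
  The last expression is the derivative of \<open>A \<bar>P\<bar>\<^sup>2 - B \<bar>M\<bar>\<^sup>2\<close>, where \<open>dP\<close>, \<open>dM\<close>, \<open>A'\<close> and \<open>B'\<close> are the
  derivatives. Only the term in \<open>Re \<kappa>\<close> grows with \<open>\<kappa>\<close>, up to the error \<open>e\<close>.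
\<close>
lemma quadratic_growth:
  fixes P M dP dM \<kappa> :: complex and A B A' B' r :: real
  assumes E: "cmod (dP - \<kappa> * r * P) \<le> e * (cmod P + cmod M)" "cmod (dM + \<kappa> * r * M) \<le> e * (cmod P + cmod M)"
    and AB: "h \<le> A" "h \<le> B" "A \<le> H" "B \<le> H" "\<bar>A'\<bar> \<le> D" "\<bar>B'\<bar> \<le> D" "0 < h" "r0 \<le> r" "0 < r0" "0 \<le> Re \<kappa>" "0 \<le> e"
  shows "(2 * Re \<kappa> * r0 * h - 4 * H * e - D) * ((cmod P)\<^sup>2 + (cmod M)\<^sup>2) \<le>
     Re ((A' * (P * cnj P) + A * (dP * cnj P + P * cnj dP)) - (B' * (M * cnj M) + B * (dM * cnj M + M * cnj dM)))"
proof -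
  define N where "N = (cmod P)\<^sup>2 + (cmod M)\<^sup>2"
  define S where "S = cmod P + cmod M"
  have SN: "S * S \<le> 2 * N"
    using sum_squares_ge_zero[of "cmod P - cmod M" 0] by (simp add: S_def N_def power2_eq_square algebra_simps)
  have H: "0 < H" using AB by linarith
  have sq: "Re (Z * cnj Z) = (cmod Z)\<^sup>2" for Z by (simp add: complex_norm_square[symmetric] cmod_power2 power2_eq_square)
  have p1: "Re (dP * cnj P) \<ge> Re \<kappa> * r * (cmod P)\<^sup>2 - e * S * cmod P"
  proof -
    have "dP * cnj P = (dP - \<kappa> * r * P) * cnj P + \<kappa> * r * (P * cnj P)" by (simp add: algebra_simps)
    then have "Re (dP * cnj P) = Re ((dP - \<kappa> * r * P) * cnj P) + Re \<kappa> * r * (cmod P)\<^sup>2"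
      by (simp add: complex_norm_square[symmetric] del: complex_norm_square)
    moreover have "\<bar>Re ((dP - \<kappa> * r * P) * cnj P)\<bar> \<le> e * S * cmod P"
      using abs_Re_le_cmod[of "(dP - \<kappa> * r * P) * cnj P"] mult_right_mono[OF E(1), of "cmod P"]
      by (simp add: norm_mult S_def)
    ultimately show ?thesis by linarith
  qed
  have m1: "Re (dM * cnj M) \<le> - (Re \<kappa> * r * (cmod M)\<^sup>2) + e * S * cmod M"
  proof -
    have "dM * cnj M = (dM + \<kappa> * r * M) * cnj M - \<kappa> * r * (M * cnj M)" by (simp add: algebra_simps)
    then have "Re (dM * cnj M) = Re ((dM + \<kappa> * r * M) * cnj M) - Re \<kappa> * r * (cmod M)\<^sup>2"
      by (simp add: complex_norm_square[symmetric] del: complex_norm_square)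
    moreover have "\<bar>Re ((dM + \<kappa> * r * M) * cnj M)\<bar> \<le> e * S * cmod M"
      using abs_Re_le_cmod[of "(dM + \<kappa> * r * M) * cnj M"] mult_right_mono[OF E(2), of "cmod M"]
      by (simp add: norm_mult S_def)
    ultimately show ?thesis by linarith
  qed
  have k: "Re \<kappa> * r0 * h \<le> Re \<kappa> * r * X" if "h \<le> X" for X
    using that AB by (intro mult_mono) auto
  have p2: "A * Re (dP * cnj P) \<ge> Re \<kappa> * r0 * h * (cmod P)\<^sup>2 - H * (e * S * cmod P)"
  proof -
    have "A * Re (dP * cnj P) \<ge> A * (Re \<kappa> * r * (cmod P)\<^sup>2 - e * S * cmod P)"
      using p1 AB by (intro mult_left_mono) auto
    moreover have "A * (e * S * cmod P) \<le> H * (e * S * cmod P)" using AB by (intro mult_right_mono) (auto simp: S_def)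
    moreover have "Re \<kappa> * r0 * h * (cmod P)\<^sup>2 \<le> (Re \<kappa> * r * A) * (cmod P)\<^sup>2" using k[OF AB(1)] by (intro mult_right_mono) auto
    ultimately show ?thesis by (simp add: algebra_simps)
  qed
  have m2: "B * Re (dM * cnj M) \<le> - (Re \<kappa> * r0 * h * (cmod M)\<^sup>2) + H * (e * S * cmod M)"
  proof -
    have "B * Re (dM * cnj M) \<le> B * (- (Re \<kappa> * r * (cmod M)\<^sup>2) + e * S * cmod M)"
      using m1 AB by (intro mult_left_mono) auto
    moreover have "B * (e * S * cmod M) \<le> H * (e * S * cmod M)" using AB by (intro mult_right_mono) (auto simp: S_def)
    moreover have "Re \<kappa> * r0 * h * (cmod M)\<^sup>2 \<le> (Re \<kappa> * r * B) * (cmod M)\<^sup>2" using k[OF AB(2)] by (intro mult_right_mono) auto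
    ultimately show ?thesis by (simp add: algebra_simps)
  qed
  have a: "A' * (cmod P)\<^sup>2 \<ge> - D * (cmod P)\<^sup>2" using AB by (intro mult_right_mono) auto
  have b: "B' * (cmod M)\<^sup>2 \<le> D * (cmod M)\<^sup>2" using AB by (intro mult_right_mono) auto
  have es: "H * (e * S * cmod P) + H * (e * S * cmod M) \<le> 2 * (H * e) * N"
  proof -
    have "H * (e * S * cmod P) + H * (e * S * cmod M) = H * e * (S * S)" by (simp add: S_def algebra_simps)
    also have "\<dots> \<le> H * e * (2 * N)" using SN H AB by (intro mult_left_mono) auto
    finally show ?thesis by (simp add: algebra_simps)
  qed
  have "Re ((A' * (P * cnj P) + A * (dP * cnj P + P * cnj dP)) - (B' * (M * cnj M) + B * (dM * cnj M + M * cnj dM)))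
     = A' * (cmod P)\<^sup>2 + 2 * (A * Re (dP * cnj P)) - (B' * (cmod M)\<^sup>2 + 2 * (B * Re (dM * cnj M)))"
  proof -
    have c: "Re (Z * cnj X) = Re (X * cnj Z)" for X Z by simp
    have reA: "Re (complex_of_real X * Z) = X * Re Z" for X Z by simp
    show ?thesis
      unfolding minus_complex.sel plus_complex.sel reA sq c[of P dP] c[of M dM] by algebra
  qed
  moreover have "2 * Re \<kappa> * r0 * h * N = 2 * (Re \<kappa> * r0 * h * (cmod P)\<^sup>2) + 2 * (Re \<kappa> * r0 * h * (cmod M)\<^sup>2)"
    "D * N = D * (cmod P)\<^sup>2 + D * (cmod M)\<^sup>2" by (simp_all add: N_def algebra_simps)
  moreover have "(2 * Re \<kappa> * r0 * h - 4 * H * e - D) * N = 2 * Re \<kappa> * r0 * h * N - 2 * (2 * (H * e) * N) - D * N"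
    by (simp add: algebra_simps)
  ultimately show ?thesis using p2 m2 a b es unfolding N_def[symmetric] by linarith
qed

definition lipschitz_solution ::
  "real \<Rightarrow> real \<Rightarrow> (real \<Rightarrow> complex) \<Rightarrow> (real \<Rightarrow> complex) \<Rightarrow> (real \<Rightarrow> complex) \<Rightarrow> (real \<Rightarrow> complex) \<Rightarrow> bool" where
  "lipschitz_solution c d \<alpha> \<beta> y u \<longleftrightarrow> lipschitz_Icc c d y \<and> lipschitz_Icc c d u \<and>
     (\<exists>N. negligible N \<and> (\<forall>t\<in>{c..d} - N. (y has_vector_derivative \<alpha> t * u t) (at t within {c..d}) \<and>
        (u has_vector_derivative \<beta> t * y t) (at t within {c..d})))"

text \<open>
  The weights of \<open>\<bar>P\<bar>\<^sup>2\<close> and \<open>\<bar>M\<bar>\<^sup>2\<close> run linearly from \<open>1\<close> and \<open>h\<close> at \<open>c\<close> to \<open>h\<close> and \<open>1 / h\<close> at \<open>d\<close>, as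
  \<open>interface_form\<close> wants them. Both changes work against monotonicity, at a rate that does not depend
  on \<open>\<kappa>\<close>, so the growth of order \<open>Re \<kappa>\<close> outweighs them. The derivative of the form even dominates
  \<open>\<bar>P\<bar>\<^sup>2 + \<bar>M\<bar>\<^sup>2\<close>, which settles the case of equality.
\<close>
lemma lyapunov_interval:
  fixes s :: "real \<Rightarrow> complex" and r :: "real \<Rightarrow> real" and h :: real
  assumes cd: "c < d" and cs: "continuous_on {c..d} s" and cr: "continuous_on {c..d} r"
    and snz: "\<And>t. t \<in> {c..d} \<Longrightarrow> s t \<noteq> 0" and rpos: "\<And>t. t \<in> {c..d} \<Longrightarrow> r t > 0"
    and h: "0 < h" "h \<le> 1" and Cq: "Cq \<ge> 0"
  obtains \<rho> where "\<And>(\<kappa>::complex) q y u. \<rho> \<le> Re \<kappa> \<Longrightarrow> cmod \<kappa> \<le> 2 * Re \<kappa> \<Longrightarrow> (\<And>t. t \<in> {c..d} \<Longrightarrow> cmod (q t) \<le> Cq) \<Longrightarrow>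
      lipschitz_solution c d (\<lambda>t. r t / s t) (\<lambda>t. q t + \<kappa>\<^sup>2 * r t * s t) y u \<Longrightarrow>
      (cmod (u c + \<kappa> * s c * y c))\<^sup>2 - h * (cmod (u c - \<kappa> * s c * y c))\<^sup>2
        \<le> h * (cmod (u d + \<kappa> * s d * y d))\<^sup>2 - (1 / h) * (cmod (u d - \<kappa> * s d * y d))\<^sup>2 \<and>
      ((cmod (u c + \<kappa> * s c * y c))\<^sup>2 - h * (cmod (u c - \<kappa> * s c * y c))\<^sup>2
        = h * (cmod (u d + \<kappa> * s d * y d))\<^sup>2 - (1 / h) * (cmod (u d - \<kappa> * s d * y d))\<^sup>2
        \<longrightarrow> (\<forall>t\<in>{c..d}. y t = 0 \<and> u t = 0))"
proof -
  have ne: "{c..d} \<noteq> {}" using cd by auto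
  obtain ts where ts: "ts \<in> {c..d}" "\<And>t. t \<in> {c..d} \<Longrightarrow> cmod (s ts) \<le> cmod (s t)"
    using continuous_attains_inf[OF _ ne continuous_on_norm[OF cs]] by auto
  obtain t0 where t0: "t0 \<in> {c..d}" "\<And>t. t \<in> {c..d} \<Longrightarrow> r t0 \<le> r t"
    using continuous_attains_inf[OF _ ne cr] by auto
  obtain t1 where t1: "t1 \<in> {c..d}" "\<And>t. t \<in> {c..d} \<Longrightarrow> r t \<le> r t1"
    using continuous_attains_sup[OF _ ne cr] by auto
  define s0 r0 R where "s0 = cmod (s ts) / 2" and "r0 = r t0" and "R = r t1"
  have s0: "s0 > 0" "\<And>t. t \<in> {c..d} \<Longrightarrow> 2 * s0 \<le> cmod (s t)"
    using snz[OF ts(1)] ts(2) by (auto simp: s0_def)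
  have r0: "r0 > 0" "\<And>t. t \<in> {c..d} \<Longrightarrow> r0 \<le> r t" using rpos[OF t0(1)] t0(2) by (auto simp: r0_def)
  have R: "R > 0" "\<And>t. t \<in> {c..d} \<Longrightarrow> r t \<le> R" using rpos[OF t1(1)] t1(2) by (auto simp: R_def)
  \<comment> \<open>The second bound makes the error from \<open>\<sigma> - s\<close> at most half of the growth; see \<open>coef\<close> below.\<close>
  define \<epsilon> where "\<epsilon> = min s0 (r0 * h\<^sup>2 * s0 / (8 * R))"
  have \<epsilon>: "\<epsilon> > 0" "\<epsilon> \<le> s0" "\<epsilon> \<le> r0 * h\<^sup>2 * s0 / (8 * R)" using s0 r0 R h by (auto simp: \<epsilon>_def)
  obtain \<sigma> \<sigma>' where c\<sigma>': "continuous_on {c..d} \<sigma>'"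
    and der\<sigma>: "\<And>t. t \<in> {c..d} \<Longrightarrow> (\<sigma> has_vector_derivative \<sigma>' t) (at t within {c..d})"
    and \<sigma>s: "\<And>t. t \<in> {c..d} \<Longrightarrow> cmod (\<sigma> t - s t) \<le> \<epsilon>" and \<sigma>c: "\<sigma> c = s c" and \<sigma>d: "\<sigma> d = s d"
    using smooth_approximation[OF cd cs \<epsilon>(1)] by metis
  obtain t2 where t2: "t2 \<in> {c..d}" "\<And>t. t \<in> {c..d} \<Longrightarrow> cmod (\<sigma>' t) \<le> cmod (\<sigma>' t2)"
    using continuous_attains_sup[OF _ ne continuous_on_norm[OF c\<sigma>']] by auto
  define Cs where "Cs = cmod (\<sigma>' t2)"
  have Cs: "Cs \<ge> 0" "\<And>t. t \<in> {c..d} \<Longrightarrow> cmod (\<sigma>' t) \<le> Cs" using t2 by (auto simp: Cs_def)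
  have \<sigma>ge: "s0 \<le> cmod (\<sigma> t)" if "t \<in> {c..d}" for t
    using norm_triangle_ineq2[of "s t" "s t - \<sigma> t"] \<sigma>s[OF that] s0(2)[OF that] \<epsilon>(2) by (simp add: norm_minus_commute)
  define C' where "C' = (Cq + Cs) / (2 * s0)"
  have C': "C' \<ge> 0" using Cq Cs s0 by (simp add: C'_def)
  define D where "D = 1 / (h * (d - c))"
  define \<rho> where "\<rho> = max 1 ((1 + 4 * C' / h + D) / (r0 * h))"
  show ?thesis
  proof (rule that[of \<rho>])
    fix \<kappa> :: complex and q y u :: "real \<Rightarrow> complex"
    assume \<kappa>: "\<rho> \<le> Re \<kappa>" "cmod \<kappa> \<le> 2 * Re \<kappa>" and q: "\<And>t. t \<in> {c..d} \<Longrightarrow> cmod (q t) \<le> Cq"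
      and sol: "lipschitz_solution c d (\<lambda>t. r t / s t) (\<lambda>t. q t + \<kappa>\<^sup>2 * r t * s t) y u"
    have \<kappa>1: "1 \<le> Re \<kappa>" using \<kappa>(1) by (simp add: \<rho>_def)
    then have \<kappa>n: "1 \<le> cmod \<kappa>" using complex_Re_le_cmod[of \<kappa>] by linarith
    obtain N where ly: "lipschitz_Icc c d y" and lu: "lipschitz_Icc c d u" and N: "negligible N"
      and dy: "\<And>t. t \<in> {c..d} - N \<Longrightarrow> (y has_vector_derivative (r t / s t * u t)) (at t within {c..d})"
      and du: "\<And>t. t \<in> {c..d} - N \<Longrightarrow> (u has_vector_derivative ((q t + \<kappa>\<^sup>2 * r t * s t) * y t)) (at t within {c..d})"
      using sol unfolding lipschitz_solution_def by blast
    define P M where "P t = u t + \<kappa> * \<sigma> t * y t" and "M t = u t - \<kappa> * \<sigma> t * y t" for t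
    define dv where "dv t = \<sigma>' t * y t + \<sigma> t * (r t / s t * u t)" for t
    define dP dM where "dP t = (q t + \<kappa>\<^sup>2 * r t * s t) * y t + \<kappa> * dv t"
      and "dM t = (q t + \<kappa>\<^sup>2 * r t * s t) * y t - \<kappa> * dv t" for t
    define A' B' where "A' = (h - 1) / (d - c)" and "B' = (1 / h - h) / (d - c)"
    define A B where "A t = 1 + A' * (t - c)" and "B t = h + B' * (t - c)" for t
    define e where "e = cmod \<kappa> * R * \<epsilon> / s0 + C'"
    have e0: "e \<ge> 0" using R \<epsilon> s0 C' by (simp add: e_def)
    have EP: "cmod (dP t - \<kappa> * r t * P t) \<le> e * (cmod (P t) + cmod (M t))"
      and EM: "cmod (dM t + \<kappa> * r t * M t) \<le> e * (cmod (P t) + cmod (M t))" if t: "t \<in> {c..d}" for t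
    proof -
      note W = wkb_error_bound[OF s0(1) _ \<sigma>ge[OF t] \<sigma>s[OF t] _ R(2)[OF t] _ q[OF t] Cs(2)[OF t], folded C'_def]
      show "cmod (dP t - \<kappa> * r t * P t) \<le> e * (cmod (P t) + cmod (M t))"
        using W[of \<kappa> "y t" "u t"] \<kappa>n s0(1) s0(2)[OF t] rpos[OF t] unfolding e_def P_def M_def dP_def dv_def by simp
      show "cmod (dM t + \<kappa> * r t * M t) \<le> e * (cmod (P t) + cmod (M t))"
        using W[of "- \<kappa>" "y t" "u t"] \<kappa>n s0(1) s0(2)[OF t] rpos[OF t] unfolding e_def P_def M_def dM_def dv_def
        by (simp add: add.commute)
    qed
    have coef: "1 \<le> 2 * Re \<kappa> * r0 * h - 4 * (1 / h) * e - D"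
    proof -
      have "R * \<epsilon> / s0 \<le> r0 * h\<^sup>2 / 8"
        using \<epsilon>(3) R(1) s0(1) by (simp add: field_simps)
      then have "cmod \<kappa> * (R * \<epsilon> / s0) \<le> (2 * Re \<kappa>) * (r0 * h\<^sup>2 / 8)"
        using \<kappa> \<kappa>1 R \<epsilon> s0 by (intro mult_mono) auto
      then have "(4 / h) * (cmod \<kappa> * (R * \<epsilon> / s0)) \<le> (4 / h) * ((2 * Re \<kappa>) * (r0 * h\<^sup>2 / 8))"
        using h by (intro mult_left_mono) auto
      also have "\<dots> = Re \<kappa> * r0 * h" using h by (simp add: field_simps power2_eq_square)
      finally have 1: "(4 / h) * (cmod \<kappa> * (R * \<epsilon> / s0)) \<le> Re \<kappa> * r0 * h" .
      have "(1 + 4 * C' / h + D) / (r0 * h) \<le> Re \<kappa>" using \<kappa>(1) by (simp add: \<rho>_def)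
      then have 2: "1 + 4 * C' / h + D \<le> Re \<kappa> * (r0 * h)" using r0 h by (subst (asm) pos_divide_le_eq) auto
      have 3: "4 * (1 / h) * e = (4 / h) * (cmod \<kappa> * (R * \<epsilon> / s0)) + 4 * C' / h"
        by (simp add: e_def algebra_simps)
      have 4: "2 * Re \<kappa> * r0 * h = Re \<kappa> * r0 * h + Re \<kappa> * (r0 * h)" by simp
      show ?thesis using 1 2 unfolding 3 4 by linarith
    qed
    have hinv: "1 \<le> 1 / h" using h by simp
    have AB: "h \<le> A t \<and> A t \<le> 1 / h \<and> h \<le> B t \<and> B t \<le> 1 / h" if t: "t \<in> {c..d}" for t
    proof -
      define \<tau> where "\<tau> = (t - c) / (d - c)"
      have \<tau>: "0 \<le> \<tau>" "\<tau> \<le> 1" using t cd by (auto simp: \<tau>_def)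
      have At: "A t = 1 - (1 - h) * \<tau>" and Bt: "B t = h + (1 / h - h) * \<tau>"
        by (simp_all add: A_def B_def A'_def B'_def \<tau>_def diff_divide_distrib algebra_simps)
      have "0 \<le> (1 - h) * \<tau>" "(1 - h) * \<tau> \<le> (1 - h) * 1" using \<tau> h
        by (intro mult_nonneg_nonneg mult_left_mono; linarith)+
      moreover have "0 \<le> (1 / h - h) * \<tau>" "(1 / h - h) * \<tau> \<le> (1 / h - h) * 1"
        using \<tau> h hinv by (intro mult_nonneg_nonneg mult_left_mono; linarith)+
      moreover have "h \<le> 1 - X \<and> 1 - X \<le> 1 / h \<and> h \<le> h + Z \<and> h + Z \<le> 1 / h"
        if "0 \<le> X" "X \<le> (1 - h) * 1" "0 \<le> Z" "Z \<le> (1 / h - h) * 1" for X Z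
        using that hinv by auto
      ultimately show ?thesis unfolding At Bt by blast
    qed
    have D: "\<bar>A'\<bar> \<le> D" "\<bar>B'\<bar> \<le> D"
    proof -
      have "\<bar>h - 1\<bar> \<le> 1 / h" "\<bar>1 / h - h\<bar> \<le> 1 / h" using hinv h by linarith+
      then have "\<bar>h - 1\<bar> / (d - c) \<le> (1 / h) / (d - c)" "\<bar>1 / h - h\<bar> / (d - c) \<le> (1 / h) / (d - c)"
        using cd by (auto intro!: divide_right_mono simp del: divide_divide_eq_left)
      then show "\<bar>A'\<bar> \<le> D" "\<bar>B'\<bar> \<le> D" using cd by (simp_all add: A'_def B'_def D_def abs_divide)
    qed
    define Q where "Q t = complex_of_real (A t) * (P t * cnj (P t)) - complex_of_real (B t) * (M t * cnj (M t))" for t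
    define Q' where "Q' t = (A' * (P t * cnj (P t)) + A t * (dP t * cnj (P t) + P t * cnj (dP t)))
         - (B' * (M t * cnj (M t)) + B t * (dM t * cnj (M t) + M t * cnj (dM t)))" for t
    define n where "n t = (cmod (P t))\<^sup>2 + (cmod (M t))\<^sup>2" for t
    have l\<sigma>: "lipschitz_Icc c d \<sigma>" by (rule lipschitz_Icc_C1[OF c\<sigma>' der\<sigma>])
    have lP: "lipschitz_Icc c d P" and lM: "lipschitz_Icc c d M" unfolding P_def M_def
      by (intro lipschitz_Icc_add lipschitz_Icc_diff lipschitz_Icc_mult lipschitz_Icc_const l\<sigma> ly lu)+
    have dA: "((\<lambda>t. complex_of_real (A t)) has_vector_derivative complex_of_real A') (at t within {c..d})"
      and dB: "((\<lambda>t. complex_of_real (B t)) has_vector_derivative complex_of_real B') (at t within {c..d})" for t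
      unfolding A_def B_def by (intro has_vector_derivative_of_real; auto intro!: derivative_eq_intros)+
    have lA: "lipschitz_Icc c d (\<lambda>t. complex_of_real (A t))" and lB: "lipschitz_Icc c d (\<lambda>t. complex_of_real (B t))"
      by (rule lipschitz_Icc_C1[OF continuous_on_const dA]) (rule lipschitz_Icc_C1[OF continuous_on_const dB])
    have lQ: "lipschitz_Icc c d Q" unfolding Q_def by (intro lipschitz_Icc_diff lipschitz_Icc_mult lipschitz_Icc_cnj lA lB lP lM)
    have dQ: "(Q has_vector_derivative Q' t) (at t within {c..d})" if t: "t \<in> {c..d} - N" for t
    proof -
      have t': "t \<in> {c..d}" using t by simp
      have 1: "((\<lambda>t. \<kappa> * (\<sigma> t * y t)) has_vector_derivative \<kappa> * (\<sigma> t * (r t / s t * u t) + \<sigma>' t * y t)) (at t within {c..d})"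
        by (intro has_vector_derivative_mult_right has_vector_derivative_mult der\<sigma>[OF t'] dy[OF t])
      have P: "(P has_vector_derivative dP t) (at t within {c..d})"
        using has_vector_derivative_add[OF du[OF t] 1] unfolding P_def dP_def dv_def by (simp add: algebra_simps)
      have M: "(M has_vector_derivative dM t) (at t within {c..d})"
        using has_vector_derivative_diff[OF du[OF t] 1] unfolding M_def dM_def dv_def by (simp add: algebra_simps)
      have PP: "((\<lambda>t. P t * cnj (P t)) has_vector_derivative (P t * cnj (dP t) + dP t * cnj (P t))) (at t within {c..d})"
        by (intro has_vector_derivative_mult P has_vector_derivative_cnj)
      have MM: "((\<lambda>t. M t * cnj (M t)) has_vector_derivative (M t * cnj (dM t) + dM t * cnj (M t))) (at t within {c..d})"
        by (intro has_vector_derivative_mult M has_vector_derivative_cnj)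
      have "(Q has_vector_derivative
         (A t * (P t * cnj (dP t) + dP t * cnj (P t)) + A' * (P t * cnj (P t))
          - (B t * (M t * cnj (dM t) + dM t * cnj (M t)) + B' * (M t * cnj (M t))))) (at t within {c..d})"
        unfolding Q_def by (intro has_vector_derivative_diff has_vector_derivative_mult dA dB PP MM)
      then show ?thesis unfolding Q'_def by (simp only: add.commute)
    qed
    have ge: "n t \<le> Re (Q' t)" if t: "t \<in> {c..d} - N" for t
    proof -
      have t': "t \<in> {c..d}" using t by simp
      have "(2 * Re \<kappa> * r0 * h - 4 * (1 / h) * e - D) * n t \<le> Re (Q' t)"
        unfolding n_def Q'_def
        by (rule quadratic_growth[OF EP[OF t'] EM[OF t']]) (use AB[OF t'] D h r0 t' \<kappa>1 e0 in auto)
      moreover have "1 * n t \<le> (2 * Re \<kappa> * r0 * h - 4 * (1 / h) * e - D) * n t"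
        using coef by (intro mult_right_mono) (auto simp: n_def)
      ultimately show ?thesis by simp
    qed
    have cn: "continuous_on {c..d} n"
      unfolding n_def by (intro continuous_intros lipschitz_Icc_continuous[OF lP] lipschitz_Icc_continuous[OF lM])
    have int: "integral {c..d} n \<le> Re (Q d) - Re (Q c)"
      by (rule lipschitz_Icc_ae_derivative_Re_ge[OF less_imp_le[OF cd] lQ N dQ ge cn])
    have n0: "n t \<ge> 0" for t by (simp add: n_def)
    have in0: "0 \<le> integral {c..d} n" by (intro integral_nonneg integrable_continuous_real cn n0)
    have ReQ: "Re (Q t) = A t * (cmod (P t))\<^sup>2 - B t * (cmod (M t))\<^sup>2" for t
      unfolding Q_def complex_norm_square[symmetric] by simp
    have ends: "A c = 1" "B c = h" "A d = h" "B d = 1 / h"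
      using cd by (simp_all add: A_def B_def A'_def B'_def)
    have Qc: "Re (Q c) = (cmod (u c + \<kappa> * s c * y c))\<^sup>2 - h * (cmod (u c - \<kappa> * s c * y c))\<^sup>2"
      unfolding ReQ ends P_def M_def \<sigma>c by simp
    have Qd: "Re (Q d) = h * (cmod (u d + \<kappa> * s d * y d))\<^sup>2 - (1 / h) * (cmod (u d - \<kappa> * s d * y d))\<^sup>2"
      unfolding ReQ ends P_def M_def \<sigma>d by simp
    have zero: "y t = 0 \<and> u t = 0" if eq: "Re (Q c) = Re (Q d)" and t: "t \<in> {c..d}" for t
    proof -
      have "integral {c..d} n = 0" using int in0 eq by linarith
      then have "n t = 0" using integral_eq_0_iff[OF cn cd n0] t by blast
      then have "P t = 0" "M t = 0" by (simp_all add: n_def sum_power2_eq_zero_iff)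
      then have "2 * u t = 0" "2 * (\<kappa> * \<sigma> t * y t) = 0" unfolding P_def M_def by algebra+
      moreover have "\<kappa> \<noteq> 0" "\<sigma> t \<noteq> 0" using \<kappa>n \<sigma>ge[OF t] s0(1) by auto
      ultimately show ?thesis by simp
    qed
    show "(cmod (u c + \<kappa> * s c * y c))\<^sup>2 - h * (cmod (u c - \<kappa> * s c * y c))\<^sup>2
        \<le> h * (cmod (u d + \<kappa> * s d * y d))\<^sup>2 - (1 / h) * (cmod (u d - \<kappa> * s d * y d))\<^sup>2 \<and>
      ((cmod (u c + \<kappa> * s c * y c))\<^sup>2 - h * (cmod (u c - \<kappa> * s c * y c))\<^sup>2
        = h * (cmod (u d + \<kappa> * s d * y d))\<^sup>2 - (1 / h) * (cmod (u d - \<kappa> * s d * y d))\<^sup>2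
        \<longrightarrow> (\<forall>t\<in>{c..d}. y t = 0 \<and> u t = 0))"
      unfolding Qc[symmetric] Qd[symmetric] using int in0 zero by (auto simp del: atLeastAtMost_iff)
  qed
qed

text \<open>
  Around the period, the values \<open>Q0 j \<le> Q1 j \<le> Q0 (nxt j)\<close> of the form at the start of piece \<open>j\<close>, at its end, and at
  the start of the next piece close up to a cycle. Hence they are all equal.
\<close>
lemma no_large_eigensolution:
  fixes x :: "nat \<Rightarrow> real" and s :: "nat \<Rightarrow> real \<Rightarrow> complex" and r :: "nat \<Rightarrow> real \<Rightarrow> real" and z :: complex
  assumes m: "m \<ge> 1" and x: "\<And>j. j < m \<Longrightarrow> x j < x (Suc j)"
    and cs: "\<And>j. j < m \<Longrightarrow> continuous_on {x j..x (Suc j)} (s j)"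
    and cr: "\<And>j. j < m \<Longrightarrow> continuous_on {x j..x (Suc j)} (r j)"
    and snz: "\<And>j t. j < m \<Longrightarrow> t \<in> {x j..x (Suc j)} \<Longrightarrow> s j t \<noteq> 0"
    and rpos: "\<And>j t. j < m \<Longrightarrow> t \<in> {x j..x (Suc j)} \<Longrightarrow> r j t > 0"
    and iface: "\<And>j. Suc j < m \<Longrightarrow> s j (x (Suc j)) + s (Suc j) (x (Suc j)) \<noteq> 0"
    and iface_end: "s (m - 1) (x m) + s 0 (x 0) \<noteq> 0"
    and Cq: "Cq \<ge> 0" and z: "cmod z = 1"
  obtains R where "\<And>\<mu> q y u. Re \<mu> < 0 \<Longrightarrow> R \<le> cmod \<mu> \<Longrightarrow>
      (\<And>t. t \<in> {x 0..x m} \<Longrightarrow> cmod (q t) \<le> Cq) \<Longrightarrow>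
      (\<And>j. j < m \<Longrightarrow> lipschitz_solution (x j) (x (Suc j)) (\<lambda>t. r j t / s j t) (\<lambda>t. q t - \<mu> * (r j t * s j t)) y u) \<Longrightarrow>
      y (x m) = z * y (x 0) \<Longrightarrow> u (x m) = z * u (x 0) \<Longrightarrow>
      (\<forall>j<m. \<forall>t\<in>{x j..x (Suc j)}. y t = 0 \<and> u t = 0)"
proof -
  define nxt where "nxt j = (if Suc j = m then 0 else Suc j)" for j
  have "\<exists>\<eta>>0. \<forall>h U Y. 0 < h \<longrightarrow> h \<le> \<eta> \<longrightarrow>
     h * (cmod (U + s j (x (Suc j)) * Y))\<^sup>2 - (1 / h) * (cmod (U - s j (x (Suc j)) * Y))\<^sup>2
       \<le> (cmod (U + s (nxt j) (x (nxt j)) * Y))\<^sup>2 - h * (cmod (U - s (nxt j) (x (nxt j)) * Y))\<^sup>2" if j: "j < m" for j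
  proof -
    have "s j (x (Suc j)) \<noteq> 0" using snz[OF j, of "x (Suc j)"] x[OF j] by auto
    moreover have "s j (x (Suc j)) + s (nxt j) (x (nxt j)) \<noteq> 0"
      using iface[of j] iface_end j by (cases "Suc j = m") (auto simp: nxt_def)
    ultimately show ?thesis using interface_form[of "s j (x (Suc j))" "s (nxt j) (x (nxt j))"] by metis
  qed
  then obtain \<eta> where \<eta>: "\<And>j. j < m \<Longrightarrow> \<eta> j > 0" and jump\<eta>: "\<And>j h U Y. j < m \<Longrightarrow> 0 < h \<Longrightarrow> h \<le> \<eta> j \<Longrightarrow>
     h * (cmod (U + s j (x (Suc j)) * Y))\<^sup>2 - (1 / h) * (cmod (U - s j (x (Suc j)) * Y))\<^sup>2
       \<le> (cmod (U + s (nxt j) (x (nxt j)) * Y))\<^sup>2 - h * (cmod (U - s (nxt j) (x (nxt j)) * Y))\<^sup>2"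
    by metis
  define h where "h = Min (insert 1 (\<eta> ` {..<m}))"
  have h: "0 < h" "h \<le> 1" "\<And>j. j < m \<Longrightarrow> h \<le> \<eta> j" using \<eta> by (auto simp: h_def)
  define Q0 where "Q0 \<kappa> y u j = (cmod (u (x j) + \<kappa> * s j (x j) * y (x j)))\<^sup>2
      - h * (cmod (u (x j) - \<kappa> * s j (x j) * y (x j)))\<^sup>2" for \<kappa> :: complex and j and y u :: "real \<Rightarrow> complex"
  define Q1 where "Q1 \<kappa> y u j = h * (cmod (u (x (Suc j)) + \<kappa> * s j (x (Suc j)) * y (x (Suc j))))\<^sup>2
      - (1 / h) * (cmod (u (x (Suc j)) - \<kappa> * s j (x (Suc j)) * y (x (Suc j))))\<^sup>2" for \<kappa> :: complex and j and y u :: "real \<Rightarrow> complex"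
  define good where "good j \<rho> \<longleftrightarrow> (\<forall>(\<kappa>::complex) q y u. \<rho> \<le> Re \<kappa> \<longrightarrow> cmod \<kappa> \<le> 2 * Re \<kappa> \<longrightarrow> (\<forall>t\<in>{x j..x (Suc j)}. cmod (q t) \<le> Cq) \<longrightarrow>
      lipschitz_solution (x j) (x (Suc j)) (\<lambda>t. r j t / s j t) (\<lambda>t. q t + \<kappa>\<^sup>2 * r j t * s j t) y u \<longrightarrow>
      Q0 \<kappa> y u j \<le> Q1 \<kappa> y u j \<and> (Q0 \<kappa> y u j = Q1 \<kappa> y u j \<longrightarrow> (\<forall>t\<in>{x j..x (Suc j)}. y t = 0 \<and> u t = 0)))" for j \<rho>
  have "\<exists>\<rho>. good j \<rho>" if j: "j < m" for j
    unfolding good_def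
    apply (rule lyapunov_interval[OF x[OF j] cs[OF j] cr[OF j] snz[OF j] rpos[OF j] h(1,2) Cq], assumption, assumption)
    subgoal premises p for \<rho>
    proof (intro exI[of _ \<rho>] allI impI)
      fix \<kappa> :: complex and q y u
      assume "\<rho> \<le> Re \<kappa>" "cmod \<kappa> \<le> 2 * Re \<kappa>" and q: "\<forall>t\<in>{x j..x (Suc j)}. cmod (q t) \<le> Cq"
        and "lipschitz_solution (x j) (x (Suc j)) (\<lambda>t. r j t / s j t) (\<lambda>t. q t + \<kappa>\<^sup>2 * r j t * s j t) y u"
      note p[OF this(1,2) bspec[OF q] this(4)]
      then show "Q0 \<kappa> y u j \<le> Q1 \<kappa> y u j \<and> (Q0 \<kappa> y u j = Q1 \<kappa> y u j \<longrightarrow> (\<forall>t\<in>{x j..x (Suc j)}. y t = 0 \<and> u t = 0))"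
        unfolding Q0_def Q1_def .
    qed
    done
  then obtain \<rho>j where \<rho>j: "\<And>j. j < m \<Longrightarrow> good j (\<rho>j j)" by metis
  define \<rho> where "\<rho> = Max (insert 1 (\<rho>j ` {..<m}))"
  have \<rho>: "1 \<le> \<rho>" "\<And>j. j < m \<Longrightarrow> \<rho>j j \<le> \<rho>" by (auto simp: \<rho>_def)
  have xmono: "x i \<le> x k" if "i \<le> k" "k \<le> m" for i k
    using that
  proof (induction k rule: dec_induct)
    case (step k)
    then show ?case using x[of k] by simp
  qed simp
  show ?thesis
  proof (rule that[of "(2 * \<rho>)\<^sup>2"])
    fix \<mu> :: complex and q y u :: "real \<Rightarrow> complex"
    assume \<mu>: "Re \<mu> < 0" "(2 * \<rho>)\<^sup>2 \<le> cmod \<mu>" and q: "\<And>t. t \<in> {x 0..x m} \<Longrightarrow> cmod (q t) \<le> Cq"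
      and sol: "\<And>j. j < m \<Longrightarrow> lipschitz_solution (x j) (x (Suc j)) (\<lambda>t. r j t / s j t) (\<lambda>t. q t - \<mu> * (r j t * s j t)) y u"
      and per: "y (x m) = z * y (x 0)" "u (x m) = z * u (x 0)"
    \<comment> \<open>The principal root has \<open>Re \<kappa> \<ge> 0\<close>, and \<open>Re \<mu> < 0\<close> puts it into the sector \<open>\<bar>Im \<kappa>\<bar> < Re \<kappa>\<close>.\<close>
    define \<kappa> where "\<kappa> = csqrt (- \<mu>)"
    have \<kappa>2: "\<kappa>\<^sup>2 = - \<mu>" by (simp add: \<kappa>_def)
    have Re0: "Re \<kappa> \<ge> 0" by (simp add: \<kappa>_def Re_csqrt del: csqrt.sel csqrt.simps)
    have "Re (\<kappa>\<^sup>2) > 0" using \<mu>(1) by (simp add: \<kappa>2)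
    then have im: "(Im \<kappa>)\<^sup>2 < (Re \<kappa>)\<^sup>2" by (simp add: power2_eq_square)
    have "(2 * Re \<kappa>)\<^sup>2 = 4 * (Re \<kappa>)\<^sup>2" by (simp add: power_mult_distrib)
    then have "(cmod \<kappa>)\<^sup>2 \<le> (2 * Re \<kappa>)\<^sup>2"
      using im zero_le_power2[of "Re \<kappa>"] cmod_power2[of \<kappa>] by linarith
    then have \<kappa>le: "cmod \<kappa> \<le> 2 * Re \<kappa>" by (rule power2_le_imp_le) (use Re0 in simp)
    have "(2 * \<rho>)\<^sup>2 \<le> (cmod \<kappa>)\<^sup>2" using \<mu>(2) by (simp add: \<kappa>2 flip: norm_power)
    then have "2 * \<rho> \<le> cmod \<kappa>" by (rule power2_le_imp_le) simp
    then have Re\<rho>: "\<rho> \<le> Re \<kappa>" using \<kappa>le by simp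
    have step: "Q0 \<kappa> y u j \<le> Q1 \<kappa> y u j \<and> (Q0 \<kappa> y u j = Q1 \<kappa> y u j \<longrightarrow> (\<forall>t\<in>{x j..x (Suc j)}. y t = 0 \<and> u t = 0))"
      if j: "j < m" for j
    proof -
      have "\<forall>t\<in>{x j..x (Suc j)}. cmod (q t) \<le> Cq"
        using q xmono[of 0 j] xmono[of "Suc j" m] j by auto
      moreover have "lipschitz_solution (x j) (x (Suc j)) (\<lambda>t. r j t / s j t) (\<lambda>t. q t + \<kappa>\<^sup>2 * r j t * s j t) y u"
        using sol[OF j] by (simp add: \<kappa>2 mult.assoc)
      ultimately show ?thesis
        using \<rho>j[OF j, unfolded good_def] order_trans[OF \<rho>(2)[OF j] Re\<rho>] \<kappa>le by blast
    qed
    have jump: "Q1 \<kappa> y u j \<le> Q0 \<kappa> y u (nxt j)" if j: "j < m" for j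
    proof -
      have eq: "\<kappa> * S * Y = S * (\<kappa> * Y)" for S Y :: complex by simp
      have *: "Q1 \<kappa> y u j \<le> (cmod (u (x (Suc j)) + s (nxt j) (x (nxt j)) * (\<kappa> * y (x (Suc j)))))\<^sup>2
           - h * (cmod (u (x (Suc j)) - s (nxt j) (x (nxt j)) * (\<kappa> * y (x (Suc j)))))\<^sup>2"
        unfolding Q1_def eq by (rule jump\<eta>[OF j h(1) h(3)[OF j]])
      show ?thesis
      proof (cases "Suc j = m")
        case False
        then show ?thesis using * unfolding Q0_def eq nxt_def by simp
      next
        case True
        have "cmod (z * u (x 0) + S * (\<kappa> * (z * y (x 0)))) = cmod (u (x 0) + S * (\<kappa> * y (x 0)))"
          "cmod (z * u (x 0) - S * (\<kappa> * (z * y (x 0)))) = cmod (u (x 0) - S * (\<kappa> * y (x 0)))" for S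
        proof -
          have "z * u (x 0) + S * (\<kappa> * (z * y (x 0))) = z * (u (x 0) + S * (\<kappa> * y (x 0)))"
            "z * u (x 0) - S * (\<kappa> * (z * y (x 0))) = z * (u (x 0) - S * (\<kappa> * y (x 0)))"
            by (simp_all add: algebra_simps)
          then show "cmod (z * u (x 0) + S * (\<kappa> * (z * y (x 0)))) = cmod (u (x 0) + S * (\<kappa> * y (x 0)))"
            "cmod (z * u (x 0) - S * (\<kappa> * (z * y (x 0)))) = cmod (u (x 0) - S * (\<kappa> * y (x 0)))"
            by (simp_all only: norm_mult z mult_1)
        qed
        then show ?thesis using * True per unfolding Q0_def eq nxt_def by simp
      qed
    qed
    have sum: "(\<Sum>j<m. Q0 \<kappa> y u (nxt j)) = (\<Sum>j<m. Q0 \<kappa> y u j)"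
    proof -
      obtain k where k: "m = Suc k" using m by (cases m) auto
      have "(\<Sum>j<m. Q0 \<kappa> y u (nxt j)) = (\<Sum>j<k. Q0 \<kappa> y u (Suc j)) + Q0 \<kappa> y u 0"
        by (simp add: k nxt_def)
      then show ?thesis by (simp add: k sum.lessThan_Suc_shift del: sum.lessThan_Suc)
    qed
    have nn: "0 \<le> Q1 \<kappa> y u j - Q0 \<kappa> y u j" if "j < m" for j using step[OF that] by simp
    have "(\<Sum>j<m. Q1 \<kappa> y u j - Q0 \<kappa> y u j) \<le> (\<Sum>j<m. Q0 \<kappa> y u (nxt j) - Q0 \<kappa> y u j)"
      by (intro sum_mono diff_right_mono jump) auto
    also have "\<dots> = 0" by (simp add: sum_subtractf sum)
    finally have "(\<Sum>j<m. Q1 \<kappa> y u j - Q0 \<kappa> y u j) = 0" using nn by (intro antisym sum_nonneg) auto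
    then have "\<forall>j\<in>{..<m}. Q1 \<kappa> y u j - Q0 \<kappa> y u j = 0"
      by (subst (asm) sum_nonneg_eq_0_iff) (use nn in auto)
    then show "\<forall>j<m. \<forall>t\<in>{x j..x (Suc j)}. y t = 0 \<and> u t = 0" using step by auto
  qed
qed

section \<open>The coefficients and their interface values\<close>

text \<open>
  The quotient of the continuous extensions of \<open>w\<close> and \<open>p\<close> is real and nonnegative up to the end points by
  continuity, and nonzero by the lower bounds; hence its square root \<open>R\<close> is continuous and positive.
\<close>
lemma coefficient_extension:
  fixes p w :: "real \<Rightarrow> complex" and \<rho> :: "real \<Rightarrow> real"
  assumes lr: "l < r" and p: "W2_infinity {l<..<r} p" and w: "W2_infinity {l<..<r} w"
    and pinf: "(INF t\<in>closure {l<..<r}. cmod (closure_ext {l<..<r} p t)) > 0"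
    and winf: "(INF t\<in>closure {l<..<r}. cmod (closure_ext {l<..<r} w t)) > 0"
    and \<rho>: "\<And>t. t \<in> {l<..<r} \<Longrightarrow> \<rho> t > 0" "\<And>t. t \<in> {l<..<r} \<Longrightarrow> w t / p t = complex_of_real ((\<rho> t)\<^sup>2)"
  obtains s :: "real \<Rightarrow> complex" and R :: "real \<Rightarrow> real" where "continuous_on {l..r} s" "continuous_on {l..r} R"
    "\<And>t. t \<in> {l..r} \<Longrightarrow> s t \<noteq> 0" "\<And>t. t \<in> {l..r} \<Longrightarrow> R t > 0"
    "\<And>t. t \<in> {l<..<r} \<Longrightarrow> s t = p t * complex_of_real (\<rho> t)"
    "\<And>t. t \<in> {l<..<r} \<Longrightarrow> p t \<noteq> 0 \<and> 1 / p t = R t / s t \<and> w t = R t * s t"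
proof -
  obtain P where P: "continuous_on {l..r} P" "\<And>t. t \<in> {l<..<r} \<Longrightarrow> P t = p t"
    "\<And>t. t \<in> {l..r} \<Longrightarrow> closure_ext {l<..<r} p t = P t" using W2_infinity_extension[OF p lr] by blast
  obtain W where W: "continuous_on {l..r} W" "\<And>t. t \<in> {l<..<r} \<Longrightarrow> W t = w t"
    "\<And>t. t \<in> {l..r} \<Longrightarrow> closure_ext {l<..<r} w t = W t" using W2_infinity_extension[OF w lr] by blast
  have cl: "closure {l<..<r} = {l..r}" using lr by simp
  have nz: "F t \<noteq> 0" if "(INF t\<in>closure {l<..<r}. cmod (closure_ext {l<..<r} f t)) > 0" "t \<in> {l..r}"
    "\<And>t. t \<in> {l..r} \<Longrightarrow> closure_ext {l<..<r} f t = F t" for f F t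
  proof -
    have "(INF t\<in>closure {l<..<r}. cmod (closure_ext {l<..<r} f t)) \<le> cmod (closure_ext {l<..<r} f t)"
      by (rule cINF_lower) (use that(2) cl in \<open>auto intro!: bdd_belowI2[where m=0]\<close>)
    then show ?thesis using that by auto
  qed
  have Pnz: "P t \<noteq> 0" if "t \<in> {l..r}" for t by (rule nz[OF pinf that P(3)])
  have Wnz: "W t \<noteq> 0" if "t \<in> {l..r}" for t by (rule nz[OF winf that W(3)])
  have cWP: "continuous_on {l..r} (\<lambda>t. W t / P t)"
    by (intro continuous_intros P(1) W(1)) (use Pnz in auto)
  have open_eq: "W t / P t = complex_of_real ((\<rho> t)\<^sup>2)" if "t \<in> {l<..<r}" for t
    using P(2)[OF that] W(2)[OF that] \<rho>(2)[OF that] by simp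
  have Im0: "Im (W t / P t) = 0" if "t \<in> {l..r}" for t
  proof (rule continuous_constant_on_closure[where S="{l<..<r}" and f="\<lambda>t. Im (W t / P t)"])
    show "continuous_on (closure {l<..<r}) (\<lambda>t. Im (W t / P t))"
      unfolding cl by (intro continuous_on_Im cWP)
    show "Im (W t / P t) = 0" if "t \<in> {l<..<r}" for t using open_eq[OF that] by simp
  qed (use that cl in auto)
  have Re0: "Re (W t / P t) \<ge> 0" if "t \<in> {l..r}" for t
  proof -
    have c: "continuous_on (closure {l<..<r}) (\<lambda>t. Re (W t / P t))"
      unfolding cl by (intro continuous_on_Re cWP)
    have "0 \<le> Re (W t / P t)" if "t \<in> {l<..<r}" for t
      unfolding open_eq[OF that] by simp
    then show ?thesis using continuous_ge_on_closure[OF c, of t 0] that unfolding cl by blast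
  qed
  have Repos: "Re (W t / P t) > 0" if "t \<in> {l..r}" for t
  proof -
    have "W t / P t \<noteq> 0" using Pnz[OF that] Wnz[OF that] by simp
    then have "Re (W t / P t) \<noteq> 0" using Im0[OF that] by (metis complex_eq_iff zero_complex.sel)
    then show ?thesis using Re0[OF that] by simp
  qed
  define R where "R t = sqrt (Re (W t / P t))" for t
  define s where "s t = P t * complex_of_real (R t)" for t
  have R\<rho>: "R t = \<rho> t" if "t \<in> {l<..<r}" for t
    unfolding R_def open_eq[OF that] using \<rho>(1)[OF that] by simp
  show ?thesis
  proof (rule that[of s R])
    show cR: "continuous_on {l..r} R" unfolding R_def[abs_def] by (intro continuous_on_real_sqrt continuous_on_Re cWP)
    show "continuous_on {l..r} s" unfolding s_def[abs_def] by (intro continuous_on_mult P(1) continuous_on_of_real cR)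
    show Rp: "R t > 0" if "t \<in> {l..r}" for t using Repos[OF that] by (simp add: R_def)
    show "s t \<noteq> 0" if "t \<in> {l..r}" for t using Pnz[OF that] Rp[OF that] by (simp add: s_def)
    show "s t = p t * complex_of_real (\<rho> t)" if "t \<in> {l<..<r}" for t
      using R\<rho>[OF that] P(2)[OF that] by (simp add: s_def)
    show "p t \<noteq> 0 \<and> 1 / p t = R t / s t \<and> w t = R t * s t" if t: "t \<in> {l<..<r}" for t
    proof -
      have "t \<in> {l..r}" using t by auto
      then have "p t \<noteq> 0" "R t > 0" using Pnz[of t] P(2)[OF t] Rp[of t] by auto
      moreover have "w t = p t * complex_of_real ((R t)\<^sup>2)"
        using \<rho>(2)[OF t] R\<rho>[OF t] \<open>p t \<noteq> 0\<close> by (simp add: field_simps)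
      ultimately show ?thesis using P(2)[OF t] by (simp add: s_def power2_eq_square)
    qed
  qed
qed

lemma left_limit_eqI:
  assumes "l < r" "continuous_on {l..r} s" "\<And>t. t \<in> {l<..<r} \<Longrightarrow> f t = s t"
  shows "left_limit r f = s r"
proof -
  have "(s \<longlongrightarrow> s r) (at_left r)"
    using assms(1,2) by (metis at_within_Icc_at_left atLeastAtMost_iff continuous_on_def less_imp_le order_refl)
  moreover have "\<forall>\<^sub>F t in at_left r. s t = f t"
    using eventually_at_left_real[OF assms(1)] by eventually_elim (simp add: assms(3))
  ultimately have "(f \<longlongrightarrow> s r) (at_left r)" by (rule Lim_transform_eventually)
  then show ?thesis unfolding left_limit_def by (intro tendsto_Lim) simp
qed

lemma right_limit_eqI:
  assumes "l < r" "continuous_on {l..r} s" "\<And>t. t \<in> {l<..<r} \<Longrightarrow> f t = s t"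
  shows "right_limit l f = s l"
proof -
  have "(s \<longlongrightarrow> s l) (at_right l)"
    using assms(1,2) by (metis at_within_Icc_at_right atLeastAtMost_iff continuous_on_def less_imp_le order_refl)
  moreover have "\<forall>\<^sub>F t in at_right l. s t = f t"
    using eventually_at_right_real[OF assms(1)] by eventually_elim (simp add: assms(3))
  ultimately have "(f \<longlongrightarrow> s l) (at_right l)" by (rule Lim_transform_eventually)
  then show ?thesis unfolding right_limit_def by (intro tendsto_Lim) simp
qed

lemma right_limit_shift: "right_limit (x + d) f = right_limit x (\<lambda>t. f (t + d))"
proof -
  have "(f \<longlongrightarrow> L) (at_right (x + d)) \<longleftrightarrow> ((\<lambda>t. f (t + d)) \<longlongrightarrow> L) (at_right x)" for L
    using filtermap_at_right_shift[of "- d" x] by (simp add: filterlim_def filtermap_filtermap[symmetric, of f "\<lambda>t. t + d"])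
  then show ?thesis by (simp add: right_limit_def t2_space_class.Lim_def)
qed

lemma periodic_ext_eq:
  assumes "a < b" "t \<in> {a..<b}" shows "periodic_ext a b f t = f t"
proof -
  have "frac ((t - a) / (b - a)) = (t - a) / (b - a)" using assms by (simp add: frac_eq)
  then show ?thesis using assms by (simp add: periodic_ext_def)
qed

lemma periodic_ext_period:
  assumes "a < b" shows "periodic_ext a b f (t + (b - a)) = periodic_ext a b f t"
proof -
  have "(t + (b - a) - a) / (b - a) = (t - a) / (b - a) + 1" using assms by (simp add: field_simps)
  then show ?thesis by (simp add: periodic_ext_def frac_1_eq)
qed

text \<open>
  The pieces leave out the partition points, which form a null set; \<open>G\<close> is zero there.
\<close>
lemma piecewise_bounded_coeff:
  fixes x :: "nat \<Rightarrow> real" and g :: "nat \<Rightarrow> real \<Rightarrow> complex"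
  assumes x: "\<And>i k. i \<le> k \<Longrightarrow> k \<le> m \<Longrightarrow> x i \<le> x k"
    and g: "\<And>j. j < m \<Longrightarrow> continuous_on {x j..x (Suc j)} (g j)"
  obtains G K where "bounded_coeff (x 0) (x m) K G" "\<And>j t. j < m \<Longrightarrow> t \<in> {x j<..<x (Suc j)} \<Longrightarrow> G t = g j t"
proof -
  define G where "G t = (\<Sum>j<m. indicat_real {x j<..<x (Suc j)} t *\<^sub>R g j t)" for t
  have Geq: "G t = g j t" if j: "j < m" and t: "t \<in> {x j<..<x (Suc j)}" for j t
  proof -
    have "indicat_real {x i<..<x (Suc i)} t *\<^sub>R g i t = (if i = j then g j t else 0)" if i: "i < m" for i
    proof (cases i j rule: linorder_cases)
      case less
      then have "x (Suc i) \<le> x j" using x[of "Suc i" j] j by simp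
      then show ?thesis using less t by auto
    next
      case greater
      then have "x (Suc j) \<le> x i" using x[of "Suc j" i] i by simp
      then show ?thesis using greater t by auto
    qed (use t in auto)
    then have "G t = (\<Sum>i<m. if i = j then g j t else 0)" unfolding G_def by (intro sum.cong) auto
    then show ?thesis using j by simp
  qed
  have "\<exists>M. \<forall>t\<in>{x j..x (Suc j)}. cmod (g j t) \<le> M" if "j < m" for j
  proof -
    have "bounded (g j ` {x j..x (Suc j)})" by (intro compact_imp_bounded compact_continuous_image g[OF that]) auto
    then show ?thesis unfolding bounded_iff by blast
  qed
  then obtain M where M: "\<And>j t. j < m \<Longrightarrow> t \<in> {x j..x (Suc j)} \<Longrightarrow> cmod (g j t) \<le> M j" by metis
  have meas: "(\<lambda>t. indicat_real {x j<..<x (Suc j)} t *\<^sub>R g j t) \<in> borel_measurable (lebesgue_on {x 0..x m})" if j: "j < m" for j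
  proof -
    have "g j \<in> borel_measurable (lebesgue_on {x j<..<x (Suc j)})"
      by (rule continuous_imp_measurable_on_sets_lebesgue[OF continuous_on_subset[OF g[OF j]]]) auto
    then have "(\<lambda>t. if t \<in> {x j<..<x (Suc j)} then g j t else 0) \<in> borel_measurable lebesgue"
      by (subst borel_measurable_if) auto
    moreover have "(\<lambda>t. if t \<in> {x j<..<x (Suc j)} then g j t else 0) = (\<lambda>t. indicat_real {x j<..<x (Suc j)} t *\<^sub>R g j t)"
      by (auto simp: indicator_def)
    ultimately show ?thesis by (simp add: measurable_restrict_space1)
  qed
  show ?thesis
  proof (rule that[of "\<Sum>j<m. \<bar>M j\<bar>" G])
    show "bounded_coeff (x 0) (x m) (\<Sum>j<m. \<bar>M j\<bar>) G"
      unfolding bounded_coeff_def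
    proof (intro conjI ballI)
      show "G \<in> borel_measurable (lebesgue_on {x 0..x m})"
        unfolding G_def by (intro borel_measurable_sum meas) auto
      fix t
      have "cmod (indicat_real {x j<..<x (Suc j)} t *\<^sub>R g j t) \<le> \<bar>M j\<bar>" if "j < m" for j
        using M[OF that, of t] by (cases "t \<in> {x j<..<x (Suc j)}") auto
      then show "cmod (G t) \<le> (\<Sum>j<m. \<bar>M j\<bar>)" unfolding G_def by (intro sum_norm_le) auto
    qed
  qed (rule Geq)
qed

section \<open>Finiteness\<close>

theorem mainTheorem4:
  fixes a b \<phi> :: real and m :: nat and x :: "nat \<Rightarrow> real"
    and p q w :: "real \<Rightarrow> complex" and r :: "real \<Rightarrow> real"
  assumes "m \<ge> 1" and "x 0 = a" and "x m = b"
    and "\<And>j. j < m \<Longrightarrow> x j < x (Suc j)"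
    and "\<And>j. j \<in> {1..m} \<Longrightarrow> W2_infinity (subinterval x j) p"
    and "\<And>j. j \<in> {1..m} \<Longrightarrow> W2_infinity (subinterval x j) w"
    and "\<And>j. j \<in> {1..m} \<Longrightarrow>
           (INF t\<in>closure (subinterval x j). cmod (closure_ext (subinterval x j) p t)) > 0"
    and "\<And>j. j \<in> {1..m} \<Longrightarrow>
           (INF t\<in>closure (subinterval x j). cmod (closure_ext (subinterval x j) w t)) > 0"
    and "\<And>t. t \<in> {a..b} \<Longrightarrow> r t > 0"
    and "\<And>t. t \<in> {a..b} \<Longrightarrow> w t / p t = complex_of_real ((r t)\<^sup>2)"
    and "L_infinity {a..b} q"
    and "\<And>j. j \<in> {1..m} \<Longrightarrow>
           right_limit (x j) (periodic_ext a b (\<lambda>t. p t * complex_of_real (r t)))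
           + left_limit (x j) (periodic_ext a b (\<lambda>t. p t * complex_of_real (r t))) \<noteq> 0"
  shows "finite {\<mu>. SL_eigenvalue a b p q w \<phi> \<mu> \<and> Re \<mu> < 0}"
proof -
  note m = assms(1) and x0 = assms(2) and xm = assms(3) and xinc = assms(4)
  define e where "e = exp (\<i> * complex_of_real \<phi>)"
  have e: "cmod e = 1" by (simp add: e_def)
  have xmono: "x i \<le> x k" if "i \<le> k" "k \<le> m" for i k
    using that
  proof (induction k rule: dec_induct)
    case (step k)
    then show ?case using xinc[of k] by simp
  qed simp
  have xstrict: "x i < x k" if "i < k" "k \<le> m" for i k
    using xinc[of i] xmono[of "Suc i" k] that by simp
  have ab: "a < b" using xstrict[of 0 m] m x0 xm by simp
  have sub: "subinterval x (Suc j) = {x j<..<x (Suc j)}" for j by (simp add: subinterval_def)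
  have piece: "{x j..x (Suc j)} \<subseteq> {a..b}" if "j < m" for j
    using xmono[of 0 j] xmono[of "Suc j" m] that x0 xm by auto

  define ext where "ext j s R \<longleftrightarrow> continuous_on {x j..x (Suc j)} s \<and> continuous_on {x j..x (Suc j)} R \<and>
      (\<forall>t\<in>{x j..x (Suc j)}. s t \<noteq> 0) \<and> (\<forall>t\<in>{x j..x (Suc j)}. R t > 0) \<and>
      (\<forall>t\<in>{x j<..<x (Suc j)}. s t = p t * complex_of_real (r t)) \<and>
      (\<forall>t\<in>{x j<..<x (Suc j)}. p t \<noteq> 0 \<and> 1 / p t = complex_of_real (R t) / s t \<and> w t = complex_of_real (R t) * s t)"
    for j and s :: "real \<Rightarrow> complex" and R :: "real \<Rightarrow> real"
  have "\<exists>s R. ext j s R" if j: "j < m" for j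
    unfolding ext_def
  proof (rule coefficient_extension[OF xinc[OF j], of p w r])
    have j1: "Suc j \<in> {1..m}" using j by simp
    show "W2_infinity {x j<..<x (Suc j)} p" "W2_infinity {x j<..<x (Suc j)} w"
      "0 < (INF t\<in>closure {x j<..<x (Suc j)}. cmod (closure_ext {x j<..<x (Suc j)} p t))"
      "0 < (INF t\<in>closure {x j<..<x (Suc j)}. cmod (closure_ext {x j<..<x (Suc j)} w t))"
      using assms(5-8)[OF j1] unfolding sub by blast+
    show "0 < r t" "w t / p t = complex_of_real ((r t)\<^sup>2)" if "t \<in> {x j<..<x (Suc j)}" for t
    proof -
      have "t \<in> {a..b}" using piece[OF j] that by auto
      then show "0 < r t" "w t / p t = complex_of_real ((r t)\<^sup>2)" by (rule assms(9), rule assms(10))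
    qed
  qed (intro exI conjI ballI; blast)
  then obtain s R where sR: "\<And>j. j < m \<Longrightarrow> ext j (s j) (R j)" by metis
  have cs: "continuous_on {x j..x (Suc j)} (s j)" and cR: "continuous_on {x j..x (Suc j)} (R j)" if "j < m" for j
    using sR[OF that] unfolding ext_def by blast+
  have snz: "s j t \<noteq> 0" and Rpos: "R j t > 0" if "j < m" "t \<in> {x j..x (Suc j)}" for j t
    using sR[OF that(1)] that(2) unfolding ext_def by blast+
  have spr: "s j t = p t * complex_of_real (r t)"
    and coef: "p t \<noteq> 0 \<and> 1 / p t = complex_of_real (R j t) / s j t \<and> w t = complex_of_real (R j t) * s j t"
    if "j < m" "t \<in> {x j<..<x (Suc j)}" for j t
    using sR[OF that(1)] that(2) unfolding ext_def by blast+

  let ?pe = "periodic_ext a b (\<lambda>t. p t * complex_of_real (r t))"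
  have pe: "?pe t = s j t" if "j < m" "t \<in> {x j<..<x (Suc j)}" for j t
  proof -
    have "t \<in> {a..<b}" using piece[OF that(1)] that(2) xmono[of "Suc j" m] that(1) xm by auto
    then show ?thesis using periodic_ext_eq[OF ab] spr[OF that] by simp
  qed
  have leftl: "left_limit (x (Suc j)) ?pe = s j (x (Suc j))" if "j < m" for j
    by (rule left_limit_eqI[OF xinc[OF that] cs[OF that] pe[OF that]])
  have rightl: "right_limit (x j) ?pe = s j (x j)" if "j < m" for j
    by (rule right_limit_eqI[OF xinc[OF that] cs[OF that] pe[OF that]])
  have iface: "s j (x (Suc j)) + s (Suc j) (x (Suc j)) \<noteq> 0" if "Suc j < m" for j
    using assms(12)[of "Suc j"] leftl[of j] rightl[of "Suc j"] that by (simp add: add.commute)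
  have iface_end: "s (m - 1) (x m) + s 0 (x 0) \<noteq> 0"
  proof -
    have "right_limit (x m) ?pe = right_limit (a + (b - a)) ?pe" using xm by simp
    also have "\<dots> = right_limit a ?pe"
      unfolding right_limit_shift periodic_ext_period[OF ab] ..
    also have "\<dots> = s 0 (x 0)" using rightl[of 0] m x0 by simp
    finally show ?thesis using assms(12)[of m] leftl[of "m - 1"] m by (simp add: add.commute)
  qed

  obtain Cq0 where Cq0: "AE t in lebesgue_on {a..b}. cmod (q t) \<le> Cq0" and qm: "q \<in> borel_measurable (lebesgue_on {a..b})"
    using assms(11) by (auto simp: L_infinity_def)
  define Cq where "Cq = max Cq0 0"
  define q' where "q' t = (if cmod (q t) \<le> Cq then q t else 0)" for t
  have Cq: "Cq \<ge> 0" "\<And>t. cmod (q' t) \<le> Cq" by (auto simp: q'_def Cq_def)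
  have bq: "bounded_coeff a b Cq q'"
    unfolding bounded_coeff_def q'_def[abs_def] using qm Cq(2) by (auto simp: q'_def)
  obtain \<alpha> K1 where b\<alpha>: "bounded_coeff a b K1 \<alpha>" and \<alpha>: "\<And>j t. j < m \<Longrightarrow> t \<in> {x j<..<x (Suc j)} \<Longrightarrow> \<alpha> t = R j t / s j t"
  proof (rule piecewise_bounded_coeff[OF xmono, where g="\<lambda>j t. complex_of_real (R j t) / s j t"])
    show "continuous_on {x j..x (Suc j)} (\<lambda>t. complex_of_real (R j t) / s j t)" if "j < m" for j
      by (intro continuous_intros cR cs that) (use snz[OF that] in auto)
  qed (use x0 xm in auto)
  obtain W K2 where bW: "bounded_coeff a b K2 W" and W: "\<And>j t. j < m \<Longrightarrow> t \<in> {x j<..<x (Suc j)} \<Longrightarrow> W t = - (R j t * s j t)"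
  proof (rule piecewise_bounded_coeff[OF xmono, where g="\<lambda>j t. - (complex_of_real (R j t) * s j t)"])
    show "continuous_on {x j..x (Suc j)} (\<lambda>t. - (complex_of_real (R j t) * s j t))" if "j < m" for j
      by (intro continuous_intros cR cs that)
  qed (use x0 xm in auto)
  define K where "K = \<bar>K1\<bar> + \<bar>K2\<bar> + Cq"
  define A B where "A i = (if i then \<alpha> else q')" and "B i = (if i then (\<lambda>t. 0) else W)" for i
  have bA: "bounded_coeff a b K (A i)" for i
    using bounded_coeff_mono[OF b\<alpha>, of K] bounded_coeff_mono[OF bq, of K] Cq(1) by (auto simp: A_def K_def)
  have bB: "bounded_coeff a b K (B i)" for i
    using bounded_coeff_mono[OF bW, of K] Cq(1) by (auto simp: B_def K_def bounded_coeff_def)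
  define g where "g \<mu> i t = A i t + \<mu> * B i t" for \<mu> i t
  have bg: "bounded_coeff a b (K + cmod \<mu> * K) (g \<mu> i)" for \<mu> i
    unfolding g_def by (rule bounded_coeff_affine[OF bA bB order_refl])

  have cover: "\<exists>j<m. t \<in> {x j..x (Suc j)}" if t: "t \<in> {a..b}" for t
  proof -
    have "\<exists>j<k. t \<in> {x j..x (Suc j)}" if "k \<ge> 1" "k \<le> m" "t \<le> x k" for k
      using that
    proof (induction k rule: dec_induct)
      case base
      then show ?case using t x0 by auto
    next
      case (step k)
      then show ?case by (cases "t \<le> x k") (auto intro: less_SucI)
    qed
    from this[of m] show ?thesis using m t xm by auto
  qed
  have cover_open: "\<exists>j<m. t \<in> {x j<..<x (Suc j)}" if t: "t \<in> {a..b} - x ` {..m}" for t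
  proof -
    obtain j where j: "j < m" "t \<in> {x j..x (Suc j)}" using cover[of t] t by blast
    then have "t \<noteq> x j" "t \<noteq> x (Suc j)" using t by auto
    then show ?thesis using j by auto
  qed

  \<comment> \<open>The partition points and the points where \<open>q\<close> is too large join the exceptional null set.\<close>
  have eigen_solution: "\<exists>z. volterra_solution a b (g \<mu>) z \<and> (\<exists>t\<in>{a..b}. z True t \<noteq> 0) \<and> (\<forall>i. z i b = e * z i a)"
    if eig: "SL_eigenvalue a b p q w \<phi> \<mu>" for \<mu>
  proof -
    obtain y u where sol: "SL_solution a b p q w \<mu> y u" and nz: "\<exists>t\<in>{a..b}. y t \<noteq> 0"
      and per: "y b = e * y a" "u b = e * u a"
      using eig unfolding SL_eigenvalue_def e_def by blast
    define z where "z i = (if i then y else u)" for i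
    have "AE t in lebesgue_on {a..b}. (\<exists>y' u'.
        (y has_vector_derivative y') (at t within {a..b}) \<and> u t = p t * y' \<and>
        (u has_vector_derivative u') (at t within {a..b}) \<and>
        - u' + q t * y t = \<mu> * w t * y t) \<and> cmod (q t) \<le> Cq0"
      using sol Cq0 unfolding SL_solution_def by (intro AE_conjI) auto
    then have "AE t in lebesgue. t \<in> {a..b} \<longrightarrow> (\<exists>y' u'.
        (y has_vector_derivative y') (at t within {a..b}) \<and> u t = p t * y' \<and>
        (u has_vector_derivative u') (at t within {a..b}) \<and>
        - u' + q t * y t = \<mu> * w t * y t) \<and> cmod (q t) \<le> Cq0"
      by (subst (asm) AE_restrict_space_iff) auto
    then obtain N where N: "negligible N" and ae: "\<And>t. t \<in> {a..b} - N \<Longrightarrow> (\<exists>y' u'.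
        (y has_vector_derivative y') (at t within {a..b}) \<and> u t = p t * y' \<and>
        (u has_vector_derivative u') (at t within {a..b}) \<and>
        - u' + q t * y t = \<mu> * w t * y t) \<and> cmod (q t) \<le> Cq0"
      unfolding eventually_ae_filter_negligible by blast
    have "volterra_solution a b (g \<mu>) z"
    proof (rule abs_continuous_volterra_solution)
      show "a \<le> b" using ab by simp
      show "abs_continuous_on {a..b} (z i)" for i
        using sol by (auto simp: SL_solution_def z_def)
      show "negligible (N \<union> x ` {..m})" using N by (simp add: negligible_finite)
      fix i t assume t: "t \<in> {a..b} - (N \<union> x ` {..m})"
      then obtain j where j: "j < m" "t \<in> {x j<..<x (Suc j)}" using cover_open[of t] by auto
      obtain y' u' where d: "(y has_vector_derivative y') (at t within {a..b})" "u t = p t * y'"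
        "(u has_vector_derivative u') (at t within {a..b})" "- u' + q t * y t = \<mu> * w t * y t" "cmod (q t) \<le> Cq0"
        using ae[of t] t by blast
      have "y' = \<alpha> t * u t"
        using d(2) coef[OF j] \<alpha>[OF j] by (metis nonzero_mult_div_cancel_left times_divide_eq_left mult_1)
      moreover have "u' = (q' t + \<mu> * W t) * y t"
      proof -
        have "q' t = q t" using d(5) by (simp add: q'_def Cq_def)
        moreover have "W t = - w t" using W[OF j] coef[OF j] by simp
        moreover have "u' = q t * y t - \<mu> * w t * y t" using d(4) by (simp add: algebra_simps)
        ultimately show ?thesis by (simp add: algebra_simps)
      qed
      ultimately show "(z i has_vector_derivative g \<mu> i t * z (\<not> i) t) (at t within {a..b})"
        using d(1,3) by (cases i) (simp_all add: z_def g_def A_def B_def)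
    qed
    moreover have "\<exists>t\<in>{a..b}. z True t \<noteq> 0" using nz by (simp add: z_def)
    moreover have "\<forall>i. z i b = e * z i a" using per by (simp add: z_def)
    ultimately show ?thesis by blast
  qed

  have piece_solution: "lipschitz_solution (x j) (x (Suc j)) (\<lambda>t. R j t / s j t) (\<lambda>t. q' t - \<mu> * (R j t * s j t)) (z True) (z False)"
    if z: "volterra_solution a b (g \<mu>) z" and j: "j < m" for \<mu> z j
  proof -
    obtain N where N: "negligible N"
      "\<And>i t. t \<in> {a..b} - N \<Longrightarrow> (z i has_vector_derivative g \<mu> i t * z (\<not> i) t) (at t within {a..b})"
      using volterra_solution_ae_derivative[OF bg z] by blast
    have lipschitz_Icc: "lipschitz_Icc (x j) (x (Suc j)) (z i)" for i
      by (rule lipschitz_Icc_subset[OF volterra_solution_lipschitz[OF bg z]])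
         (use xmono[of 0 j] xmono[of "Suc j" m] j x0 xm in auto)
    have "\<forall>t\<in>{x j..x (Suc j)} - (N \<union> {x j, x (Suc j)}).
       (z True has_vector_derivative R j t / s j t * z False t) (at t within {x j..x (Suc j)}) \<and>
       (z False has_vector_derivative (q' t - \<mu> * (R j t * s j t)) * z True t) (at t within {x j..x (Suc j)})"
    proof
      fix t assume t: "t \<in> {x j..x (Suc j)} - (N \<union> {x j, x (Suc j)})"
      then have tj: "t \<in> {x j<..<x (Suc j)}" and tN: "t \<in> {a..b} - N" using piece[OF j] by auto
      have d: "(z i has_vector_derivative g \<mu> i t * z (\<not> i) t) (at t within {x j..x (Suc j)})" for i
        by (rule has_vector_derivative_within_subset[OF N(2)[OF tN] piece[OF j]])
      show "(z True has_vector_derivative R j t / s j t * z False t) (at t within {x j..x (Suc j)}) \<and>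
       (z False has_vector_derivative (q' t - \<mu> * (R j t * s j t)) * z True t) (at t within {x j..x (Suc j)})"
        using d[of True] d[of False] by (simp add: g_def A_def B_def \<alpha>[OF j tj] W[OF j tj])
    qed
    moreover have "negligible (N \<union> {x j, x (Suc j)})" using N(1) by simp
    ultimately show ?thesis unfolding lipschitz_solution_def using lipschitz_Icc by blast
  qed

  obtain R0 where R0: "\<And>\<mu> q y u. Re \<mu> < 0 \<Longrightarrow> R0 \<le> cmod \<mu> \<Longrightarrow>
      (\<And>t. t \<in> {x 0..x m} \<Longrightarrow> cmod (q t) \<le> Cq) \<Longrightarrow>
      (\<And>j. j < m \<Longrightarrow> lipschitz_solution (x j) (x (Suc j)) (\<lambda>t. R j t / s j t) (\<lambda>t. q t - \<mu> * (R j t * s j t)) y u) \<Longrightarrow>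
      y (x m) = e * y (x 0) \<Longrightarrow> u (x m) = e * u (x 0) \<Longrightarrow>
      (\<forall>j<m. \<forall>t\<in>{x j..x (Suc j)}. y t = 0 \<and> u t = 0)"
    by (rule no_large_eigensolution[OF m xinc cs cR snz Rpos iface iface_end Cq(1) e];
        (assumption | erule that))
  have large: "z True t = 0 \<and> z False t = 0"
    if \<mu>: "Re \<mu> < 0" "R0 \<le> cmod \<mu>" and z: "volterra_solution a b (g \<mu>) z" "\<And>i. z i b = e * z i a" and t: "t \<in> {a..b}" for \<mu> z t
  proof -
    have "\<forall>j<m. \<forall>t\<in>{x j..x (Suc j)}. z True t = 0 \<and> z False t = 0"
      by (rule R0[OF \<mu> Cq(2) piece_solution[OF z(1)]]) (use z(2) x0 xm in auto)
    then show ?thesis using cover[OF t] by blast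
  qed

  obtain D where D: "D holomorphic_on UNIV" and Dz0: "\<And>\<mu>. D \<mu> = 0 \<longleftrightarrow>
      (\<exists>z. volterra_solution a b (\<lambda>i s. A i s + \<mu> * B i s) z \<and> (\<exists>i. z i a \<noteq> 0) \<and> (\<forall>i. z i b = e * z i a))"
    by (rule quasi_periodic_zeros[where A=A and B=B and e=e, OF ab bA bB]) (rule that; assumption)
  have Dz: "D \<mu> = 0 \<longleftrightarrow>
      (\<exists>z. volterra_solution a b (g \<mu>) z \<and> (\<exists>i. z i a \<noteq> 0) \<and> (\<forall>i. z i b = e * z i a))" for \<mu>
    using Dz0[of \<mu>] unfolding g_def[abs_def] .
  have eigD: "D \<mu> = 0 \<and> \<not> R0 \<le> cmod \<mu>" if eig: "SL_eigenvalue a b p q w \<phi> \<mu>" and \<mu>: "Re \<mu> < 0" for \<mu>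
  proof -
    obtain z where z: "volterra_solution a b (g \<mu>) z" "\<exists>t\<in>{a..b}. z True t \<noteq> 0" "\<And>i. z i b = e * z i a"
      using eigen_solution[OF eig] by blast
    have "\<exists>i. z i a \<noteq> 0" using volterra_solution_zero[OF bg z(1)] z(2) by blast
    then have "D \<mu> = 0" using Dz z by blast
    moreover have "\<not> R0 \<le> cmod \<mu>" using large[OF \<mu> _ z(1) z(3)] z(2) by blast
    ultimately show ?thesis by blast
  qed
  have D0: "D (- complex_of_real (\<bar>R0\<bar> + 1)) \<noteq> 0"
  proof
    let ?\<mu> = "- complex_of_real (\<bar>R0\<bar> + 1)"
    assume "D ?\<mu> = 0"
    then obtain z where z: "volterra_solution a b (g ?\<mu>) z" "\<exists>i. z i a \<noteq> 0" "\<And>i. z i b = e * z i a"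
      using Dz by blast
    have "Re ?\<mu> < 0" by simp
    moreover have "R0 \<le> cmod ?\<mu>" unfolding norm_minus_cancel norm_of_real by simp
    ultimately have "z True a = 0 \<and> z False a = 0" using large[OF _ _ z(1,3), of a] ab by simp
    then show False using z(2) by (metis (full_types))
  qed
  show ?thesis
  proof (cases "D constant_on UNIV")
    case True
    then have "D \<mu> \<noteq> 0" for \<mu> using D0 unfolding constant_on_def by (metis UNIV_I)
    then have "{\<mu>. SL_eigenvalue a b p q w \<phi> \<mu> \<and> Re \<mu> < 0} = {}" using eigD by blast
    then show ?thesis by (simp only: finite.emptyI)
  next
    case False
    have "finite {\<mu> \<in> cball 0 R0. D \<mu> = 0}"
      by (rule holomorphic_compact_finite_zeros[OF D open_UNIV connected_UNIV compact_cball _ False]) simp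
    moreover have "{\<mu>. SL_eigenvalue a b p q w \<phi> \<mu> \<and> Re \<mu> < 0} \<subseteq> {\<mu> \<in> cball 0 R0. D \<mu> = 0}"
    proof clarify
      fix \<mu> assume "SL_eigenvalue a b p q w \<phi> \<mu>" "Re \<mu> < 0"
      from eigD[OF this] show "\<mu> \<in> cball 0 R0 \<and> D \<mu> = 0" by auto
    qed
    ultimately show ?thesis by (rule finite_subset[rotated])
  qed
qed

end
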